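(* For real $\beta$ the Ruelle operator $\mathcal{L}_\beta$ and the Kac-Gutzwiller operator $\mathcal{G}_\beta$ with kernel $(\lambda\exp\beta)^{-\frac12}\mathcal{K}_\beta(\xi,\eta)$ have the same eigenvalues (counted with multiplicities) and hence the same spectrum. Their eigenfunctions $F=F(z)$ (of $\mathcal{L}_\beta$) and $f=f(\xi)$ (of $\mathcal{G}_\beta$) to the eigenvalue $\rho$ are related as follows: (1) $$F(z)=(8\pi)^{\frac14}\int_{\mathbb{R}}\sqrt{\cosh(2\sqrt{\pi\beta}\,\xi)}\; f(2\sqrt{\pi}\,\xi)\,\exp\left(2\sqrt{\pi\beta}\,\xi z-\pi\xi^2-\frac{\beta}{2}z^2\right)d\xi.$$ (2) $$f(\xi)=\left(\frac{1}{2\pi}\right)^{\frac14}\frac{1}{\sqrt{\cosh(2\sqrt{\pi\beta}\,\xi)}}\int_{\mathbb{C}}F\left(\sqrt{\frac{\pi}{\beta}}\,z\right)\exp\left(\sqrt{\pi}\,\xi z^{*}-\frac14\xi^2-\frac{\pi}{2}(z^{*})^2-\pi|z|^2\right)dz.$$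
   Context: Here $\lambda=e^{-\gamma}$ with $0<\lambda<1$, and $\beta$ is the inverse temperature (with the interaction strength $J>0$ absorbed into it). The Ruelle operator of the Kac-Baker model is $$(\mathcal{L}_\beta F)(z)=e^{\beta z}F(\lambda+\lambda z)+e^{-\beta z}F(-\lambda+\lambda z).$$ It is a nuclear operator on the Banach space of functions holomorphic in a disc $D_r=\{|z|<r\}$, $r>\frac{\lambda}{1-\lambda}$, and continuous on its closure, with the supremum norm. For the comparison with the Kac-Gutzwiller operator it is considered on the Hilbert space $\mathcal{H}L^2(\mathbb{C},\mu_{|\beta|/\pi})$, where for $t>0$ the space $\mathcal{H}L^2(\mathbb{C},\mu_t)$ consists of the entire functions $F:\mathbb{C}\to\mathbb{C}$ with $\int_{\mathbb{C}}|F(z)|^2\mu_t(z)\,dz<\infty$, $\mu_t(z)=t\exp(-\pi t|z|^2)$. The Kac kernel is $$\mathcal{K}_\beta(\xi,\eta)=\left(\frac{\cosh(\sqrt{\beta}\,\xi)\cosh(\sqrt{\beta}\,\eta)}{\pi\sinh\gamma}\right)^{\frac12}\exp\left(-\frac14\left(\tanh\frac{\gamma}{2}\right)(\xi^2+\eta^2)-\frac{(\xi-\eta)^2}{4\sinh\gamma}\right),$$ and the Kac-Gutzwiller operator is the integral operator on $L^2(\mathbb{R},d\xi)$ given by $(\mathcal{G}_\beta f)(\xi)=(\lambda\exp\beta)^{-\frac12}\int_{\mathbb{R}}\mathcal{K}_\beta(\xi,\eta)f(\eta)\,d\eta$. Integrals over $\mathbb{C}$ are with respect to Lebesgue measure $dz$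 on $\mathbb{C}\cong\mathbb{R}^2$, and $z^*$ denotes the complex conjugate of $z$.
   Formalization: In (2) the prefactor is corrected to 1/√cosh(√β ξ), as the printed 1/√cosh(2√(πβ) ξ) contradicts (1); β = 0 is excluded, as √(π/β) and the space are undefined there; for β < 0 the root of the cosh product in the kernel is the product of principal roots. *)

theory Defs
  imports "HOL-Analysis.Analysis" "HOL-Library.Extended_Nat"
begin

text \<open>
  The Hilbert spaces below are spaces of square integrable functions, represented by a measure
  \<open>M\<close> together with a set \<open>V\<close> of functions. Two functions denote the same vector iff they agree
  almost everywhere with respect to \<open>M\<close>; an operator is a map on functions, and all notions
  for operators are taken modulo this identification.
\<close>

definition square_integrable :: "'a measure \<Rightarrow> ('a \<Rightarrow> complex) set" where
  "square_integrable M =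
     {f. f \<in> borel_measurable M \<and> integrable M (\<lambda>x. (cmod (f x))\<^sup>2)}"

definition l2_norm :: "'a measure \<Rightarrow> ('a \<Rightarrow> complex) \<Rightarrow> real" where
  "l2_norm M f = sqrt (\<integral>x. (cmod (f x))\<^sup>2 \<partial>M)"

definition bounded_operator_on ::
  "'a measure \<Rightarrow> ('a \<Rightarrow> complex) set \<Rightarrow> (('a \<Rightarrow> complex) \<Rightarrow> 'a \<Rightarrow> complex) \<Rightarrow> bool" where
  "bounded_operator_on M V T \<longleftrightarrow>
     (\<forall>f\<in>V. T f \<in> V) \<and>
     (\<forall>f\<in>V. \<forall>g\<in>V. \<forall>a b.
        AE x in M. T (\<lambda>y. a * f y + b * g y) x = a * T f x + b * T g x) \<and>
     (\<exists>C. \<forall>f\<in>V. l2_norm M (T f) \<le> C * l2_norm M f)"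

definition shifted ::
  "(('a \<Rightarrow> complex) \<Rightarrow> 'a \<Rightarrow> complex) \<Rightarrow> complex \<Rightarrow> ('a \<Rightarrow> complex) \<Rightarrow> 'a \<Rightarrow> complex" where
  "shifted T \<rho> f = (\<lambda>x. T f x - \<rho> * f x)"

definition eigenfunction ::
  "'a measure \<Rightarrow> ('a \<Rightarrow> complex) set \<Rightarrow> (('a \<Rightarrow> complex) \<Rightarrow> 'a \<Rightarrow> complex) \<Rightarrow>
   complex \<Rightarrow> ('a \<Rightarrow> complex) \<Rightarrow> bool" where
  "eigenfunction M V T \<rho> f \<longleftrightarrow>
     f \<in> V \<and> \<not> (AE x in M. f x = 0) \<and> (AE x in M. T f x = \<rho> * f x)"

definition eigenvalues ::
  "'a measure \<Rightarrow> ('a \<Rightarrow> complex) set \<Rightarrow> (('a \<Rightarrow> complex) \<Rightarrow> 'a \<Rightarrow> complex) \<Rightarrow> complex set" where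
  "eigenvalues M V T = {\<rho>. \<exists>f. eigenfunction M V T \<rho> f}"

definition lin_indep_AE :: "'a measure \<Rightarrow> ('a \<Rightarrow> complex) set \<Rightarrow> bool" where
  "lin_indep_AE M B \<longleftrightarrow>
     (\<forall>c. (AE x in M. (\<Sum>f\<in>B. c f * f x) = 0) \<longrightarrow> (\<forall>f\<in>B. c f = 0))"

text \<open>Complex dimension of the space of classes modulo \<open>M\<close>-null functions represented in \<open>W\<close>.\<close>

definition dim_AE :: "'a measure \<Rightarrow> ('a \<Rightarrow> complex) set \<Rightarrow> enat" where
  "dim_AE M W = (SUP B \<in> {B. finite B \<and> B \<subseteq> W \<and> lin_indep_AE M B}. enat (card B))"

definition geometric_multiplicity ::
  "'a measure \<Rightarrow> ('a \<Rightarrow> complex) set \<Rightarrow> (('a \<Rightarrow> complex) \<Rightarrow> 'a \<Rightarrow> complex) \<Rightarrow> complex \<Rightarrow> enat" where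
  "geometric_multiplicity M V T \<rho> =
     dim_AE M {f\<in>V. AE x in M. shifted T \<rho> f x = 0}"

definition algebraic_multiplicity ::
  "'a measure \<Rightarrow> ('a \<Rightarrow> complex) set \<Rightarrow> (('a \<Rightarrow> complex) \<Rightarrow> 'a \<Rightarrow> complex) \<Rightarrow> complex \<Rightarrow> enat" where
  "algebraic_multiplicity M V T \<rho> =
     dim_AE M {f\<in>V. \<exists>k. AE x in M. (shifted T \<rho> ^^ k) f x = 0}"

text \<open>\<open>T - \<rho>\<close> is surjective, injective, and its inverse is bounded.\<close>

definition resolvent_set ::
  "'a measure \<Rightarrow> ('a \<Rightarrow> complex) set \<Rightarrow> (('a \<Rightarrow> complex) \<Rightarrow> 'a \<Rightarrow> complex) \<Rightarrow> complex set" where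
  "resolvent_set M V T = {\<rho>.
     (\<forall>g\<in>V. \<exists>f\<in>V. AE x in M. shifted T \<rho> f x = g x) \<and>
     (\<forall>f\<in>V. (AE x in M. shifted T \<rho> f x = 0) \<longrightarrow> (AE x in M. f x = 0)) \<and>
     (\<exists>C. \<forall>f\<in>V. l2_norm M f \<le> C * l2_norm M (shifted T \<rho> f))}"

definition op_spectrum ::
  "'a measure \<Rightarrow> ('a \<Rightarrow> complex) set \<Rightarrow> (('a \<Rightarrow> complex) \<Rightarrow> 'a \<Rightarrow> complex) \<Rightarrow> complex set" where
  "op_spectrum M V T = - resolvent_set M V T"

text \<open>
  The space \<open>HL\<^sup>2(\<complex>, \<mu>\<^sub>t)\<close>. For \<open>t > 0\<close> its measure has the same null sets as Lebesgue measure, so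
  for entire functions equality almost everywhere is equality everywhere.
\<close>

definition fock_measure :: "real \<Rightarrow> complex measure" where
  "fock_measure t = density lborel (\<lambda>z. ennreal (t * exp (- pi * t * (cmod z)\<^sup>2)))"

definition HL2 :: "real \<Rightarrow> (complex \<Rightarrow> complex) set" where
  "HL2 t = {F. F holomorphic_on UNIV \<and> F \<in> square_integrable (fock_measure t)}"

definition ruelle_op ::
  "real \<Rightarrow> real \<Rightarrow> (complex \<Rightarrow> complex) \<Rightarrow> complex \<Rightarrow> complex" where
  "ruelle_op lam \<beta> F = (\<lambda>z.
     exp (of_real \<beta> * z) * F (of_real lam + of_real lam * z) +
     exp (- (of_real \<beta> * z)) * F (- of_real lam + of_real lam * z))"

text \<open>
  For \<open>\<beta> < 0\<close> the number \<open>sqrt_beta \<beta>\<close> is imaginary and \<open>cosh (sqrt_beta \<beta> * \<xi>)\<close> is the cosine of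
  \<open>sqrt \<bar>\<beta>\<bar> * \<xi>\<close>, which changes sign. Branches are fixed as follows: the square roots of
  \<open>\<pi>\<beta>\<close> and \<open>\<pi>/\<beta>\<close> are \<open>sqrt \<pi> * sqrt_beta \<beta>\<close> and \<open>sqrt \<pi> / sqrt_beta \<beta>\<close>, and the square root
  of the product of the two hyperbolic cosines in the Kac kernel is the product of their
  principal square roots. For \<open>\<beta> > 0\<close> all these roots are the positive ones.
\<close>

definition sqrt_beta :: "real \<Rightarrow> complex" where
  "sqrt_beta \<beta> = csqrt (of_real \<beta>)"

definition kac_kernel :: "real \<Rightarrow> real \<Rightarrow> real \<Rightarrow> real \<Rightarrow> complex" where
  "kac_kernel \<gamma> \<beta> \<xi> \<eta> =
     csqrt (cosh (sqrt_beta \<beta> * of_real \<xi>)) * csqrt (cosh (sqrt_beta \<beta> * of_real \<eta>))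
       / of_real (sqrt (pi * sinh \<gamma>))
     * of_real (exp (- (1/4) * tanh (\<gamma> / 2) * (\<xi>\<^sup>2 + \<eta>\<^sup>2) - (\<xi> - \<eta>)\<^sup>2 / (4 * sinh \<gamma>)))"

definition gutzwiller_op ::
  "real \<Rightarrow> real \<Rightarrow> (real \<Rightarrow> complex) \<Rightarrow> real \<Rightarrow> complex" where
  "gutzwiller_op \<gamma> \<beta> f = (\<lambda>\<xi>.
     of_real ((exp (- \<gamma>) * exp \<beta>) powr (- 1/2)) *
       (\<integral>\<eta>. kac_kernel \<gamma> \<beta> \<xi> \<eta> * f \<eta> \<partial>lborel))"

definition ruelle_integrand ::
  "real \<Rightarrow> (real \<Rightarrow> complex) \<Rightarrow> complex \<Rightarrow> real \<Rightarrow> complex" where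
  "ruelle_integrand \<beta> f z \<xi> =
     csqrt (cosh (2 * (of_real (sqrt pi) * sqrt_beta \<beta>) * of_real \<xi>)) *
     f (2 * sqrt pi * \<xi>) *
     exp (2 * (of_real (sqrt pi) * sqrt_beta \<beta>) * of_real \<xi> * z
          - of_real (pi * \<xi>\<^sup>2) - of_real (\<beta> / 2) * z\<^sup>2)"

definition gutzwiller_to_ruelle ::
  "real \<Rightarrow> (real \<Rightarrow> complex) \<Rightarrow> complex \<Rightarrow> complex" where
  "gutzwiller_to_ruelle \<beta> f = (\<lambda>z.
     of_real ((8 * pi) powr (1/4)) * (\<integral>\<xi>. ruelle_integrand \<beta> f z \<xi> \<partial>lborel))"

definition gutzwiller_integrand ::
  "real \<Rightarrow> (complex \<Rightarrow> complex) \<Rightarrow> real \<Rightarrow> complex \<Rightarrow> complex" where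
  "gutzwiller_integrand \<beta> F \<xi> z =
     F (of_real (sqrt pi) / sqrt_beta \<beta> * z) *
     exp (of_real (sqrt pi * \<xi>) * cnj z - of_real (\<xi>\<^sup>2 / 4)
          - of_real (pi / 2) * (cnj z)\<^sup>2 - of_real (pi * (cmod z)\<^sup>2))"

text \<open>
  The factor in front of the integral is \<open>1 / sqrt (cosh (sqrt \<beta> * \<xi>))\<close>: inverting
  \<^const>\<open>gutzwiller_to_ruelle\<close> first yields
  \<open>sqrt (cosh (2 * sqrt (\<pi>\<beta>) * \<xi>)) * f (2 * sqrt \<pi> * \<xi>)\<close>, and rescaling
  \<open>\<xi>\<close> by \<open>1 / (2 * sqrt \<pi>)\<close> to get \<open>f \<xi>\<close> also rescales the argument of the hyperbolic cosine
  (the value \<open>2 * sqrt (\<pi>\<beta>) * \<xi>\<close> printed in the source for this argument is a misprint).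
  For \<open>\<beta> < 0\<close> this factor is undefined on a null set only.
\<close>

definition ruelle_to_gutzwiller ::
  "real \<Rightarrow> (complex \<Rightarrow> complex) \<Rightarrow> real \<Rightarrow> complex" where
  "ruelle_to_gutzwiller \<beta> F = (\<lambda>\<xi>.
     of_real ((1 / (2 * pi)) powr (1/4)) *
     (1 / csqrt (cosh (sqrt_beta \<beta> * of_real \<xi>))) *
     (\<integral>z. gutzwiller_integrand \<beta> F \<xi> z \<partial>lborel))"

end

theory Submission
  imports Defs "HOL-Probability.Levy" "HOL-Complex_Analysis.Complex_Analysis"
begin

text \<open>
  Up to rescaling, \<^const>\<open>gutzwiller_to_ruelle\<close> is the Bargmann transform after multiplication by
  \<open>c = sqrt (cosh (sqrt \<beta> * \<xi>))\<close>. The Bargmann transform turns the Gaussian part of the Kac kernel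
  into the dilation \<open>z \<mapsto> lam * z\<close> and multiplication by \<open>cosh (sqrt \<beta> * \<xi>)\<close> into the shifts in the
  Ruelle operator, so it intertwines \<open>\<G>\<close> and \<open>\<L>\<close>. As \<open>c\<close> is unbounded for \<open>\<beta> > 0\<close>, the intertwiner
  \<open>A\<close> does not map all of \<open>L\<^sup>2\<close> into the Fock space, but \<open>X = \<L> A\<close> does. An intertwiner \<open>Y\<close> in the
  other direction is the inverse transform applied after the dilation; it satisfies \<open>A Y = \<L>\<close>. Both
  are bounded and injective with \<open>X Y = \<L>\<^sup>2\<close> and \<open>Y X = \<G>\<^sup>2\<close>, and this already transfers
  eigenvalues, multiplicities and resolvents. Eigenfunctions of \<open>\<L>\<close> inherit from the dilation a
  growth rate strictly below that of the Fock space, which is what makes the integral over \<open>\<complex>\<close>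
  in the inverse transform absolutely convergent; the inversion formula is then Fubini and the
  reproducing property of the kernel \<open>exp (\<pi> * w * cnj z)\<close>.
\<close>

section \<open>Operators modulo null functions\<close>

text \<open>Write \<open>R\<close> for \<open>ruelle_to_gutzwiller \<beta>\<close>, formally the
  inverse of \<open>A\<close>. Then \<open>X\<close> is also \<open>A\<close> after
  \<open>\<G>\<close>, and \<open>Y\<close> is formally \<open>\<G>\<close> after \<open>R\<close>:
  each direction carries one extra factor of the operator, which smooths enough to make it bounded,
  and this is where the squares in \<open>X Y\<close> and \<open>Y X\<close> come from. Being
  products of injections, these squares make both operators injective, so 0 is no eigenvalue, and an
  eigenfunction is its own image divided by the eigenvalue. Negative \<beta> is the second obstacle:
  the hyperbolic cosine becomes a cosine, the principal square root jumps, and \<open>R\<close>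
  divides by a function with real zeros. The computations go through the square
  \<open>cc x * cc x\<close>, which does not depend on the branch, and the zeros form a countable
  set. As \<open>R F\<close> is not visibly square integrable, it is identified almost everywhere
  with a multiple of \<open>Y F\<close>, which multiplies by \<open>cc\<close> where
  \<open>R\<close> divides.\<close>

definition l2_subspace :: "'a measure \<Rightarrow> ('a \<Rightarrow> complex) set \<Rightarrow> bool" where
  "l2_subspace M V \<longleftrightarrow> V \<subseteq> square_integrable M \<and> (\<lambda>x. 0) \<in> V \<and>
     (\<forall>f\<in>V. \<forall>g\<in>V. \<forall>a b. (\<lambda>x. a * f x + b * g x) \<in> V)"

definition bounded_map_on ::
  "'a measure \<Rightarrow> ('a \<Rightarrow> complex) set \<Rightarrow> 'b measure \<Rightarrow> ('b \<Rightarrow> complex) set \<Rightarrow>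
   (('a \<Rightarrow> complex) \<Rightarrow> 'b \<Rightarrow> complex) \<Rightarrow> bool" where
  "bounded_map_on M V N W X \<longleftrightarrow>
     (\<forall>f\<in>V. X f \<in> W) \<and>
     (\<forall>f\<in>V. \<forall>g\<in>V. \<forall>a b.
        AE x in N. X (\<lambda>y. a * f y + b * g y) x = a * X f x + b * X g x) \<and>
     (\<exists>C. \<forall>f\<in>V. l2_norm N (X f) \<le> C * l2_norm M f)"

lemma bounded_operator_on_iff: "bounded_operator_on M V T \<longleftrightarrow> bounded_map_on M V M V T"
  by (simp add: bounded_operator_on_def bounded_map_on_def)

lemma square_integrableD:
  assumes "f \<in> square_integrable M"
  shows "f \<in> borel_measurable M" "integrable M (\<lambda>x. (cmod (f x))\<^sup>2)"
  using assms by (auto simp: square_integrable_def)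

lemma l2_norm_nonneg [simp]: "0 \<le> l2_norm M f"
  by (simp add: l2_norm_def)

lemma l2_norm_sq: "(l2_norm M f)\<^sup>2 = (\<integral>x. (cmod (f x))\<^sup>2 \<partial>M)"
  by (simp add: l2_norm_def)

lemma l2_norm_eq_0_iff:
  assumes "f \<in> square_integrable M"
  shows "l2_norm M f = 0 \<longleftrightarrow> (AE x in M. f x = 0)"
  using integral_nonneg_eq_0_iff_AE[OF square_integrableD(2)[OF assms]]
  by (simp add: l2_norm_def)

lemma l2_norm_cong_AE:
  assumes "f \<in> borel_measurable M" "g \<in> borel_measurable M" "AE x in M. f x = g x"
  shows "l2_norm M f = l2_norm M g"
  unfolding l2_norm_def using assms
  by (intro arg_cong[where f = sqrt] integral_cong_AE) auto

lemma norm_add_sq_le: "(cmod (x + y))\<^sup>2 \<le> 2 * (cmod x)\<^sup>2 + 2 * (cmod y)\<^sup>2"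
proof -
  have "(cmod (x + y))\<^sup>2 \<le> (cmod x + cmod y)\<^sup>2"
    by (simp add: norm_triangle_ineq)
  also have "\<dots> \<le> 2 * (cmod x)\<^sup>2 + 2 * (cmod y)\<^sup>2"
    using zero_le_power2[of "cmod x - cmod y"] by (simp add: power2_eq_square algebra_simps)
  finally show ?thesis .
qed

lemma square_integrable_lincomb:
  assumes f: "f \<in> square_integrable M" and g: "g \<in> square_integrable M"
  shows "(\<lambda>x. a * f x + b * g x) \<in> square_integrable M"
    and "l2_norm M (\<lambda>x. a * f x + b * g x) \<le> 2 * (cmod a * l2_norm M f + cmod b * l2_norm M g)"
proof -
  note [measurable] = square_integrableD(1)[OF f] square_integrableD(1)[OF g]
  note [simp] = square_integrableD(2)[OF f] square_integrableD(2)[OF g]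
  let ?h = "\<lambda>x. a * f x + b * g x"
  let ?B = "\<lambda>x. 2 * (cmod a)\<^sup>2 * (cmod (f x))\<^sup>2 + 2 * (cmod b)\<^sup>2 * (cmod (g x))\<^sup>2"
  have le: "(cmod (?h x))\<^sup>2 \<le> ?B x" for x
    using norm_add_sq_le[of "a * f x" "b * g x"] by (simp add: norm_mult power_mult_distrib)
  have B: "integrable M ?B" by simp
  have "integrable M (\<lambda>x. (cmod (?h x))\<^sup>2)"
    by (rule Bochner_Integration.integrable_bound[OF B])
       (auto intro!: AE_I2 order_trans[OF le])
  then show h: "?h \<in> square_integrable M"
    by (auto simp: square_integrable_def)
  have "(l2_norm M ?h)\<^sup>2 \<le> (\<integral>x. ?B x \<partial>M)"
    unfolding l2_norm_sq by (rule integral_mono[OF square_integrableD(2)[OF h] B le])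
  also have "\<dots> = 2 * (cmod a * l2_norm M f)\<^sup>2 + 2 * (cmod b * l2_norm M g)\<^sup>2"
    by (simp add: power_mult_distrib l2_norm_sq)
  also have "\<dots> \<le> (2 * (cmod a * l2_norm M f + cmod b * l2_norm M g))\<^sup>2"
    by (simp add: power2_eq_square algebra_simps)
  finally show "l2_norm M ?h \<le> 2 * (cmod a * l2_norm M f + cmod b * l2_norm M g)"
    by (rule power2_le_imp_le) simp
qed

lemma l2_subspaceD:
  assumes "l2_subspace M V"
  shows "f \<in> V \<Longrightarrow> f \<in> square_integrable M" "f \<in> V \<Longrightarrow> f \<in> borel_measurable M"
    and "(\<lambda>x. 0) \<in> V"
    and "f \<in> V \<Longrightarrow> g \<in> V \<Longrightarrow> (\<lambda>x. a * f x + b * g x) \<in> V"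
  using assms by (auto simp: l2_subspace_def square_integrable_def)

lemma l2_subspace_square_integrable: "l2_subspace M (square_integrable M)"
  unfolding l2_subspace_def using square_integrable_lincomb(1)[of _ M]
  by (auto simp: square_integrable_def)

context
  fixes M V N W X
  assumes V: "l2_subspace M V" and W: "l2_subspace N W" and X: "bounded_map_on M V N W X"
begin

lemma map_in: "f \<in> V \<Longrightarrow> X f \<in> W"
  using X by (simp add: bounded_map_on_def)

lemma map_lin:
  "f \<in> V \<Longrightarrow> g \<in> V \<Longrightarrow> AE x in N. X (\<lambda>y. a * f y + b * g y) x = a * X f x + b * X g x"
  using X by (simp add: bounded_map_on_def)

lemma map_bound: obtains C where "0 \<le> C" "\<And>f. f \<in> V \<Longrightarrow> l2_norm N (X f) \<le> C * l2_norm M f"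
proof -
  obtain C where C: "\<And>f. f \<in> V \<Longrightarrow> l2_norm N (X f) \<le> C * l2_norm M f"
    using X unfolding bounded_map_on_def by blast
  show ?thesis
  proof (rule that[of "max C 0"])
    fix f assume "f \<in> V"
    have "C * l2_norm M f \<le> max C 0 * l2_norm M f"
      by (intro mult_right_mono) auto
    with C[OF \<open>f \<in> V\<close>] show "l2_norm N (X f) \<le> max C 0 * l2_norm M f" by simp
  qed simp
qed

text \<open>\<open>X\<close> acts on functions, not on classes. The norm bound is what forces it to
  respect equality almost everywhere, and \<open>map_cong\<close> then allows rewriting under
  \<open>X\<close>.\<close>

lemma map_null:
  assumes f: "f \<in> V" and 0: "AE x in M. f x = 0"
  shows "AE x in N. X f x = 0"
proof -
  obtain C where C: "\<And>f. f \<in> V \<Longrightarrow> l2_norm N (X f) \<le> C * l2_norm M f"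
    using map_bound by blast
  have "l2_norm M f = 0" using 0 l2_norm_eq_0_iff l2_subspaceD(1)[OF V f] by blast
  then have "l2_norm N (X f) = 0"
    using C[OF f] l2_norm_nonneg[of N "X f"] by simp
  then show ?thesis using l2_norm_eq_0_iff l2_subspaceD(1)[OF W map_in[OF f]] by blast
qed

lemma map_cong:
  assumes f: "f \<in> V" and g: "g \<in> V" and fg: "AE x in M. f x = g x"
  shows "AE x in N. X f x = X g x"
proof -
  have "AE x in N. X (\<lambda>y. 1 * f y + (-1) * g y) x = 0"
    by (rule map_null[OF l2_subspaceD(4)[OF V f g]]) (use fg in auto)
  with map_lin[OF f g, of 1 "-1"] show ?thesis
    by eventually_elim auto
qed

lemma map_lin_AE:
  assumes "f \<in> V" "g \<in> V" "h \<in> V" and "AE x in M. h x = a * f x + b * g x"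
  shows "AE x in N. X h x = a * X f x + b * X g x"
  using map_cong[OF assms(3) l2_subspaceD(4)[OF V assms(1,2)] assms(4)] map_lin[OF assms(1,2), of a b]
  by eventually_elim simp

lemma lincomb_in:
  assumes "finite B" "\<And>f. f \<in> B \<Longrightarrow> v f \<in> V"
  shows "(\<lambda>x. \<Sum>f\<in>B. c f * v f x) \<in> V"
  using assms
proof (induction B rule: finite_induct)
  case empty
  then show ?case using l2_subspaceD(3)[OF V] by simp
next
  case (insert f B)
  have "(\<lambda>x. c f * v f x + 1 * (\<Sum>f\<in>B. c f * v f x)) \<in> V"
    by (rule l2_subspaceD(4)[OF V]) (use insert in auto)
  with insert show ?case by simp
qed

lemma map_sum:
  assumes "finite B" "B \<subseteq> V"
  shows "AE x in N. X (\<lambda>x. \<Sum>f\<in>B. c f * f x) x = (\<Sum>f\<in>B. c f * X f x)"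
  using assms
proof (induction B rule: finite_induct)
  case empty
  show ?case using map_null[OF l2_subspaceD(3)[OF V]] by simp
next
  case (insert f B)
  have "AE x in N. X (\<lambda>x. \<Sum>f\<in>insert f B. c f * f x) x
      = c f * X f x + 1 * X (\<lambda>x. \<Sum>f\<in>B. c f * f x) x"
  proof (rule map_lin_AE)
    show *: "(\<lambda>x. \<Sum>f\<in>B. c f * f x) \<in> V"
      using insert lincomb_in[of B "\<lambda>f. f"] by auto
    show "(\<lambda>x. \<Sum>f\<in>insert f B. c f * f x) \<in> V"
      using insert l2_subspaceD(4)[OF V _ *, of f "c f" 1] by auto
  qed (use insert in auto)
  moreover have "AE x in N. X (\<lambda>x. \<Sum>f\<in>B. c f * f x) x = (\<Sum>f\<in>B. c f * X f x)"
    using insert by auto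
  ultimately show ?case using insert by (auto elim: eventually_mono)
qed

text \<open>Independence survives an injective map. Used in both directions, this yields equal
  multiplicities from two injections.\<close>

lemma dim_AE_le:
  assumes inj: "\<And>f. f \<in> V \<Longrightarrow> AE x in N. X f x = 0 \<Longrightarrow> AE x in M. f x = 0"
    and K: "K \<subseteq> V" "\<And>f. f \<in> K \<Longrightarrow> X f \<in> L"
  shows "dim_AE M K \<le> dim_AE N L"
  unfolding dim_AE_def
proof (rule SUP_least)
  fix B assume "B \<in> {B. finite B \<and> B \<subseteq> K \<and> lin_indep_AE M B}"
  then have B: "finite B" "B \<subseteq> K" "lin_indep_AE M B" by auto
  have BV: "B \<subseteq> V" using B K by blast
  have indep: "\<forall>f\<in>B. c f = 0" if "AE x in N. (\<Sum>f\<in>B. c f * X f x) = 0" for c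
  proof -
    have "AE x in N. X (\<lambda>x. \<Sum>f\<in>B. c f * f x) x = 0"
      using map_sum[OF B(1) BV, of c] that by eventually_elim simp
    then have "AE x in M. (\<Sum>f\<in>B. c f * f x) = 0"
      using inj[OF lincomb_in[OF B(1), of "\<lambda>f. f"]] BV by blast
    then show ?thesis using B(3) by (auto simp: lin_indep_AE_def)
  qed
  \<comment> \<open>Dimension counts functions, not classes, so \<open>X\<close> must be literally
    injective on \<open>B\<close>: two distinct members with the same image would give a relation
    with coefficients 1 and -1.\<close>
  have injX: "inj_on X B"
  proof (rule inj_onI, rule ccontr)
    fix f g assume fg: "f \<in> B" "g \<in> B" "X f = X g" "f \<noteq> g"
    define c where "c h = (if h = f then 1 else if h = g then -1 else 0 :: complex)" for h
    have "(\<Sum>h\<in>B. c h * X h x) = (\<Sum>h\<in>{f, g}. c h * X h x)" for x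
      by (rule sum.mono_neutral_right) (use B(1) fg in \<open>auto simp: c_def\<close>)
    then have "(\<Sum>h\<in>B. c h * X h x) = 0" for x
      using fg by (simp add: c_def)
    then have "c f = 0" using indep[of c] fg by simp
    then show False by (simp add: c_def)
  qed
  have "lin_indep_AE N (X ` B)"
    unfolding lin_indep_AE_def
  proof (intro allI impI)
    fix c assume "AE x in N. (\<Sum>f\<in>X ` B. c f * f x) = 0"
    then have "\<forall>f\<in>B. c (X f) = 0"
      by (intro indep) (simp add: sum.reindex[OF injX])
    then show "\<forall>f\<in>X ` B. c f = 0" by simp
  qed
  then have "X ` B \<in> {B. finite B \<and> B \<subseteq> L \<and> lin_indep_AE N B}"
    using B K by auto
  from SUP_upper[OF this, of "\<lambda>B. enat (card B)"]
  show "enat (card B) \<le> (SUP B\<in>{B. finite B \<and> B \<subseteq> L \<and> lin_indep_AE N B}. enat (card B))"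
    by (simp add: card_image[OF injX])
qed

end

section \<open>Shifted operators and the resolvent set\<close>

lemma shifted_in:
  assumes "l2_subspace M V" "bounded_map_on M V M V T" "f \<in> V"
  shows "shifted T \<rho> f \<in> V"
  using l2_subspaceD(4)[OF assms(1) map_in[OF assms(1,1,2,3)] assms(3), of 1 "-\<rho>"]
  by (simp add: shifted_def)

lemma shifted_pow_in:
  assumes "l2_subspace M V" "bounded_map_on M V M V T" "f \<in> V"
  shows "(shifted T \<rho> ^^ k) f \<in> V"
  by (induction k) (use assms shifted_in in auto)

lemma resolvent_set_iff:
  assumes "l2_subspace M V" "bounded_map_on M V M V T"
  shows "\<rho> \<in> resolvent_set M V T \<longleftrightarrow>
     (\<forall>g\<in>V. \<exists>f\<in>V. AE x in M. shifted T \<rho> f x = g x) \<and>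
     (\<exists>C. \<forall>f\<in>V. l2_norm M f \<le> C * l2_norm M (shifted T \<rho> f))"
proof -
  have "AE x in M. f x = 0"
    if C: "\<forall>f\<in>V. l2_norm M f \<le> C * l2_norm M (shifted T \<rho> f)" and f: "f \<in> V"
      and 0: "AE x in M. shifted T \<rho> f x = 0" for C f
  proof -
    have "l2_norm M (shifted T \<rho> f) = 0"
      using 0 l2_norm_eq_0_iff[OF l2_subspaceD(1)[OF assms(1) shifted_in[OF assms f]]] by blast
    with C f have "l2_norm M f \<le> 0" by fastforce
    then have "l2_norm M f = 0" using l2_norm_nonneg[of M f] by linarith
    then show ?thesis using l2_norm_eq_0_iff[OF l2_subspaceD(1)[OF assms(1) f]] by blast
  qed
  then show ?thesis unfolding resolvent_set_def by blast
qed

text \<open>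
  Two operators that factor, in a common power, through bounded injective intertwiners in both
  directions have the same spectral data; neither intertwiner needs to be onto.
\<close>

locale square_intertwined =
  fixes M V T N W S X Y
  assumes V: "l2_subspace M V" and W: "l2_subspace N W"
    and T: "bounded_map_on M V M V T" and S: "bounded_map_on N W N W S"
    and X: "bounded_map_on N W M V X" and Y: "bounded_map_on M V N W Y"
    and X_inj: "\<And>f. f \<in> W \<Longrightarrow> AE x in M. X f x = 0 \<Longrightarrow> AE x in N. f x = 0"
    and Y_inj: "\<And>F. F \<in> V \<Longrightarrow> AE x in N. Y F x = 0 \<Longrightarrow> AE x in M. F x = 0"
    and TX: "\<And>f. f \<in> W \<Longrightarrow> AE x in M. T (X f) x = X (S f) x"
    and SY: "\<And>F. F \<in> V \<Longrightarrow> AE x in N. S (Y F) x = Y (T F) x"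
    and XY: "\<And>F. F \<in> V \<Longrightarrow> AE x in M. X (Y F) x = T (T F) x"
    and YX: "\<And>f. f \<in> W \<Longrightarrow> AE x in N. Y (X f) x = S (S f) x"
begin

lemma swap: "square_intertwined N W S M V T Y X"
  by unfold_locales (fact V W T S X Y X_inj Y_inj TX SY XY YX)+

lemmas T_in = map_in[OF V V T] and S_in = map_in[OF W W S]
  and X_in = map_in[OF W V X] and Y_in = map_in[OF V W Y]

lemma shifted_intertwine:
  assumes f: "f \<in> W"
  shows "AE x in M. shifted T \<rho> (X f) x = X (shifted S \<rho> f) x"
proof -
  have "AE x in M. X (\<lambda>x. 1 * S f x + (- \<rho>) * f x) x = 1 * X (S f) x + (- \<rho>) * X f x"
    by (rule map_lin[OF W V X S_in[OF f] f])
  with TX[OF f] show ?thesis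
    by eventually_elim (simp add: shifted_def)
qed

lemma shifted_pow_intertwine:
  assumes f: "f \<in> W"
  shows "AE x in M. (shifted T \<rho> ^^ k) (X f) x = X ((shifted S \<rho> ^^ k) f) x"
proof (induction k)
  case (Suc k)
  let ?u = "(shifted T \<rho> ^^ k) (X f)" and ?v = "(shifted S \<rho> ^^ k) f"
  have v: "?v \<in> W" using shifted_pow_in[OF W S f] .
  have u: "?u \<in> V" using shifted_pow_in[OF V T X_in[OF f]] .
  have "AE x in M. T ?u x = T (X ?v) x"
    by (rule map_cong[OF V V T u X_in[OF v] Suc])
  with shifted_intertwine[OF v, of \<rho>] Suc show ?case
    by eventually_elim (simp add: shifted_def[of T \<rho> ?u] shifted_def[of T \<rho> "X ?v"])
qed simp

lemma kernel_intertwine: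
  assumes f: "f \<in> W" and 0: "AE x in N. (shifted S \<rho> ^^ k) f x = 0"
  shows "AE x in M. (shifted T \<rho> ^^ k) (X f) x = 0"
  using shifted_pow_intertwine[OF f, where \<rho> = \<rho> and k = k] map_null[OF W V X shifted_pow_in[OF W S f] 0]
  by eventually_elim simp

lemma geometric_multiplicity_le:
  "geometric_multiplicity N W S \<rho> \<le> geometric_multiplicity M V T \<rho>"
  unfolding geometric_multiplicity_def
  by (rule dim_AE_le[OF W V X X_inj]) (use X_in kernel_intertwine[where k = 1] in auto)

lemma algebraic_multiplicity_le:
  "algebraic_multiplicity N W S \<rho> \<le> algebraic_multiplicity M V T \<rho>"
  unfolding algebraic_multiplicity_def
  by (rule dim_AE_le[OF W V X X_inj]) (use X_in kernel_intertwine in blast)+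

lemma eigenvalues_le: "eigenvalues N W S \<subseteq> eigenvalues M V T"
proof
  fix \<rho> assume "\<rho> \<in> eigenvalues N W S"
  then obtain f where f: "f \<in> W" "\<not> (AE x in N. f x = 0)" "AE x in N. S f x = \<rho> * f x"
    by (auto simp: eigenvalues_def eigenfunction_def)
  have "AE x in M. (shifted T \<rho> ^^ 1) (X f) x = 0"
    by (rule kernel_intertwine) (use f in \<open>auto simp: shifted_def\<close>)
  then have "eigenfunction M V T \<rho> (X f)"
    using f X_in X_inj by (auto simp: eigenfunction_def shifted_def)
  then show "\<rho> \<in> eigenvalues M V T" by (auto simp: eigenvalues_def)
qed

text \<open>The square of \<open>S\<close> factors as \<open>Y X\<close>, a composition of injective
  maps. Later this excludes the eigenvalue 0 for both operators.\<close>

lemma S_inj: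
  assumes f: "f \<in> W" and 0: "AE x in N. S f x = 0"
  shows "AE x in N. f x = 0"
proof -
  have "AE x in N. Y (X f) x = 0"
    using YX[OF f] map_null[OF W W S S_in[OF f] 0] by eventually_elim simp
  then show ?thesis using X_inj Y_inj X_in f by blast
qed

text \<open>Since \<open>Y X\<close> is the square of \<open>S\<close> and S^2 - \<rho>^2 = (S -
  \<rho>)(S + \<rho>), the inverse of S - \<rho> can only be \<rho>^(-2) (Y (T - \<rho>)^(-1) X - S
  - \<rho>). Solvability is checked with this expression, the function \<open>u\<close>
  below.\<close>

lemma resolvent_set_nonzero:
  assumes \<rho>: "\<rho> \<in> resolvent_set M V T" "\<rho> \<noteq> 0"
  shows "\<rho> \<in> resolvent_set N W S"
proof -
  obtain C where C: "\<And>F. F \<in> V \<Longrightarrow> l2_norm M F \<le> C * l2_norm M (shifted T \<rho> F)"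
    using \<rho> by (auto simp: resolvent_set_def)
  have "\<exists>u\<in>W. AE x in N. shifted S \<rho> u x = h x" if h: "h \<in> W" for h
  proof -
    obtain F where F: "F \<in> V" "AE x in M. shifted T \<rho> F x = X h x"
      using \<rho> X_in[OF h] by (auto simp: resolvent_set_def)
    define k where "k = (\<lambda>x. (1 / \<rho>\<^sup>2) * Y F x + (- 1 / \<rho>\<^sup>2) * S h x)"
    define u where "u = (\<lambda>x. 1 * k x + (- 1 / \<rho>) * h x)"
    have k: "k \<in> W" unfolding k_def by (intro l2_subspaceD(4)[OF W] Y_in F S_in h)
    have u: "u \<in> W" unfolding u_def by (intro l2_subspaceD(4)[OF W] k h)
    have Sk: "AE x in N. S k x = (1 / \<rho>\<^sup>2) * S (Y F) x + (- 1 / \<rho>\<^sup>2) * S (S h) x"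
      unfolding k_def by (intro map_lin[OF W W S] Y_in F S_in h)
    have Su: "AE x in N. S u x = 1 * S k x + (- 1 / \<rho>) * S h x"
      unfolding u_def by (intro map_lin[OF W W S] k h)
    have "AE x in N. Y (X h) x = 1 * Y (T F) x + (- \<rho>) * Y F x"
      by (rule map_lin_AE[OF V W Y]) (use F h X_in T_in in \<open>auto simp: shifted_def\<close>)
    with Sk Su SY[OF F(1)] YX[OF h] have "AE x in N. shifted S \<rho> u x = h x"
    proof eventually_elim
      case (elim x)
      have SS: "S (S h) x = Y (T F) x - \<rho> * Y F x" using elim by simp
      show ?case using \<rho>(2) elim(3) unfolding shifted_def elim(2) elim(1) SS
        by (simp add: u_def k_def field_simps power2_eq_square)
    qed
    then show ?thesis using u by blast
  qed
  \<comment> \<open>The same formula read backwards: with \<open>h = shifted S \<rho> f\<close> one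
    has \<open>\<rho>\<^sup>2 * f = Y (X f) - S h - \<rho> * h\<close>, and the estimate for T -
    \<rho> controls \<open>X f\<close> by \<open>X h\<close>.\<close>
  moreover have "\<exists>C. \<forall>f\<in>W. l2_norm N f \<le> C * l2_norm N (shifted S \<rho> f)"
  proof -
    obtain CX where CX: "0 \<le> CX" "\<And>f. f \<in> W \<Longrightarrow> l2_norm M (X f) \<le> CX * l2_norm N f"
      using map_bound[OF W V X] by blast
    obtain CY where CY: "0 \<le> CY" "\<And>F. F \<in> V \<Longrightarrow> l2_norm N (Y F) \<le> CY * l2_norm M F"
      using map_bound[OF V W Y] by blast
    obtain CS where CS: "0 \<le> CS" "\<And>f. f \<in> W \<Longrightarrow> l2_norm N (S f) \<le> CS * l2_norm N f"
      using map_bound[OF W W S] by blast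
    define r1 where "r1 = cmod (1 / \<rho>\<^sup>2)"
    define r2 where "r2 = cmod (- 1 / \<rho>)"
    define D where "D = 2 * (2 * (r1 * (CY * (\<bar>C\<bar> * CX)) + r1 * CS) + r2)"
    have "l2_norm N f \<le> D * l2_norm N (shifted S \<rho> f)" if f: "f \<in> W" for f
    proof -
      define h where "h = shifted S \<rho> f"
      have h: "h \<in> W" using shifted_in[OF W S f] by (simp add: h_def)
      have "l2_norm M (X f) \<le> C * l2_norm M (shifted T \<rho> (X f))"
        by (rule C[OF X_in[OF f]])
      also have "l2_norm M (shifted T \<rho> (X f)) = l2_norm M (X h)"
        using shifted_intertwine[OF f] shifted_in[OF V T X_in[OF f]] X_in[OF h]
        by (intro l2_norm_cong_AE l2_subspaceD(2)[OF V]) (auto simp: h_def)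
      also have "C * l2_norm M (X h) \<le> \<bar>C\<bar> * (CX * l2_norm N h)"
        by (intro mult_mono CX(2) h) auto
      finally have Xf: "l2_norm M (X f) \<le> \<bar>C\<bar> * CX * l2_norm N h" by (simp add: mult.assoc)
      have YXf: "l2_norm N (Y (X f)) \<le> CY * (\<bar>C\<bar> * CX) * l2_norm N h"
        using CY(2)[OF X_in[OF f]] mult_left_mono[OF Xf CY(1)] by (simp add: mult.assoc)
      define k where "k = (\<lambda>x. (1 / \<rho>\<^sup>2) * Y (X f) x + (- (1 / \<rho>\<^sup>2)) * S h x)"
      define u where "u = (\<lambda>x. 1 * k x + (- 1 / \<rho>) * h x)"
      have k: "k \<in> W" unfolding k_def by (intro l2_subspaceD(4)[OF W] Y_in X_in f S_in h)
      have u: "u \<in> W" unfolding u_def by (intro l2_subspaceD(4)[OF W] k h)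
      have "AE x in N. S h x = 1 * S (S f) x + (- \<rho>) * S f x"
        by (rule map_lin_AE[OF W W S]) (use f h S_in in \<open>auto simp: h_def shifted_def\<close>)
      with YX[OF f] have "AE x in N. f x = u x"
      proof eventually_elim
        case (elim x)
        show ?case using \<rho>(2) unfolding u_def k_def elim
          by (simp add: h_def shifted_def field_simps power2_eq_square)
      qed
      then have "l2_norm N f = l2_norm N u"
        by (intro l2_norm_cong_AE l2_subspaceD(2)[OF W] f u)
      also have "\<dots> \<le> 2 * (cmod 1 * l2_norm N k + r2 * l2_norm N h)"
        unfolding u_def r2_def by (intro square_integrable_lincomb(2) l2_subspaceD(1)[OF W] k h)
      also have "l2_norm N k \<le> 2 * (r1 * l2_norm N (Y (X f)) + cmod (- (1 / \<rho>\<^sup>2)) * l2_norm N (S h))"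
        unfolding k_def r1_def
        by (intro square_integrable_lincomb(2) l2_subspaceD(1)[OF W] Y_in X_in f S_in h)
      also have "\<dots> \<le> 2 * (r1 * (CY * (\<bar>C\<bar> * CX) * l2_norm N h) + r1 * (CS * l2_norm N h))"
        unfolding norm_minus_cancel r1_def[symmetric]
        by (intro mult_left_mono add_mono YXf CS(2) h) (auto simp: r1_def)
      finally show ?thesis by (simp add: D_def h_def algebra_simps)
    qed
    then show ?thesis by blast
  qed
  ultimately show ?thesis unfolding resolvent_set_iff[OF W S] by blast
qed

text \<open>At 0 the previous formula would divide by 0. Here the inverse of \<open>S\<close> is
  \<open>Y\<close> after T^(-3) after \<open>X\<close>: if T^3 F3 = X h, then
  \<open>X (S (Y F3))\<close> is T^3 F3, hence \<open>X h\<close>, and injectivity of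
  \<open>X\<close> gives \<open>S (Y F3) = h\<close>.\<close>

lemma resolvent_set_zero:
  assumes 0: "0 \<in> resolvent_set M V T"
  shows "0 \<in> resolvent_set N W S"
proof -
  have [simp]: "shifted A 0 = A" for A :: "('x \<Rightarrow> complex) \<Rightarrow> 'x \<Rightarrow> complex"
    by (simp add: shifted_def fun_eq_iff)
  obtain C where C: "\<And>F. F \<in> V \<Longrightarrow> l2_norm M F \<le> C * l2_norm M (T F)"
    using 0 by (auto simp: resolvent_set_def)
  obtain CX where CX: "0 \<le> CX" "\<And>f. f \<in> W \<Longrightarrow> l2_norm M (X f) \<le> CX * l2_norm N f"
    using map_bound[OF W V X] by blast
  obtain CY where CY: "0 \<le> CY" "\<And>F. F \<in> V \<Longrightarrow> l2_norm N (Y F) \<le> CY * l2_norm M F"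
    using map_bound[OF V W Y] by blast
  define D where "D = CY * (\<bar>C\<bar> * (\<bar>C\<bar> * (\<bar>C\<bar> * CX)))"
  have solve: "\<exists>F\<in>V. (AE x in M. T F x = G x) \<and> l2_norm M F \<le> \<bar>C\<bar> * l2_norm M G" if G: "G \<in> V" for G
  proof -
    obtain F where F: "F \<in> V" "AE x in M. T F x = G x"
      using 0 G by (auto simp: resolvent_set_def)
    have "l2_norm M (T F) = l2_norm M G"
      by (intro l2_norm_cong_AE l2_subspaceD(2)[OF V] T_in F G)
    moreover have "C * l2_norm M G \<le> \<bar>C\<bar> * l2_norm M G" by (intro mult_right_mono) auto
    ultimately show ?thesis using F C[OF F(1)] by force
  qed
  have main: "\<exists>f\<in>W. (AE x in N. S f x = h x) \<and> l2_norm N f \<le> D * l2_norm N h" if h: "h \<in> W" for h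
  proof -
    obtain F1 where F1: "F1 \<in> V" "AE x in M. T F1 x = X h x" "l2_norm M F1 \<le> \<bar>C\<bar> * l2_norm M (X h)"
      using solve[OF X_in[OF h]] by blast
    obtain F2 where F2: "F2 \<in> V" "AE x in M. T F2 x = F1 x" "l2_norm M F2 \<le> \<bar>C\<bar> * l2_norm M F1"
      using solve[OF F1(1)] by blast
    obtain F3 where F3: "F3 \<in> V" "AE x in M. T F3 x = F2 x" "l2_norm M F3 \<le> \<bar>C\<bar> * l2_norm M F2"
      using solve[OF F2(1)] by blast
    define k where "k = (\<lambda>x. 1 * S (Y F3) x + (-1) * h x)"
    have k: "k \<in> W" unfolding k_def by (intro l2_subspaceD(4)[OF W] S_in Y_in F3 h)
    have Xk: "AE x in M. X k x = 1 * X (S (Y F3)) x + (-1) * X h x"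
      unfolding k_def by (intro map_lin[OF W V X] S_in Y_in F3 h)
    have e1: "AE x in M. T (X (Y F3)) x = T (T (T F3)) x"
      by (intro map_cong[OF V V T] X_in Y_in T_in F3 XY)
    have e2: "AE x in M. T (T F3) x = T F2 x"
      by (intro map_cong[OF V V T] T_in F3 F2)
    have e3: "AE x in M. T (T (T F3)) x = T (T F2) x"
      by (intro map_cong[OF V V T] T_in F3 F2 e2)
    have e4: "AE x in M. T (T F2) x = T F1 x"
      by (intro map_cong[OF V V T] T_in F1 F2)
    have "AE x in M. X k x = 0"
      using Xk TX[OF Y_in[OF F3(1)]] e1 e3 e4 F1(2) by eventually_elim simp
    then have "AE x in N. k x = 0" using X_inj[OF k] by blast
    then have "AE x in N. S (Y F3) x = h x" by eventually_elim (simp add: k_def)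
    moreover have "l2_norm N (Y F3) \<le> D * l2_norm N h"
    proof -
      have "l2_norm N (Y F3) \<le> CY * l2_norm M F3" by (rule CY(2)[OF F3(1)])
      also have "\<dots> \<le> CY * (\<bar>C\<bar> * (\<bar>C\<bar> * (\<bar>C\<bar> * (CX * l2_norm N h))))"
        by (intro mult_left_mono order_trans[OF F3(3)] order_trans[OF F2(3)] order_trans[OF F1(3)]
            CX CY h) auto
      finally show ?thesis by (simp add: D_def mult.assoc)
    qed
    ultimately show ?thesis using Y_in[OF F3(1)] by blast
  qed
  \<comment> \<open>\<open>main\<close> provides some preimage of \<open>S f\<close> with the
    required bound; injectivity of \<open>S\<close> identifies it with \<open>f\<close>.\<close>
  have "l2_norm N f \<le> D * l2_norm N (S f)" if f: "f \<in> W" for f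
  proof -
    obtain g where g: "g \<in> W" "AE x in N. S g x = S f x" "l2_norm N g \<le> D * l2_norm N (S f)"
      using main[OF S_in[OF f]] by blast
    define k where "k = (\<lambda>x. 1 * g x + (-1) * f x)"
    have k: "k \<in> W" unfolding k_def by (intro l2_subspaceD(4)[OF W] g f)
    have "AE x in N. S k x = 1 * S g x + (-1) * S f x"
      unfolding k_def by (intro map_lin[OF W W S] g f)
    with g(2) have "AE x in N. S k x = 0" by eventually_elim simp
    then have "AE x in N. k x = 0" using S_inj[OF k] by blast
    then have "AE x in N. f x = g x" by eventually_elim (simp add: k_def)
    then have "l2_norm N f = l2_norm N g"
      by (intro l2_norm_cong_AE l2_subspaceD(2)[OF W] f g)
    with g show ?thesis by simp
  qed
  with main show ?thesis unfolding resolvent_set_iff[OF W S] by auto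
qed

lemma resolvent_set_le: "resolvent_set M V T \<subseteq> resolvent_set N W S"
  using resolvent_set_nonzero resolvent_set_zero by blast

end

theorem (in square_intertwined) same_spectral_data:
  shows "eigenvalues M V T = eigenvalues N W S"
    and "geometric_multiplicity M V T \<rho> = geometric_multiplicity N W S \<rho>"
    and "algebraic_multiplicity M V T \<rho> = algebraic_multiplicity N W S \<rho>"
    and "op_spectrum M V T = op_spectrum N W S"
proof -
  interpret swapped: square_intertwined N W S M V T Y X by (rule swap)
  show "eigenvalues M V T = eigenvalues N W S"
    using eigenvalues_le swapped.eigenvalues_le by blast
  show "geometric_multiplicity M V T \<rho> = geometric_multiplicity N W S \<rho>"
    using geometric_multiplicity_le swapped.geometric_multiplicity_le by (rule antisym[rotated])
  show "algebraic_multiplicity M V T \<rho> = algebraic_multiplicity N W S \<rho>"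
    using algebraic_multiplicity_le swapped.algebraic_multiplicity_le by (rule antisym[rotated])
  show "op_spectrum M V T = op_spectrum N W S"
    using resolvent_set_le swapped.resolvent_set_le by (auto simp: op_spectrum_def)
qed

text \<open>Injectivity of \<open>X\<close> yields the two missing identities from \<open>TX\<close> and \<open>XY\<close>.\<close>

lemma square_intertwinedI:
  assumes V: "l2_subspace M V" and W: "l2_subspace N W"
    and T: "bounded_map_on M V M V T" and S: "bounded_map_on N W N W S"
    and X: "bounded_map_on N W M V X" and Y: "bounded_map_on M V N W Y"
    and X_inj: "\<And>f. f \<in> W \<Longrightarrow> AE x in M. X f x = 0 \<Longrightarrow> AE x in N. f x = 0"
    and Y_inj: "\<And>F. F \<in> V \<Longrightarrow> AE x in N. Y F x = 0 \<Longrightarrow> AE x in M. F x = 0"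
    and TX: "\<And>f. f \<in> W \<Longrightarrow> AE x in M. T (X f) x = X (S f) x"
    and XY: "\<And>F. F \<in> V \<Longrightarrow> AE x in M. X (Y F) x = T (T F) x"
  shows "square_intertwined M V T N W S X Y"
proof
  note T_in = map_in[OF V V T] and S_in = map_in[OF W W S]
    and X_in = map_in[OF W V X] and Y_in = map_in[OF V W Y]
  have X_eq: "AE x in N. f x = g x" if f: "f \<in> W" and g: "g \<in> W" and e: "AE x in M. X f x = X g x"
    for f g
  proof -
    have "AE x in M. X (\<lambda>x. 1 * f x + (-1) * g x) x = 0"
      using map_lin[OF W V X f g, of 1 "-1"] e by eventually_elim simp
    then have "AE x in N. 1 * f x + (-1) * g x = 0"
      by (intro X_inj l2_subspaceD(4)[OF W] f g)
    then show ?thesis by eventually_elim simp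
  qed
  show "AE x in N. S (Y F) x = Y (T F) x" if F: "F \<in> V" for F
  proof (intro X_eq S_in Y_in T_in F)
    have "AE x in M. T (X (Y F)) x = T (T (T F)) x"
      by (intro map_cong[OF V V T] X_in Y_in T_in F XY)
    with TX[OF Y_in[OF F]] XY[OF T_in[OF F]]
    show "AE x in M. X (S (Y F)) x = X (Y (T F)) x" by eventually_elim simp
  qed
  show "AE x in N. Y (X f) x = S (S f) x" if f: "f \<in> W" for f
  proof (intro X_eq S_in Y_in X_in f)
    have "AE x in M. T (T (X f)) x = T (X (S f)) x"
      by (intro map_cong[OF V V T] X_in T_in S_in f TX)
    with TX[OF S_in[OF f]] XY[OF X_in[OF f]]
    show "AE x in M. X (Y (X f)) x = X (S (S f)) x" by eventually_elim simp
  qed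
qed (fact V W T S X Y X_inj Y_inj TX XY)+

section \<open>Fourier transforms and Gaussian integrals\<close>

text \<open>The positive and the negative part of \<phi> have the same Fourier transform. After
  normalisation they are densities of probability measures with equal characteristic functions, so
  Levy's uniqueness theorem applies.\<close>

lemma fourier_injective_real:
  fixes \<phi> :: "real \<Rightarrow> real"
  assumes int: "integrable lborel \<phi>"
    and zero: "\<And>t. (\<integral>x. \<phi> x *\<^sub>R iexp (t * x) \<partial>lborel) = 0"
  shows "AE x in lborel. \<phi> x = 0"
proof -
  note [measurable] = borel_measurable_integrable[OF int]
  define P where "P x = max (\<phi> x) 0" for x
  define N where "N x = max (- \<phi> x) 0" for x
  define m where "m = (\<integral>x. P x \<partial>lborel)"
  have P: "integrable lborel P" and N: "integrable lborel N"
    unfolding P_def[abs_def] N_def[abs_def] using int by (auto intro!: integrable_max)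
  have [measurable]: "P \<in> borel_measurable borel" "N \<in> borel_measurable borel"
    using P N by auto
  have [simp]: "0 \<le> P x" "0 \<le> N x" for x by (auto simp: P_def N_def)
  have PN: "\<phi> x = P x - N x" for x by (auto simp: P_def N_def max_def)
  have intw: "integrable lborel (\<lambda>x. h x *\<^sub>R iexp (t * x))" if "integrable lborel h"
    for h :: "real \<Rightarrow> real" and t
    by (rule Bochner_Integration.integrable_bound[OF that]) (use that in auto)
  have eq: "(\<integral>x. P x *\<^sub>R iexp (t * x) \<partial>lborel) = (\<integral>x. N x *\<^sub>R iexp (t * x) \<partial>lborel)" for t
    using zero[of t] intw[OF P, of t] intw[OF N, of t]
    by (simp add: PN scaleR_diff_left Bochner_Integration.integral_diff)
  \<comment> \<open>At frequency 0 the transforms are the total masses, so both parts are normalised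
    by the same \<open>m\<close>.\<close>
  have "complex_of_real (\<integral>x. P x \<partial>lborel) = complex_of_real (\<integral>x. N x \<partial>lborel)"
    using eq[of 0] by (simp add: scaleR_conv_of_real)
  then have mN: "m = (\<integral>x. N x \<partial>lborel)" by (simp add: m_def)
  have "AE x in lborel. P x = N x"
  proof (cases "m = 0")
    case True
    then have "AE x in lborel. P x = 0" "AE x in lborel. N x = 0"
      using integral_nonneg_eq_0_iff_AE[OF P] integral_nonneg_eq_0_iff_AE[OF N] mN m_def by auto
    then show ?thesis by eventually_elim simp
  next
    case False
    moreover have "0 \<le> m" by (simp add: m_def)
    ultimately have m: "0 < m" by simp
    define D where "D h = density lborel (\<lambda>x. ennreal (h x / m))" for h :: "real \<Rightarrow> real"
    have D: "real_distribution (D h)"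
      if [measurable]: "h \<in> borel_measurable borel" and h: "integrable lborel h" "\<And>x. 0 \<le> h x"
        "(\<integral>x. h x \<partial>lborel) = m" for h
    proof -
      have "emeasure (D h) (space (D h)) = (\<integral>\<^sup>+x. ennreal (h x / m) \<partial>lborel)"
        unfolding D_def by (subst emeasure_density) auto
      also have "\<dots> = ennreal (\<integral>x. h x / m \<partial>lborel)"
        using h m by (intro nn_integral_eq_integral) auto
      also have "\<dots> = 1" using h m by simp
      finally interpret prob_space "D h" by (intro prob_spaceI)
      show ?thesis by unfold_locales (auto simp: D_def)
    qed
    have char: "char (D h) t = (1 / m) *\<^sub>R (\<integral>x. h x *\<^sub>R iexp (t * x) \<partial>lborel)"
      if [measurable]: "h \<in> borel_measurable borel" and h: "\<And>x. 0 \<le> h x" for h t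
    proof -
      have "char (D h) t = (\<integral>x. (h x / m) *\<^sub>R iexp (t * x) \<partial>lborel)"
        unfolding char_def D_def using h m by (subst integral_density) auto
      also have "\<dots> = (\<integral>x. (1 / m) *\<^sub>R (h x *\<^sub>R iexp (t * x)) \<partial>lborel)"
        by (simp add: divide_inverse mult.commute)
      also have "\<dots> = (1 / m) *\<^sub>R (\<integral>x. h x *\<^sub>R iexp (t * x) \<partial>lborel)"
        by (rule integral_scaleR_right)
      finally show ?thesis .
    qed
    have "D P = D N"
      using D[OF _ P] D[OF _ N] mN eq
      by (intro Levy_uniqueness ext) (auto simp: m_def char)
    then have "AE x in lborel. ennreal (P x / m) = ennreal (N x / m)"
      unfolding D_def by (subst (asm) sigma_finite_measure.density_unique_iff[OF sigma_finite_lborel]) auto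
    then show ?thesis
      by eventually_elim (use m in auto)
  qed
  then show ?thesis by eventually_elim (simp add: PN)
qed

text \<open>The transform of the conjugate of \<open>g\<close> at t is the conjugate of the
  transform of \<open>g\<close> at -t. So it vanishes too, and with it the transforms of the real
  and the imaginary part.\<close>

lemma fourier_injective:
  fixes g :: "real \<Rightarrow> complex"
  assumes int: "integrable lborel g"
    and zero: "\<And>t. (\<integral>x. g x * exp (\<i> * of_real (t * x)) \<partial>lborel) = 0"
  shows "AE x in lborel. g x = 0"
proof -
  note [measurable] = borel_measurable_integrable[OF int]
  have intw: "integrable lborel (\<lambda>x. g x * exp (\<i> * of_real (t * x)))" for t
    by (rule Bochner_Integration.integrable_bound[OF int]) (auto simp: norm_mult)
  have cnj0: "(\<integral>x. cnj (g x) * exp (\<i> * of_real (t * x)) \<partial>lborel) = 0" for t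
  proof -
    have "(\<integral>x. cnj (g x) * exp (\<i> * of_real (t * x)) \<partial>lborel)
        = (\<integral>x. cnj (g x * exp (\<i> * of_real (- t * x))) \<partial>lborel)"
      by (simp add: exp_cnj)
    also have "\<dots> = 0" using Bochner_Integration.integral_cnj[of lborel "\<lambda>x. g x * exp (\<i> * of_real (- t * x))"] zero[of "- t"] by (metis complex_cnj_zero)
    finally show ?thesis .
  qed
  have intc: "integrable lborel (\<lambda>x. cnj (g x) * exp (\<i> * of_real (t * x)))" for t
    using borel_measurable_integrable[OF Bochner_Integration.integrable_cnj[OF int]]
    by (intro Bochner_Integration.integrable_bound[OF int]) (auto simp: norm_mult)
  have "(\<integral>x. Re (g x) *\<^sub>R iexp (t * x) \<partial>lborel) = 0" for t
  proof -
    have "(\<integral>x. Re (g x) *\<^sub>R iexp (t * x) \<partial>lborel) =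
      (\<integral>x. (1/2) * (g x * exp (\<i> * of_real (t * x))) + (1/2) * (cnj (g x) * exp (\<i> * of_real (t * x))) \<partial>lborel)"
      by (intro Bochner_Integration.integral_cong refl)
         (simp add: scaleR_conv_of_real complex_eq_iff field_simps)
    also have "\<dots> = 0" using zero[of t] cnj0[of t] intw[of t] intc[of t] by simp
    finally show ?thesis .
  qed
  then have "AE x in lborel. Re (g x) = 0"
    by (intro fourier_injective_real integrable_Re int)
  moreover have "(\<integral>x. Im (g x) *\<^sub>R iexp (t * x) \<partial>lborel) = 0" for t
  proof -
    have "(\<integral>x. Im (g x) *\<^sub>R iexp (t * x) \<partial>lborel) =
      (\<integral>x. (-\<i>/2) * (g x * exp (\<i> * of_real (t * x))) + (\<i>/2) * (cnj (g x) * exp (\<i> * of_real (t * x))) \<partial>lborel)"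
      by (intro Bochner_Integration.integral_cong refl)
         (simp add: scaleR_conv_of_real complex_eq_iff field_simps)
    also have "\<dots> = 0" using zero[of t] cnj0[of t] intw[of t] intc[of t] by simp
    finally show ?thesis .
  qed
  then have "AE x in lborel. Im (g x) = 0"
    by (intro fourier_injective_real integrable_Im int)
  ultimately show ?thesis by eventually_elim (simp add: complex_eq_iff)
qed

section \<open>Gaussian integrals on the real line\<close>

lemma has_integral_std_normal_iexp:
  "has_bochner_integral lborel (\<lambda>x. of_real (std_normal_density x) * exp (\<i> * of_real (t * x)))
     (of_real (exp (- t\<^sup>2 / 2)))"
proof -
  have "(\<integral>x. std_normal_density x *\<^sub>R iexp (t * x) \<partial>lborel) = char std_normal_distribution t"
    unfolding char_def by (subst integral_density) auto
  moreover have "integrable lborel (\<lambda>x. std_normal_density x *\<^sub>R iexp (t * x))"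
    by (rule Bochner_Integration.integrable_bound[of _ std_normal_density]) auto
  ultimately show ?thesis
    by (simp add: has_bochner_integral_iff char_std_normal_distribution scaleR_conv_of_real)
qed

text \<open>No contour has to be moved: an affine substitution removes the real part of
  \<open>w\<close>, and the imaginary part is a frequency in the characteristic function of the
  normal distribution.\<close>

lemma complex_gaussian:
  fixes p :: real and w :: complex
  assumes p: "0 < p"
  shows "has_bochner_integral lborel (\<lambda>x. exp (w * of_real x - of_real (p * x\<^sup>2)))
     (of_real (sqrt (pi / p)) * exp (w\<^sup>2 / of_real (4 * p)))"
proof -
  define c where "c = sqrt (2 * p)"
  define d where "d = - Re w / c"
  define t where "t = Im w / c"
  have c: "0 < c" "c\<^sup>2 = 2 * p" using p by (auto simp: c_def)
  let ?f = "\<lambda>x. of_real (std_normal_density x) * exp (\<i> * of_real (t * x)) :: complex"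
  have "has_bochner_integral lborel (\<lambda>x. ?f (d + c * x)) (inverse \<bar>c\<bar> *\<^sub>R of_real (exp (- t\<^sup>2 / 2)))"
    using c has_integral_std_normal_iexp[of t]
      lborel_integrable_real_affine[of ?f c d] lborel_integral_real_affine[of c ?f d]
    by (auto simp: has_bochner_integral_iff)
  \<comment> \<open>\<open>sqrt (2 * pi)\<close> cancels the normalisation of the density; the two
    exponentials are the constants left over from completing the square.\<close>
  from has_bochner_integral_mult_right[OF this, of "exp (w\<^sup>2 / of_real (4 * p)) * exp (of_real (t\<^sup>2 / 2)) * of_real (sqrt (2 * pi))"]
  have "has_bochner_integral lborel (\<lambda>x. exp (w\<^sup>2 / of_real (4 * p)) * exp (of_real (t\<^sup>2 / 2)) * of_real (sqrt (2 * pi)) * ?f (d + c * x))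
     (exp (w\<^sup>2 / of_real (4 * p)) * exp (of_real (t\<^sup>2 / 2)) * of_real (sqrt (2 * pi)) * (inverse \<bar>c\<bar> *\<^sub>R of_real (exp (- t\<^sup>2 / 2))))"
    by blast
  also have "exp (w\<^sup>2 / of_real (4 * p)) * exp (of_real (t\<^sup>2 / 2)) * of_real (sqrt (2 * pi)) * (inverse \<bar>c\<bar> *\<^sub>R of_real (exp (- t\<^sup>2 / 2)))
     = of_real (sqrt (pi / p)) * exp (w\<^sup>2 / of_real (4 * p))"
  proof -
    have "sqrt (2 * pi) * inverse \<bar>c\<bar> = sqrt (pi / p)"
      using p by (simp add: c_def real_sqrt_mult real_sqrt_divide field_simps)
    then have *: "of_real (sqrt (2 * pi)) * of_real (inverse \<bar>c\<bar>) = complex_of_real (sqrt (pi / p))"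
      by (metis of_real_mult)
    have "exp (of_real (t\<^sup>2 / 2)) * of_real (exp (- t\<^sup>2 / 2)) = (1::complex)"
      by (simp add: exp_of_real[symmetric] exp_add[symmetric] del: of_real_divide of_real_power)
    have "x1 * x2 * x3 * (x4 * x5) = (x3 * x4) * x1 * (x2 * x5)" for x1 x2 x3 x4 x5 :: complex
      by simp
    then show ?thesis unfolding scaleR_conv_of_real using * \<open>exp (of_real (t\<^sup>2 / 2)) * _ = 1\<close>
      by (metis mult_1_right)
  qed
  also have "(\<lambda>x. exp (w\<^sup>2 / of_real (4 * p)) * exp (of_real (t\<^sup>2 / 2)) * of_real (sqrt (2 * pi)) * ?f (d + c * x))
     = (\<lambda>x. exp (w * of_real x - of_real (p * x\<^sup>2)))"
  proof
    fix x
    have 1: "of_real (sqrt (2 * pi)) * complex_of_real (std_normal_density (d + c * x)) = exp (of_real (- (d + c * x)\<^sup>2 / 2))"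
      by (simp add: std_normal_density_def exp_of_real[symmetric])
    have wd: "w = of_real (- d * c) + \<i> * of_real (t * c)"
      using c by (simp add: d_def t_def complex_eq_iff)
    have "of_real (4 * p) = 2 * (complex_of_real c)\<^sup>2"
      using c by (simp flip: of_real_power)
    then have W: "w\<^sup>2 / of_real (4 * p) = (of_real (- d) + \<i> * of_real t)\<^sup>2 / 2"
    proof -
      have "w = of_real c * (of_real (- d) + \<i> * of_real t)"
        unfolding wd by (simp add: algebra_simps)
      then show ?thesis
        using \<open>of_real (4 * p) = _\<close> c by (simp add: power_mult_distrib)
    qed
    have 2: "w\<^sup>2 / of_real (4 * p) + of_real (t\<^sup>2 / 2) + of_real (- (d + c * x)\<^sup>2 / 2) + \<i> * of_real (t * (d + c * x))
       = w * of_real x - of_real (c\<^sup>2 / 2 * x\<^sup>2)"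
      unfolding W by (simp add: wd field_simps power2_eq_square)
    have "exp (w\<^sup>2 / of_real (4 * p)) * exp (of_real (t\<^sup>2 / 2)) * of_real (sqrt (2 * pi)) * ?f (d + c * x)
      = exp (w\<^sup>2 / of_real (4 * p)) * exp (of_real (t\<^sup>2 / 2)) * (of_real (sqrt (2 * pi)) * of_real (std_normal_density (d + c * x))) * exp (\<i> * of_real (t * (d + c * x)))"
      by (simp only: mult.assoc)
    also have "\<dots> = exp (w * of_real x - of_real (p * x\<^sup>2))"
      unfolding 1 exp_add[symmetric] 2 c(2) by simp
    finally show "exp (w\<^sup>2 / of_real (4 * p)) * exp (of_real (t\<^sup>2 / 2)) * of_real (sqrt (2 * pi)) * ?f (d + c * x) = exp (w * of_real x - of_real (p * x\<^sup>2))" .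
  qed
  finally show ?thesis .
qed

lemma real_gaussian:
  fixes p u :: real
  assumes p: "0 < p"
  shows "has_bochner_integral lborel (\<lambda>x. exp (u * x - p * x\<^sup>2)) (sqrt (pi / p) * exp (u\<^sup>2 / (4 * p)))"
proof -
  have "has_bochner_integral lborel (\<lambda>x. complex_of_real (exp (u * x - p * x\<^sup>2)))
     (complex_of_real (sqrt (pi / p) * exp (u\<^sup>2 / (4 * p))))"
    using complex_gaussian[OF p, of "of_real u"] by (simp add: exp_of_real[symmetric])
  then show ?thesis
    using has_bochner_integral_Re by fastforce
qed

section \<open>Integration over the complex plane\<close>

text \<open>It suffices to compare boxes. This gives access to Fubini in the real and the imaginary
  part.\<close>

lemma lborel_complex:
  "lborel = distr (lborel \<Otimes>\<^sub>M lborel) borel (\<lambda>(x, y). Complex x y)"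
proof (rule lborel_eqI)
  fix l u :: complex
  assume lu: "\<And>b. b \<in> Basis \<Longrightarrow> l \<bullet> b \<le> u \<bullet> b"
  have le: "Re l \<le> Re u" "Im l \<le> Im u"
    using lu[of 1] lu[of \<i>] by (auto simp: Basis_complex_def)
  have [measurable]: "(\<lambda>(x, y). Complex x y) \<in> borel_measurable (lborel \<Otimes>\<^sub>M lborel)"
    unfolding Complex_eq split_def by measurable
  have "(\<lambda>(x, y). Complex x y) -` box l u \<inter> space (lborel \<Otimes>\<^sub>M lborel) = {Re l<..<Re u} \<times> {Im l<..<Im u}"
    by (auto simp: box_def Basis_complex_def space_pair_measure)
  then have "emeasure (distr (lborel \<Otimes>\<^sub>M lborel) borel (\<lambda>(x, y). Complex x y)) (box l u)
      = emeasure (lborel \<Otimes>\<^sub>M lborel) ({Re l<..<Re u} \<times> {Im l<..<Im u})"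
    by (subst emeasure_distr) auto
  also have "\<dots> = ennreal ((Re u - Re l) * (Im u - Im l))"
    using le by (subst lborel.emeasure_pair_measure_Times) (auto simp: ennreal_mult)
  finally show "emeasure (distr (lborel \<Otimes>\<^sub>M lborel) borel (\<lambda>(x, y). Complex x y)) (box l u) = (\<Prod>b\<in>Basis. (u - l) \<bullet> b)"
    by (simp add: Basis_complex_def)
qed simp

lemma measurable_Complex_pair [measurable]:
  "(\<lambda>(x, y). Complex x y) \<in> (borel \<Otimes>\<^sub>M borel) \<rightarrow>\<^sub>M borel"
  unfolding Complex_eq split_def by measurable

lemma nn_integral_complex:
  assumes [measurable]: "f \<in> borel_measurable borel"
  shows "(\<integral>\<^sup>+z. f z \<partial>lborel) = (\<integral>\<^sup>+y. \<integral>\<^sup>+x. f (Complex x y) \<partial>lborel \<partial>lborel)"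
proof -
  have "(\<integral>\<^sup>+z. f z \<partial>lborel) = (\<integral>\<^sup>+p. f (case p of (x, y) \<Rightarrow> Complex x y) \<partial>(lborel \<Otimes>\<^sub>M lborel))"
    by (subst lborel_complex, subst nn_integral_distr) auto
  also have "\<dots> = (\<integral>\<^sup>+y. \<integral>\<^sup>+x. f (Complex x y) \<partial>lborel \<partial>lborel)"
    by (subst lborel_pair.nn_integral_snd[symmetric]) auto
  finally show ?thesis .
qed

lemma lborel_eq_distr_complexI:
  assumes [measurable]: "h \<in> borel_measurable borel"
    and eq: "\<And>f. f \<in> borel_measurable borel \<Longrightarrow> (\<integral>\<^sup>+z. f (h z) \<partial>lborel) = (\<integral>\<^sup>+z. f z \<partial>lborel)"
  shows "distr lborel borel h = (lborel :: complex measure)"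
proof (rule measure_eqI)
  fix A assume "A \<in> sets (distr lborel borel h)"
  then have [measurable]: "A \<in> sets borel" by simp
  have "emeasure (distr lborel borel h) A = (\<integral>\<^sup>+z. indicator A (h z) \<partial>lborel)"
    by (subst nn_integral_distr[symmetric, of h lborel borel]) auto
  also have "\<dots> = emeasure lborel A"
    by (subst eq) auto
  finally show "emeasure (distr lborel borel h) A = emeasure lborel A" .
qed simp

lemma nn_integral_lborel_translate:
  fixes f :: "real \<Rightarrow> ennreal"
  assumes "f \<in> borel_measurable borel"
  shows "(\<integral>\<^sup>+x. f (x + c) \<partial>lborel) = (\<integral>\<^sup>+x. f x \<partial>lborel)"
  using nn_integral_real_affine[OF assms, of 1 c] by (simp add: add.commute)

text \<open>For fixed imaginary part a shear is a translation of the real part, so invariance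
  reduces to that of the inner integral.\<close>

lemma distr_shear_Re:
  "distr lborel borel (\<lambda>z. Complex (Re z + a * Im z) (Im z)) = lborel"
proof (rule lborel_eq_distr_complexI)
  show [measurable]: "(\<lambda>z. Complex (Re z + a * Im z) (Im z)) \<in> borel_measurable borel"
    unfolding Complex_eq by measurable
  fix f :: "complex \<Rightarrow> ennreal" assume [measurable]: "f \<in> borel_measurable borel"
  show "(\<integral>\<^sup>+z. f (Complex (Re z + a * Im z) (Im z)) \<partial>lborel) = (\<integral>\<^sup>+z. f z \<partial>lborel)"
    using nn_integral_lborel_translate[of "\<lambda>x. f (Complex x _)"]
    by (simp add: nn_integral_complex)
qed

lemma distr_shear_Im:
  "distr lborel borel (\<lambda>z. Complex (Re z) (Im z + a * Re z)) = lborel"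
proof (rule lborel_eq_distr_complexI)
  show [measurable]: "(\<lambda>z. Complex (Re z) (Im z + a * Re z)) \<in> borel_measurable borel"
    unfolding Complex_eq by measurable
  fix f :: "complex \<Rightarrow> ennreal" assume [measurable]: "f \<in> borel_measurable borel"
  have "(\<integral>\<^sup>+z. f (Complex (Re z) (Im z + a * Re z)) \<partial>lborel)
     = (\<integral>\<^sup>+x. \<integral>\<^sup>+y. f (Complex x (y + a * x)) \<partial>lborel \<partial>lborel)"
    by (simp add: nn_integral_complex) (subst lborel_pair.Fubini', auto)
  also have "\<dots> = (\<integral>\<^sup>+x. \<integral>\<^sup>+y. f (Complex x y) \<partial>lborel \<partial>lborel)"
    using nn_integral_lborel_translate[of "\<lambda>y. f (Complex _ y)"] by simp
  also have "\<dots> = (\<integral>\<^sup>+z. f z \<partial>lborel)"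
    by (simp add: nn_integral_complex) (subst lborel_pair.Fubini', auto)
  finally show "(\<integral>\<^sup>+z. f (Complex (Re z) (Im z + a * Re z)) \<partial>lborel) = (\<integral>\<^sup>+z. f z \<partial>lborel)" .
qed

text \<open>A rotation by an angle other than \<open>\<pi>\<close> is a product of three shears.\<close>

lemma distr_rotate:
  assumes u: "cmod u = 1"
  shows "distr lborel borel ((*) u) = (lborel :: complex measure)"
proof -
  have gen: "distr lborel borel ((*) v) = (lborel :: complex measure)"
    if v: "cmod v = 1" "v \<noteq> -1" for v
  proof -
    \<comment> \<open>For v = exp (i \<theta>) this is -tan (\<theta> / 2), the coefficient of the
      two outer shears; it has a pole exactly at the excluded half turn.\<close>
    define a where "a = - Im v / (1 + Re v)"
    define S where "S z = Complex (Re z + a * Im z) (Im z)" for z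
    define R where "R z = Complex (Re z) (Im z + Im v * Re z)" for z
    have [measurable]: "S \<in> borel_measurable borel" "R \<in> borel_measurable borel"
      unfolding S_def[abs_def] R_def[abs_def] Complex_eq by measurable
    have n: "(Re v)\<^sup>2 + (Im v)\<^sup>2 = 1"
      using v cmod_power2[of v] by simp
    have "Re v \<noteq> -1"
      using n v by (auto simp: complex_eq_iff)
    then have d: "1 + Re v \<noteq> 0" by linarith
    have aI: "a * Im v = Re v - 1"
    proof -
      have "(1 + Re v) * (Re v - 1) = - (Im v)\<^sup>2" using n by (simp add: algebra_simps power2_eq_square)
      then show ?thesis using d by (simp add: a_def field_simps power2_eq_square)
    qed
    have aR: "a * (1 + Re v) = - Im v" using d by (simp add: a_def)
    have "S (R (S z)) = v * z" for z
    proof -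
      have "Im z + Im v * (Re z + a * Im z) = Im v * Re z + (1 + a * Im v) * Im z"
        by (simp add: algebra_simps)
      then have I: "Im z + Im v * (Re z + a * Im z) = Im v * Re z + Re v * Im z"
        by (simp add: aI)
      have "Re z + a * Im z + a * (Im v * Re z + Re v * Im z)
          = (1 + a * Im v) * Re z + a * (1 + Re v) * Im z"
        by (simp add: algebra_simps)
      then show ?thesis using I
        by (simp add: S_def R_def complex_eq_iff aI aR)
    qed
    then have "distr lborel borel ((*) v) = distr (distr (distr lborel borel S) borel R) borel S"
      by (simp add: distr_distr o_def)
    also have "\<dots> = lborel"
      using distr_shear_Re[of a] distr_shear_Im[of "Im v"]
      by (simp add: S_def[abs_def] R_def[abs_def])
    finally show ?thesis .
  qed
  show ?thesis
  proof (cases "u = -1")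
    \<comment> \<open>A half turn is two quarter turns, and \<open>\<i>\<close> is covered by
      \<open>gen\<close>.\<close>
    case True
    have "distr lborel borel ((*) u) = distr (distr lborel borel ((*) \<i>)) borel ((*) \<i>)"
      by (subst distr_distr) (auto simp: o_def True intro!: distr_cong)
    also have "\<dots> = lborel" by (simp add: gen complex_eq_iff)
    finally show ?thesis .
  qed (use gen u in auto)
qed

lemma integral_complex_rotate:
  fixes f :: "complex \<Rightarrow> 'b::{banach, second_countable_topology}"
  assumes u: "cmod u = 1" and [measurable]: "f \<in> borel_measurable borel"
  shows "(\<integral>z. f (u * z) \<partial>lborel) = (\<integral>z. f z \<partial>lborel)"
    and "integrable lborel (\<lambda>z. f (u * z)) \<longleftrightarrow> integrable lborel f"
proof -
  show "(\<integral>z. f (u * z) \<partial>lborel) = (\<integral>z. f z \<partial>lborel)"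
    by (subst (2) distr_rotate[OF u, symmetric], subst integral_distr) auto
  show "integrable lborel (\<lambda>z. f (u * z)) \<longleftrightarrow> integrable lborel f"
    by (subst (2) distr_rotate[OF u, symmetric], subst integrable_distr_eq) auto
qed

lemma integral_translate:
  fixes f :: "'a::euclidean_space \<Rightarrow> 'b::{banach, second_countable_topology}"
  assumes [measurable]: "f \<in> borel_measurable borel"
  shows "(\<integral>z. f (c + z) \<partial>lborel) = (\<integral>z. f z \<partial>lborel)"
    and "integrable lborel (\<lambda>z. f (c + z)) \<longleftrightarrow> integrable lborel f"
proof -
  show "(\<integral>z. f (c + z) \<partial>lborel) = (\<integral>z. f z \<partial>lborel)"
    by (subst (2) lborel_distr_plus[of c, symmetric], subst integral_distr) auto
  show "integrable lborel (\<lambda>z. f (c + z)) \<longleftrightarrow> integrable lborel f"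
    by (subst (2) lborel_distr_plus[of c, symmetric], subst integrable_distr_eq) auto
qed

text \<open>Cauchy's formula on the unit circle for the function mapping u to
  \<open>f (u * z)\<close>. Rotating the argument instead of the path treats all radii, including 0,
  at once.\<close>

lemma circle_mean:
  fixes f :: "complex \<Rightarrow> complex"
  assumes f: "f holomorphic_on UNIV"
  shows "(\<integral>s. indicator {0..1} s *\<^sub>R f (exp (2 * of_real pi * \<i> * of_real s) * z) \<partial>lborel) = f 0"
proof -
  let ?g = "\<lambda>s::real. f (exp (2 * of_real pi * \<i> * of_real s) * z)"
  have cf: "continuous_on UNIV f" by (rule holomorphic_on_imp_continuous_on[OF f])
  have h: "(\<lambda>u. f (u * z)) holomorphic_on UNIV"
  proof -
    have "(\<lambda>u. u * z) holomorphic_on UNIV" by (intro holomorphic_intros)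
    from holomorphic_on_compose[OF this holomorphic_on_subset[OF f]] show ?thesis
      by (simp add: o_def)
  qed
  have "((\<lambda>u. f (u * z) / (u - 0)) has_contour_integral 2 * of_real pi * \<i> * f (0 * z)) (circlepath 0 1)"
    by (rule Cauchy_integral_circlepath_simple) (auto intro: holomorphic_on_subset[OF h])
  then have 1: "((\<lambda>s. f (circlepath 0 1 s * z) / (circlepath 0 1 s - 0) *
      vector_derivative (circlepath 0 1) (at s within {0..1})) has_integral 2 * of_real pi * \<i> * f 0) {0..1}"
    by (simp only: has_contour_integral_def mult_zero_left)
  have "((\<lambda>s. 2 * of_real pi * \<i> * ?g s) has_integral 2 * of_real pi * \<i> * f 0) {0..1}"
    by (rule has_integral_eq[OF _ 1]) (simp add: vector_derivative_circlepath01, simp add: circlepath)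
  from has_integral_mult_right[OF this, of "1 / (2 * of_real pi * \<i>)"]
  have "(?g has_integral f 0) {0..1}" by simp
  moreover have "set_integrable lborel {0..1} ?g"
    by (intro borel_integrable_atLeastAtMost' continuous_on_compose2[OF cf] continuous_intros) auto
  then have "set_lebesgue_integral lborel {0..1} ?g = integral {0..1} ?g"
    by (rule set_borel_integral_eq_integral)
  ultimately show ?thesis
    by (simp add: set_lebesgue_integral_def integral_unique)
qed

text \<open>Integration over polar coordinates in disguise: the integral does not change when the
  argument of \<open>G\<close> is rotated, so it equals its average over all rotations, and after
  exchanging the integrals \<open>circle_mean\<close> evaluates the average.\<close>

lemma radial_mean:
  fixes G :: "complex \<Rightarrow> complex" and \<psi> :: "real \<Rightarrow> real"
  assumes G: "G holomorphic_on UNIV" and [measurable]: "\<psi> \<in> borel_measurable borel"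
    and int: "integrable lborel (\<lambda>z. \<psi> (cmod z) *\<^sub>R G z)"
  shows "(\<integral>z. \<psi> (cmod z) *\<^sub>R G z \<partial>lborel) = (\<integral>z. \<psi> (cmod z) *\<^sub>R G 0 \<partial>lborel)"
proof -
  have [measurable]: "G \<in> borel_measurable borel"
    by (intro borel_measurable_continuous_onI holomorphic_on_imp_continuous_on[OF G])
  define e where "e s = exp (2 * of_real pi * \<i> * of_real s)" for s :: real
  have [measurable]: "e \<in> borel_measurable borel"
    unfolding e_def[abs_def] by measurable
  have [simp]: "cmod (e s) = 1" for s by (simp add: e_def)
  let ?h = "\<lambda>s z. indicator {0..1::real} s *\<^sub>R (\<psi> (cmod z) *\<^sub>R G (e s * z))"
  let ?H = "\<lambda>z. \<psi> (cmod z) *\<^sub>R G z"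
  have rot: "(\<integral>z. \<psi> (cmod z) *\<^sub>R G (e s * z) \<partial>lborel) = (\<integral>z. ?H z \<partial>lborel)"
     "integrable lborel (\<lambda>z. \<psi> (cmod z) *\<^sub>R G (e s * z))"
     "(\<integral>z. norm (\<psi> (cmod z) *\<^sub>R G (e s * z)) \<partial>lborel) = (\<integral>z. norm (?H z) \<partial>lborel)" for s
    using integral_complex_rotate[of "e s" ?H] integral_complex_rotate[of "e s" "\<lambda>z. norm (?H z)"] int
    by (simp_all add: norm_mult)
  have ind: "integrable lborel (\<lambda>s. indicator {0..1::real} s *\<^sub>R c)" for c :: "'c::{banach,second_countable_topology}"
    by simp
  have "integrable (lborel \<Otimes>\<^sub>M lborel) (case_prod ?h)"
  proof (rule lborel_pair.Fubini_integrable)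
    show "integrable lborel (\<lambda>s. \<integral>z. norm (case_prod ?h (s, z)) \<partial>lborel)"
      using ind[of "\<integral>z. norm (?H z) \<partial>lborel"] rot(3) by (simp add: abs_mult mult.assoc)
    show "AE s in lborel. integrable lborel (\<lambda>z. case_prod ?h (s, z))"
      using integrable_scaleR_right[OF rot(2)] by (intro AE_I2) (simp only: prod.case)
  qed measurable
  then have fubini: "(\<integral>z. (\<integral>s. ?h s z \<partial>lborel) \<partial>lborel) = (\<integral>s. (\<integral>z. ?h s z \<partial>lborel) \<partial>lborel)"
    by (rule lborel_pair.Fubini_integral)
  have inner: "(\<integral>s. ?h s z \<partial>lborel) = \<psi> (cmod z) *\<^sub>R G 0" for z
  proof -
    have "(\<integral>s. ?h s z \<partial>lborel) = (\<integral>s. \<psi> (cmod z) *\<^sub>R (indicator {0..1::real} s *\<^sub>R G (e s * z)) \<partial>lborel)"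
      by (simp add: mult.commute)
    also have "\<dots> = \<psi> (cmod z) *\<^sub>R G 0"
      using circle_mean[OF G, of z] by (simp add: e_def del: scaleR_scaleR)
    finally show ?thesis .
  qed
  have "(\<integral>z. \<psi> (cmod z) *\<^sub>R G 0 \<partial>lborel) = (\<integral>s. (\<integral>z. ?h s z \<partial>lborel) \<partial>lborel)"
    using fubini by (simp only: inner)
  also have "\<dots> = (\<integral>z. ?H z \<partial>lborel)"
    by (simp add: rot(1) del: scaleR_scaleR)
  finally show ?thesis by simp
qed

text \<open>The rates \<open>p\<close> and \<open>q\<close> are kept apart because
  \<open>inv_kernel\<close> decays differently in the real and in the imaginary direction.\<close>

lemma integrable_complex_gaussian_bound:
  fixes f :: "complex \<Rightarrow> complex"
  assumes [measurable]: "f \<in> borel_measurable borel" and p: "0 < p" and q: "0 < q"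
    and bd: "\<And>z. cmod (f z) \<le> K * exp (u * Re z - p * (Re z)\<^sup>2 + (v * Im z - q * (Im z)\<^sup>2))"
  shows "integrable lborel f"
    and "cmod (\<integral>z. f z \<partial>lborel) \<le> K * (pi / sqrt (p * q)) * exp (u\<^sup>2 / (4 * p) + v\<^sup>2 / (4 * q))"
proof -
  let ?B = "\<lambda>z. exp (u * Re z - p * (Re z)\<^sup>2 + (v * Im z - q * (Im z)\<^sup>2))"
  note gp = real_gaussian[OF p, of u] and gq = real_gaussian[OF q, of v]
  define I where "I = pi / sqrt (p * q) * exp (u\<^sup>2 / (4 * p) + v\<^sup>2 / (4 * q))"
  have "(\<integral>\<^sup>+z. ennreal (?B z) \<partial>lborel)
     = (\<integral>\<^sup>+y. \<integral>\<^sup>+x. ennreal (exp (v * y - q * y\<^sup>2)) * ennreal (exp (u * x - p * x\<^sup>2)) \<partial>lborel \<partial>lborel)"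
    by (subst nn_integral_complex) (auto simp: ennreal_mult[symmetric] exp_add mult.commute)
  also have "\<dots> = (\<integral>\<^sup>+y. ennreal (exp (v * y - q * y\<^sup>2)) * ennreal (sqrt (pi / p) * exp (u\<^sup>2 / (4 * p))) \<partial>lborel)"
    using gp by (simp add: nn_integral_cmult nn_integral_eq_integral has_bochner_integral_iff)
  also have "\<dots> = ennreal (sqrt (pi / q) * exp (v\<^sup>2 / (4 * q))) * ennreal (sqrt (pi / p) * exp (u\<^sup>2 / (4 * p)))"
    using gq by (simp add: nn_integral_multc nn_integral_eq_integral has_bochner_integral_iff)
  also have "\<dots> = ennreal I"
  proof -
    have 1: "sqrt (pi / q) * sqrt (pi / p) = pi / sqrt (p * q)"
      by (simp add: real_sqrt_mult real_sqrt_divide)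
    have "sqrt (pi / q) * exp (v\<^sup>2 / (4 * q)) * (sqrt (pi / p) * exp (u\<^sup>2 / (4 * p)))
       = (sqrt (pi / q) * sqrt (pi / p)) * (exp (u\<^sup>2 / (4 * p)) * exp (v\<^sup>2 / (4 * q)))"
      by (simp only: mult_ac)
    also have "\<dots> = I"
      unfolding 1 I_def exp_add ..
    finally have "sqrt (pi / q) * exp (v\<^sup>2 / (4 * q)) * (sqrt (pi / p) * exp (u\<^sup>2 / (4 * p))) = I" .
    then show ?thesis using p q by (subst ennreal_mult[symmetric]) auto
  qed
  finally have "has_bochner_integral lborel ?B I"
    by (intro has_bochner_integral_nn_integral) (use p q in \<open>auto simp: I_def\<close>)
  then have B: "integrable lborel ?B" "(\<integral>z. ?B z \<partial>lborel) = I" by (auto simp: has_bochner_integral_iff)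
  have KB: "integrable lborel (\<lambda>z. K * ?B z)" using B by simp
  show "integrable lborel f"
    by (rule Bochner_Integration.integrable_bound[OF KB]) (use bd in \<open>auto intro!: AE_I2 order_trans[OF bd]\<close>)
  then have "cmod (\<integral>z. f z \<partial>lborel) \<le> (\<integral>z. K * ?B z \<partial>lborel)"
    by (intro Bochner_Integration.integral_norm_bound_integral KB bd)
  then show "cmod (\<integral>z. f z \<partial>lborel) \<le> K * (pi / sqrt (p * q)) * exp (u\<^sup>2 / (4 * p) + v\<^sup>2 / (4 * q))"
    using B by (simp add: I_def mult.assoc)
qed

lemma integral_complex_gaussian: "(\<integral>z. exp (- pi * (cmod z)\<^sup>2) \<partial>lborel) = 1"
proof -
  have g: "(\<integral>\<^sup>+x. ennreal (exp (- (pi * x\<^sup>2))) \<partial>lborel) = 1"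
    using real_gaussian[OF pi_gt_zero, of 0]
    by (subst nn_integral_eq_integral) (auto simp: has_bochner_integral_iff)
  have "(\<integral>\<^sup>+z. ennreal (exp (- pi * (cmod z)\<^sup>2)) \<partial>lborel)
     = (\<integral>\<^sup>+y. \<integral>\<^sup>+x. ennreal (exp (- (pi * y\<^sup>2))) * ennreal (exp (- (pi * x\<^sup>2))) \<partial>lborel \<partial>lborel)"
    by (subst nn_integral_complex) (auto simp: ennreal_mult[symmetric] exp_add[symmetric] cmod_power2 algebra_simps)
  also have "\<dots> = 1" by (simp add: nn_integral_cmult g)
  finally have "has_bochner_integral lborel (\<lambda>z. exp (- pi * (cmod z)\<^sup>2)) 1"
    by (intro has_bochner_integral_nn_integral) (auto simp: one_ennreal_def)
  then show ?thesis by (simp add: has_bochner_integral_iff)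
qed

text \<open>Translating by \<open>w\<close> turns the integrand into a radial Gaussian times an
  entire function \<open>G\<close> with \<open>G 0 = F w\<close>, to which
  \<open>radial_mean\<close> applies. The growth condition serves for absolute convergence.\<close>

theorem fock_reproducing:
  fixes F :: "complex \<Rightarrow> complex"
  assumes F: "F holomorphic_on UNIV" and bd: "\<And>z. cmod (F z) \<le> K * exp (a * (cmod z)\<^sup>2)" and a: "a < pi"
  shows "(\<integral>z. F z * exp (of_real pi * w * cnj z - of_real (pi * (cmod z)\<^sup>2)) \<partial>lborel) = F w"
proof -
  have [measurable]: "F \<in> borel_measurable borel"
    by (intro borel_measurable_continuous_onI holomorphic_on_imp_continuous_on[OF F])
  define f where "f z = F z * exp (of_real pi * w * cnj z - of_real (pi * (cmod z)\<^sup>2))" for z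
  have [measurable]: "cnj \<in> borel_measurable borel"
    by (intro borel_measurable_continuous_onI continuous_intros)
  have [measurable]: "f \<in> borel_measurable borel"
    unfolding f_def[abs_def] by measurable
  have "integrable lborel f"
  proof (rule integrable_complex_gaussian_bound(1))
    fix z
    have "cmod (f z) \<le> K * exp (a * (cmod z)\<^sup>2) * exp (pi * (Re w * Re z + Im w * Im z) - pi * (cmod z)\<^sup>2)"
      unfolding f_def norm_mult by (intro mult_mono bd order_trans[OF norm_ge_zero bd]) (auto simp: norm_exp_eq_Re algebra_simps)
    also have "\<dots> = K * exp (pi * Re w * Re z - (pi - a) * (Re z)\<^sup>2 + (pi * Im w * Im z - (pi - a) * (Im z)\<^sup>2))"
      by (simp add: mult.assoc exp_add[symmetric] cmod_power2 algebra_simps)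
    finally show "cmod (f z) \<le> K * exp (pi * Re w * Re z - (pi - a) * (Re z)\<^sup>2 + (pi * Im w * Im z - (pi - a) * (Im z)\<^sup>2))" .
  qed (use a in auto)
  then have int: "integrable lborel (\<lambda>z. f (w + z))"
    by (subst integral_translate) auto
  define G where "G z = F (w + z) * exp (- of_real pi * cnj w * z)" for z
  have "(\<lambda>z. F (w + z)) holomorphic_on UNIV"
  proof -
    have "(\<lambda>z. w + z) holomorphic_on UNIV" by (intro holomorphic_intros)
    from holomorphic_on_compose[OF this holomorphic_on_subset[OF F]] show ?thesis
      by (simp add: o_def)
  qed
  then have G: "G holomorphic_on UNIV"
    unfolding G_def[abs_def] by (intro holomorphic_intros)
  have fG: "f (w + z) = exp (- pi * (cmod z)\<^sup>2) *\<^sub>R G z" for z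
  proof -
    have sq: "complex_of_real ((cmod y)\<^sup>2) = y * cnj y" for y
      by (rule complex_norm_square)
    have e: "of_real pi * w * cnj (w + z) - of_real (pi * (cmod (w + z))\<^sup>2)
        = of_real (- pi * (cmod z)\<^sup>2) + (- of_real pi * cnj w * z)"
      unfolding of_real_mult sq by (simp add: algebra_simps)
    show ?thesis unfolding f_def e exp_add G_def scaleR_conv_of_real exp_of_real
      by (simp only: mult_ac)
  qed
  have "(\<integral>z. f z \<partial>lborel) = (\<integral>z. f (w + z) \<partial>lborel)"
    by (simp add: integral_translate)
  also have "\<dots> = (\<integral>z. exp (- pi * (cmod z)\<^sup>2) *\<^sub>R G 0 \<partial>lborel)"
    using int unfolding fG by (intro radial_mean[OF G, of "\<lambda>r. exp (- pi * r\<^sup>2)"]) auto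
  also have "\<dots> = F w"
  proof -
    have "integrable lborel (\<lambda>z::complex. exp (- pi * (cmod z)\<^sup>2))"
      using integral_complex_gaussian not_integrable_integral_eq by fastforce
    then show ?thesis
      by (simp add: integral_complex_gaussian[simplified] G_def)
  qed
  finally show ?thesis by (simp add: f_def)
qed

section \<open>Growth of entire functions and the Fock norm\<close>

lemma quadratic_absorb:
  fixes r k \<epsilon> :: real
  assumes "0 < \<epsilon>"
  shows "k * r \<le> \<epsilon> * r\<^sup>2 + k\<^sup>2 / (4 * \<epsilon>)"
proof -
  have "0 \<le> (2 * \<epsilon> * r - k)\<^sup>2 / (4 * \<epsilon>)" using assms by simp
  also have "\<dots> = \<epsilon> * r\<^sup>2 + k\<^sup>2 / (4 * \<epsilon>) - k * r"
    using assms by (simp add: field_simps power2_eq_square)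
  finally show ?thesis by simp
qed

lemma entire_measurable:
  fixes F :: "complex \<Rightarrow> complex"
  assumes "F holomorphic_on UNIV"
  shows "F \<in> borel_measurable borel"
  by (intro borel_measurable_continuous_onI holomorphic_on_imp_continuous_on[OF assms])

context
  fixes t :: real
  assumes t: "0 < t"
begin

lemma AE_fock_iff: "(AE z in fock_measure t. P z) \<longleftrightarrow> (AE z in lborel. P z)"
  unfolding fock_measure_def using t by (subst AE_density) auto

text \<open>The zero set is closed and has full measure, hence is the whole plane.\<close>

lemma entire_AE_zero:
  assumes F: "F holomorphic_on UNIV" and 0: "AE z in fock_measure t. F z = 0"
  shows "F z = 0"
proof -
  have "closed {z. F z = 0}"
    using continuous_closed_preimage[OF holomorphic_on_imp_continuous_on[OF F] closed_UNIV, of "{0}"]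
    by (simp add: vimage_def)
  moreover have "AE z in lebesgue. z \<in> {z. F z = 0}"
    using 0 unfolding AE_fock_iff by (auto intro: AE_completion)
  ultimately show ?thesis
    using mem_closed_if_AE_lebesgue by blast
qed

lemma fock_square_integrable_iff:
  assumes "F \<in> borel_measurable borel"
  shows "F \<in> square_integrable (fock_measure t) \<longleftrightarrow>
    integrable lborel (\<lambda>z. t * exp (- pi * t * (cmod z)\<^sup>2) * (cmod (F z))\<^sup>2)"
  unfolding square_integrable_def fock_measure_def using assms t
  by (auto simp: integrable_density)

lemma fock_norm_sq:
  assumes "F \<in> borel_measurable borel"
  shows "(l2_norm (fock_measure t) F)\<^sup>2 = (\<integral>z. t * exp (- pi * t * (cmod z)\<^sup>2) * (cmod (F z))\<^sup>2 \<partial>lborel)"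
  unfolding l2_norm_sq fock_measure_def using assms t
  by (subst integral_density) auto

text \<open>The critical growth rate of the space is pi * t / 2; strictly below it a pointwise bound
  becomes a norm bound. This is how maps into \<open>HL2 t\<close> are shown to be bounded.\<close>

lemma HL2_of_bound:
  assumes F: "F holomorphic_on UNIV" and bd: "\<And>z. cmod (F z) \<le> K * exp (a * (cmod z)\<^sup>2)"
    and a: "2 * a < pi * t"
  shows "F \<in> HL2 t" and "l2_norm (fock_measure t) F \<le> sqrt (t * pi / (pi * t - 2 * a)) * K"
proof -
  note [measurable] = entire_measurable[OF F]
  have K: "0 \<le> K" using order_trans[OF norm_ge_zero bd[of 0]] by simp
  let ?f = "\<lambda>z. t * exp (- pi * t * (cmod z)\<^sup>2) * (cmod (F z))\<^sup>2"
  let ?p = "pi * t - 2 * a"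
  have f: "cmod (of_real (?f z)) \<le> (t * K\<^sup>2) * exp (0 * Re z - ?p * (Re z)\<^sup>2 + (0 * Im z - ?p * (Im z)\<^sup>2))" for z
  proof -
    have "(cmod (F z))\<^sup>2 \<le> (K * exp (a * (cmod z)\<^sup>2))\<^sup>2"
      by (intro power_mono bd) simp
    then have "?f z \<le> t * exp (- pi * t * (cmod z)\<^sup>2) * (K * exp (a * (cmod z)\<^sup>2))\<^sup>2"
      using t by (intro mult_left_mono) auto
    also have "\<dots> = (t * K\<^sup>2) * (exp (- pi * t * (cmod z)\<^sup>2) * exp (2 * (a * (cmod z)\<^sup>2)))"
      by (simp add: power_mult_distrib exp_double)
    also have "\<dots> = (t * K\<^sup>2) * exp (0 * Re z - ?p * (Re z)\<^sup>2 + (0 * Im z - ?p * (Im z)\<^sup>2))"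
      unfolding exp_add[symmetric] cmod_power2 by (simp add: algebra_simps)
    finally show ?thesis using t by (simp add: norm_mult norm_power)
  qed
  have m: "(\<lambda>z. complex_of_real (?f z)) \<in> borel_measurable borel" by measurable
  have p: "0 < ?p" using a by simp
  note i = integrable_complex_gaussian_bound[OF m p p f]
  have int: "integrable lborel ?f"
    using integrable_Re[OF i(1)] by simp
  then show "F \<in> HL2 t"
    using F by (simp add: HL2_def fock_square_integrable_iff)
  have "(\<integral>z. ?f z \<partial>lborel) \<ge> 0" using t by simp
  then have "(l2_norm (fock_measure t) F)\<^sup>2 \<le> t * K\<^sup>2 * (pi / ?p)"
    using i(2) p by (simp add: fock_norm_sq del: of_real_mult)
  also have "\<dots> = (sqrt (t * pi / ?p) * K)\<^sup>2"
    using t p by (simp add: power_mult_distrib)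
  finally show "l2_norm (fock_measure t) F \<le> sqrt (t * pi / ?p) * K"
    by (rule power2_le_imp_le) (use K t p in simp)
qed

text \<open>Mean value property of the square of \<open>F\<close> over the unit disc around
  \<open>z\<close>, where the Fock weight is at least
  \<open>t * exp (- pi * t * (cmod z + 1)\<^sup>2)\<close>. The radius 1 costs only a linear term in
  the exponent, which the gap between \<bar>\<beta>\<bar> / 2 and \<alpha> absorbs later.\<close>

lemma HL2_point_evaluation:
  obtains C where "0 \<le> C"
    "\<And>F z. F \<in> HL2 t \<Longrightarrow> cmod (F z) \<le> C * l2_norm (fock_measure t) F * exp (pi * t / 2 * (cmod z + 1)\<^sup>2)"
proof -
  define \<psi> where "\<psi> r = (if r < 1 then 1 else 0 :: real)" for r :: real
  have [measurable]: "\<psi> \<in> borel_measurable borel" unfolding \<psi>_def[abs_def] by measurable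
  define V where "V = measure lborel (ball (0::complex) 1)"
  have V: "0 < V" unfolding V_def by (simp add: content_ball_pos)
  have \<psi>V: "(\<integral>z. \<psi> (cmod z) *\<^sub>R c \<partial>lborel) = V *\<^sub>R c" for c :: complex
  proof -
    have "(\<integral>z. \<psi> (cmod z) *\<^sub>R c \<partial>lborel) = (\<integral>z. indicator (ball (0::complex) 1) z *\<^sub>R c \<partial>lborel)"
      by (rule arg_cong[where f = "integral\<^sup>L lborel"]) (auto simp: \<psi>_def indicator_def dist_norm fun_eq_iff)
    also have "\<dots> = V *\<^sub>R c"
      using emeasure_bounded_finite[of "ball (0::complex) 1"] by (simp add: V_def)
    finally show ?thesis .
  qed
  show ?thesis
  proof (rule that[of "1 / sqrt (V * t)"])
    fix F w assume FH: "F \<in> HL2 t"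
    then have F: "F holomorphic_on UNIV" by (simp add: HL2_def)
    note [measurable] = entire_measurable[OF F]
    let ?f = "\<lambda>z. t * exp (- pi * t * (cmod z)\<^sup>2) * (cmod (F z))\<^sup>2"
    define E where "E = exp (pi * t * (cmod w + 1)\<^sup>2)"
    have int: "integrable lborel ?f"
      using FH by (simp add: HL2_def fock_square_integrable_iff)
    have int': "integrable lborel (\<lambda>z. ?f (w + z))"
      using int by (subst integral_translate) auto
    define G where "G z = (F (w + z))\<^sup>2" for z
    have G: "G holomorphic_on UNIV"
    proof -
      have "(\<lambda>z. w + z) holomorphic_on UNIV" by (intro holomorphic_intros)
      from holomorphic_on_compose[OF this holomorphic_on_subset[OF F]]
      have "(\<lambda>z. F (w + z)) holomorphic_on UNIV" by (simp add: o_def)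
      then show ?thesis unfolding G_def[abs_def] by (intro holomorphic_intros)
    qed
    note [measurable] = entire_measurable[OF G]
    have le: "norm (\<psi> (cmod z) *\<^sub>R G z) \<le> E / t * ?f (w + z)" for z
    proof (cases "cmod z < 1")
      case True
      have "cmod (w + z) \<le> cmod w + 1" using norm_triangle_ineq[of w z] True by linarith
      then have "(cmod (w + z))\<^sup>2 \<le> (cmod w + 1)\<^sup>2" by (intro power_mono) auto
      then have "1 \<le> E * exp (- pi * t * (cmod (w + z))\<^sup>2)"
        using t unfolding E_def exp_add[symmetric] by (simp add: mult_left_mono mult.assoc)
      from mult_right_mono[OF this zero_le_power2[of "cmod (F (w + z))"]]
      show ?thesis using True t by (simp add: \<psi>_def G_def norm_power mult.assoc)
    next
      case False
      then show ?thesis using t by (simp add: \<psi>_def E_def)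
    qed
    have int2: "integrable lborel (\<lambda>z. E / t * ?f (w + z))"
      by (rule Bochner_Integration.integrable_mult_right[OF int'])
    have int3: "integrable lborel (\<lambda>z. \<psi> (cmod z) *\<^sub>R G z)"
      by (rule Bochner_Integration.integrable_bound[OF int2])
         (use t in \<open>auto intro!: AE_I2 order_trans[OF le] simp del: norm_scaleR\<close>)
    have "cmod (V *\<^sub>R G 0) = cmod (\<integral>z. \<psi> (cmod z) *\<^sub>R G z \<partial>lborel)"
      using radial_mean[OF G _ int3] by (simp add: \<psi>V)
    also have "\<dots> \<le> (\<integral>z. E / t * ?f (w + z) \<partial>lborel)"
      by (rule Bochner_Integration.integral_norm_bound_integral[OF int3 int2 le])
    also have "\<dots> = E / t * (\<integral>z. ?f (w + z) \<partial>lborel)"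
      by (rule integral_mult_right_zero)
    also have "(\<integral>z. ?f (w + z) \<partial>lborel) = (\<integral>z. ?f z \<partial>lborel)"
      by (rule integral_translate) measurable
    also have "\<dots> = (l2_norm (fock_measure t) F)\<^sup>2"
      by (rule fock_norm_sq[symmetric]) measurable
    finally have "V * (cmod (F w))\<^sup>2 \<le> E / t * (l2_norm (fock_measure t) F)\<^sup>2"
      using V by (simp add: G_def norm_power)
    then have "(cmod (F w))\<^sup>2 \<le> E / t * (l2_norm (fock_measure t) F)\<^sup>2 / V"
      using V by (subst pos_le_divide_eq) (simp_all add: mult.commute)
    also have "\<dots> = (1 / sqrt (V * t) * l2_norm (fock_measure t) F * exp (pi * t / 2 * (cmod w + 1)\<^sup>2))\<^sup>2"
      using V t by (simp add: E_def power_mult_distrib power_divide exp_double[symmetric] mult.commute)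
    finally show "cmod (F w) \<le> 1 / sqrt (V * t) * l2_norm (fock_measure t) F * exp (pi * t / 2 * (cmod w + 1)\<^sup>2)"
      by (rule power2_le_imp_le) (use V t in simp)
  qed (use V t in simp)
qed

lemma l2_subspace_HL2: "l2_subspace (fock_measure t) (HL2 t)"
proof -
  have "(\<lambda>x. a * f x + b * g x) \<in> HL2 t" if "f \<in> HL2 t" "g \<in> HL2 t" for f g a b
    using that square_integrable_lincomb(1)[of f "fock_measure t" g a b]
    by (auto simp: HL2_def intro!: holomorphic_intros)
  moreover have "(\<lambda>x. 0) \<in> HL2 t"
    by (simp add: HL2_def square_integrable_def)
  ultimately show ?thesis
    unfolding l2_subspace_def by (auto simp: HL2_def)
qed

end

section \<open>Square integrability on the real line\<close>

lemma cauchy_schwarz_integral: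
  assumes f: "f \<in> square_integrable M" and g: "g \<in> square_integrable M"
  shows "integrable M (\<lambda>x. f x * g x)"
    and "(\<integral>x. cmod (f x * g x) \<partial>M) \<le> l2_norm M f * l2_norm M g"
proof -
  note [measurable] = square_integrableD(1)[OF f] square_integrableD(1)[OF g]
  note [simp] = square_integrableD(2)[OF f] square_integrableD(2)[OF g]
  \<comment> \<open>The weight \<open>s\<close> is free here; the optimal choice, the quotient
    \<open>?B / ?A\<close> of the norms, is made at the end.\<close>
  have am: "cmod (f x * g x) \<le> s / 2 * (cmod (f x))\<^sup>2 + 1 / (2 * s) * (cmod (g x))\<^sup>2" if "0 < s" for s x
  proof -
    have "0 \<le> (s * cmod (f x) - cmod (g x))\<^sup>2 / (2 * s)" using that by simp
    also have "\<dots> = s / 2 * (cmod (f x))\<^sup>2 + 1 / (2 * s) * (cmod (g x))\<^sup>2 - cmod (f x * g x)"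
      using that by (simp add: norm_mult field_simps power2_eq_square)
    finally show ?thesis by simp
  qed
  show int: "integrable M (\<lambda>x. f x * g x)"
    by (rule Bochner_Integration.integrable_bound[of _ "\<lambda>x. 1 / 2 * (cmod (f x))\<^sup>2 + 1 / (2 * 1) * (cmod (g x))\<^sup>2"])
       (use am[of 1] in \<open>auto simp: add_nonneg_nonneg\<close>)
  let ?A = "l2_norm M f" and ?B = "l2_norm M g"
  have bd: "(\<integral>x. cmod (f x * g x) \<partial>M) \<le> s / 2 * ?A\<^sup>2 + 1 / (2 * s) * ?B\<^sup>2" if "0 < s" for s
  proof -
    have "(\<integral>x. cmod (f x * g x) \<partial>M) \<le> (\<integral>x. s / 2 * (cmod (f x))\<^sup>2 + 1 / (2 * s) * (cmod (g x))\<^sup>2 \<partial>M)"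
      by (intro integral_mono integrable_norm int am that) auto
    also have "\<dots> = s / 2 * ?A\<^sup>2 + 1 / (2 * s) * ?B\<^sup>2"
      by (simp add: l2_norm_sq)
    finally show ?thesis .
  qed
  show "(\<integral>x. cmod (f x * g x) \<partial>M) \<le> ?A * ?B"
  proof (cases "?A = 0 \<or> ?B = 0")
    case True
    then have "AE x in M. f x * g x = 0"
      using l2_norm_eq_0_iff[OF f] l2_norm_eq_0_iff[OF g] by (auto elim: eventually_mono)
    then have "(\<integral>x. cmod (f x * g x) \<partial>M) = (\<integral>x. 0 \<partial>M)"
      by (intro integral_cong_AE) auto
    then show ?thesis by simp
  next
    case False
    then have "0 < ?A" "0 < ?B" using l2_norm_nonneg[of M f] l2_norm_nonneg[of M g] by linarith+
    with bd[of "?B / ?A"] show ?thesis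
      by (simp add: field_simps power2_eq_square)
  qed
qed

text \<open>The linear term in the exponent accommodates the growth of \<open>cc\<close>. Half of
  the Gaussian decay of the square absorbs it.\<close>

lemma square_integrable_of_gaussian_bound:
  fixes g :: "real \<Rightarrow> complex"
  assumes [measurable]: "g \<in> borel_measurable borel" and \<delta>: "0 < \<delta>"
    and bd: "\<And>x. cmod (g x) \<le> K * exp (k * \<bar>x\<bar> - \<delta> * x\<^sup>2)"
  shows "g \<in> square_integrable lborel"
    and "l2_norm lborel g \<le> sqrt (exp (2 * k\<^sup>2 / \<delta>) * sqrt (pi / \<delta>)) * K"
proof -
  have K: "0 \<le> K" using order_trans[OF norm_ge_zero bd[of 0]] by simp
  note gi = real_gaussian[OF \<delta>, of 0]
  let ?D = "exp (2 * k\<^sup>2 / \<delta>)"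
  have le: "(cmod (g x))\<^sup>2 \<le> K\<^sup>2 * ?D * exp (0 * x - \<delta> * x\<^sup>2)" for x
  proof -
    have "(cmod (g x))\<^sup>2 \<le> (K * exp (k * \<bar>x\<bar> - \<delta> * x\<^sup>2))\<^sup>2"
      by (intro power_mono bd) simp
    also have "\<dots> = K\<^sup>2 * exp (2 * (k * \<bar>x\<bar> - \<delta> * x\<^sup>2))"
      by (simp only: power_mult_distrib exp_double)
    also have "\<dots> \<le> K\<^sup>2 * exp (2 * k\<^sup>2 / \<delta> + (0 * x - \<delta> * x\<^sup>2))"
    proof (intro mult_left_mono)
      have "2 * k * \<bar>x\<bar> \<le> \<delta> * \<bar>x\<bar>\<^sup>2 + (2 * k)\<^sup>2 / (4 * \<delta>)"
        by (rule quadratic_absorb[OF \<delta>])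
      moreover have "(2 * k)\<^sup>2 / (4 * \<delta>) \<le> 2 * k\<^sup>2 / \<delta>"
        using \<delta> by (simp add: field_simps power2_eq_square)
      ultimately show "exp (2 * (k * \<bar>x\<bar> - \<delta> * x\<^sup>2)) \<le> exp (2 * k\<^sup>2 / \<delta> + (0 * x - \<delta> * x\<^sup>2))"
        by (simp add: algebra_simps)
    qed simp
    finally show ?thesis by (simp only: exp_add mult.assoc)
  qed
  have int: "integrable lborel (\<lambda>x. K\<^sup>2 * ?D * exp (0 * x - \<delta> * x\<^sup>2))"
    using gi by (auto simp: has_bochner_integral_iff)
  have intg: "integrable lborel (\<lambda>x. (cmod (g x))\<^sup>2)"
    by (rule Bochner_Integration.integrable_bound[OF int]) (use le in \<open>auto intro!: AE_I2 order_trans[OF le]\<close>)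
  then show "g \<in> square_integrable lborel" by (simp add: square_integrable_def)
  have "(l2_norm lborel g)\<^sup>2 \<le> (\<integral>x. K\<^sup>2 * ?D * exp (0 * x - \<delta> * x\<^sup>2) \<partial>lborel)"
    unfolding l2_norm_sq by (rule integral_mono[OF intg int le])
  also have "\<dots> = K\<^sup>2 * ?D * sqrt (pi / \<delta>)"
    using gi by (simp add: has_bochner_integral_iff)
  also have "\<dots> = (sqrt (?D * sqrt (pi / \<delta>)) * K)\<^sup>2"
    using \<delta> by (simp add: power_mult_distrib)
  finally show "l2_norm lborel g \<le> sqrt (?D * sqrt (pi / \<delta>)) * K"
    by (rule power2_le_imp_le) (use K \<delta> in simp)
qed

section \<open>The Bargmann transform\<close>

text \<open>Expand the exponential and integrate term by term; all partial sums are dominated by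
  \<open>cmod (h x) * exp (cmod w * \<bar>x\<bar>)\<close>. The result is a power series convergent
  on the whole plane.\<close>

lemma integral_exp_holomorphic:
  fixes h :: "real \<Rightarrow> complex"
  assumes [measurable]: "h \<in> borel_measurable borel"
    and int: "\<And>r. integrable lborel (\<lambda>x. cmod (h x) * exp (r * \<bar>x\<bar>))"
  shows "(\<lambda>w. \<integral>x. h x * exp (of_real x * w) \<partial>lborel) holomorphic_on UNIV"
proof -
  define a where "a n = (\<integral>x. h x * of_real (x ^ n / fact n) \<partial>lborel)" for n
  have "(\<lambda>n. a n * (w - 0) ^ n) sums (\<integral>x. h x * exp (of_real x * w) \<partial>lborel)" for w
  proof -
    let ?t = "\<lambda>n x. h x * (of_real (x ^ n / fact n) * w ^ n)"
    have norm_t: "norm (?t n x) = cmod (h x) * ((cmod w * \<bar>x\<bar>) ^ n / fact n)" for n x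
      by (simp add: norm_mult norm_power norm_divide power_mult_distrib power_abs)
    have expS: "(\<lambda>n. (cmod w * \<bar>x\<bar>) ^ n / fact n) sums exp (cmod w * \<bar>x\<bar>)" for x
      using exp_converges[of "cmod w * \<bar>x\<bar>"] by (simp add: divide_inverse mult.commute)
    have nS: "(\<lambda>n. norm (?t n x)) sums (cmod (h x) * exp (cmod w * \<bar>x\<bar>))" for x
      unfolding norm_t by (rule sums_mult[OF expS])
    have bound: "(\<Sum>n\<in>I. norm (?t n x)) \<le> cmod (h x) * exp (cmod w * \<bar>x\<bar>)" if "finite I" for I x
      using sum_le_suminf[OF sums_summable[OF nS[of x]] that] sums_unique[OF nS[of x]] by simp
    have int_t: "integrable lborel (?t n)" for n
    proof (rule Bochner_Integration.integrable_bound[OF int[of "cmod w"]])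
      show "AE x in lborel. norm (?t n x) \<le> norm (cmod (h x) * exp (cmod w * \<bar>x\<bar>))"
        using bound[of "{n}"] by (simp add: abs_mult)
    qed measurable
    have "(\<lambda>n. integral\<^sup>L lborel (?t n)) sums (\<integral>x. (\<Sum>n. ?t n x) \<partial>lborel)"
    proof (rule sums_integral)
      show "AE x in lborel. summable (\<lambda>n. norm (?t n x))"
        using nS sums_summable by (intro AE_I2) blast
      show "summable (\<lambda>n. \<integral>x. norm (?t n x) \<partial>lborel)"
      proof (rule bounded_imp_summable)
        fix n
        show "0 \<le> (\<integral>x. norm (?t n x) \<partial>lborel)" by simp
        have "(\<Sum>k\<le>n. \<integral>x. norm (?t k x) \<partial>lborel) = (\<integral>x. (\<Sum>k\<le>n. norm (?t k x)) \<partial>lborel)"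
          by (subst Bochner_Integration.integral_sum) (use int_t in auto)
        also have "\<dots> \<le> (\<integral>x. cmod (h x) * exp (cmod w * \<bar>x\<bar>) \<partial>lborel)"
          by (intro integral_mono bound int Bochner_Integration.integrable_sum integrable_norm int_t) auto
        finally show "(\<Sum>k\<le>n. \<integral>x. norm (?t k x) \<partial>lborel) \<le> (\<integral>x. cmod (h x) * exp (cmod w * \<bar>x\<bar>) \<partial>lborel)" .
      qed
    qed (rule int_t)
    moreover have "integral\<^sup>L lborel (?t n) = a n * (w - 0) ^ n" for n
    proof -
      have "?t n = (\<lambda>x. (h x * of_real (x ^ n / fact n)) * w ^ n)" by (simp add: fun_eq_iff mult.assoc)
      then show ?thesis by (simp add: a_def)
    qed
    moreover have "(\<Sum>n. ?t n x) = h x * exp (of_real x * w)" for x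
    proof -
      have "(\<lambda>n. h x * ((of_real x * w) ^ n /\<^sub>R fact n)) sums (h x * exp (of_real x * w))"
        by (intro sums_mult exp_converges)
      moreover have "h x * ((of_real x * w) ^ n /\<^sub>R fact n) = ?t n x" for n
        by (simp add: power_mult_distrib scaleR_conv_of_real field_simps)
      ultimately show ?thesis by (simp add: sums_iff)
    qed
    ultimately show ?thesis by simp
  qed
  then have "(\<lambda>w. \<integral>x. h x * exp (of_real x * w) \<partial>lborel) holomorphic_on ball 0 r" for r
    by (intro power_series_holomorphic[where a = a]) blast
  then have "(\<lambda>w. \<integral>x. h x * exp (of_real x * w) \<partial>lborel) field_differentiable (at w)" for w
    using holomorphic_on_imp_differentiable_at[of _ "ball 0 (cmod w + 1)" w] by simp
  then show ?thesis
    by (simp add: holomorphic_on_def field_differentiable_at_within)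
qed

definition gauss_integrable :: "(real \<Rightarrow> complex) \<Rightarrow> bool" where
  "gauss_integrable g \<longleftrightarrow> g \<in> borel_measurable borel \<and>
     (\<forall>\<epsilon>>0. integrable lborel (\<lambda>x. cmod (g x) * exp (- \<epsilon> * x\<^sup>2)))"

lemma gauss_integrable_measurable: "gauss_integrable g \<Longrightarrow> g \<in> borel_measurable borel"
  by (simp add: gauss_integrable_def)

lemma gauss_integrable_bound:
  fixes q :: "real \<Rightarrow> 'b::{banach, second_countable_topology}"
  assumes g: "gauss_integrable g" and [measurable]: "q \<in> borel_measurable borel" and \<delta>: "0 < \<delta>"
    and le: "\<And>x. norm (q x) \<le> K * (cmod (g x) * exp (k * \<bar>x\<bar> - \<delta> * x\<^sup>2))"
  shows "integrable lborel q"
proof (rule Bochner_Integration.integrable_bound)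
  show "integrable lborel (\<lambda>x. \<bar>K\<bar> * exp (k\<^sup>2 / (2 * \<delta>)) * (cmod (g x) * exp (- (\<delta> / 2) * x\<^sup>2)))"
    using g \<delta> unfolding gauss_integrable_def
    by (intro Bochner_Integration.integrable_mult_right) (metis half_gt_zero)
  have "norm (q x) \<le> \<bar>K\<bar> * exp (k\<^sup>2 / (2 * \<delta>)) * (cmod (g x) * exp (- (\<delta> / 2) * x\<^sup>2))" for x
  proof -
    have "k * \<bar>x\<bar> \<le> \<delta> / 2 * \<bar>x\<bar>\<^sup>2 + k\<^sup>2 / (4 * (\<delta> / 2))"
      using \<delta> by (intro quadratic_absorb) simp
    then have "k * \<bar>x\<bar> - \<delta> * x\<^sup>2 \<le> k\<^sup>2 / (2 * \<delta>) + - (\<delta> / 2) * x\<^sup>2" by simp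
    then have "K * (cmod (g x) * exp (k * \<bar>x\<bar> - \<delta> * x\<^sup>2))
       \<le> \<bar>K\<bar> * (cmod (g x) * exp (k\<^sup>2 / (2 * \<delta>) + - (\<delta> / 2) * x\<^sup>2))"
      by (intro mult_mono) auto
    with le[of x] show ?thesis unfolding exp_add by (simp only: mult_ac)
  qed
  then show "AE x in lborel. norm (q x) \<le> norm (\<bar>K\<bar> * exp (k\<^sup>2 / (2 * \<delta>)) * (cmod (g x) * exp (- (\<delta> / 2) * x\<^sup>2)))"
    by (intro AE_I2) (simp add: abs_mult)
qed measurable

lemma gauss_integrable_mult:
  assumes g: "gauss_integrable g" and [measurable]: "q \<in> borel_measurable borel"
    and le: "\<And>x. cmod (q x) \<le> K * exp (k * \<bar>x\<bar>)"
  shows "gauss_integrable (\<lambda>x. q x * g x)"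
  unfolding gauss_integrable_def
proof (intro conjI allI impI)
  note [measurable] = gauss_integrable_measurable[OF g]
  show "(\<lambda>x. q x * g x) \<in> borel_measurable borel" by measurable
  fix \<epsilon> :: real assume \<epsilon>: "0 < \<epsilon>"
  show "integrable lborel (\<lambda>x. cmod (q x * g x) * exp (- \<epsilon> * x\<^sup>2))"
  proof (rule gauss_integrable_bound[OF g _ \<epsilon>])
    fix x
    have "cmod (q x) * (cmod (g x) * exp (- \<epsilon> * x\<^sup>2)) \<le> K * exp (k * \<bar>x\<bar>) * (cmod (g x) * exp (- \<epsilon> * x\<^sup>2))"
      by (intro mult_right_mono le) auto
    also have "\<dots> = K * (cmod (g x) * exp (k * \<bar>x\<bar> - \<epsilon> * x\<^sup>2))"
      by (simp add: exp_diff exp_minus field_simps)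
    finally show "norm (cmod (q x * g x) * exp (- \<epsilon> * x\<^sup>2)) \<le> K * (cmod (g x) * exp (k * \<bar>x\<bar> - \<epsilon> * x\<^sup>2))"
      by (simp add: norm_mult mult.assoc)
  qed measurable
qed

lemma gauss_integrable_square_integrable:
  assumes f: "f \<in> square_integrable lborel"
  shows "gauss_integrable f"
  unfolding gauss_integrable_def
proof (intro conjI allI impI)
  show "f \<in> borel_measurable borel" using square_integrableD(1)[OF f] by simp
  fix \<epsilon> :: real assume \<epsilon>: "0 < \<epsilon>"
  have "(\<lambda>x. complex_of_real (exp (- \<epsilon> * x\<^sup>2))) \<in> square_integrable lborel"
    by (rule square_integrable_of_gaussian_bound(1)[OF _ \<epsilon>, where K = 1 and k = 0]) auto
  from integrable_norm[OF cauchy_schwarz_integral(1)[OF f this]]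
  show "integrable lborel (\<lambda>x. cmod (f x) * exp (- \<epsilon> * x\<^sup>2))"
    by (simp add: norm_mult)
qed

lemma gauss_integrable_bounded:
  assumes [measurable]: "g \<in> borel_measurable borel" and le: "\<And>x. cmod (g x) \<le> K"
  shows "gauss_integrable g"
  unfolding gauss_integrable_def
proof (intro conjI allI impI)
  fix \<epsilon> :: real assume \<epsilon>: "0 < \<epsilon>"
  have "integrable lborel (\<lambda>x. K * exp (0 * x - \<epsilon> * x\<^sup>2))"
    using real_gaussian[OF \<epsilon>, of 0] by (auto simp: has_bochner_integral_iff)
  then show "integrable lborel (\<lambda>x. cmod (g x) * exp (- \<epsilon> * x\<^sup>2))"
    by (rule Bochner_Integration.integrable_bound)
       (auto simp: abs_mult intro!: AE_I2 mult_right_mono order_trans[OF le])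
qed simp

text \<open>The generating function of the Hermite polynomials in the powers of \<open>w\<close>,
  times the ground state exp (-x^2 / 4). So \<open>bargmann\<close> is the Bargmann transform with
  constants left out.\<close>

definition bargmann_kernel :: "real \<Rightarrow> complex \<Rightarrow> complex" where
  "bargmann_kernel x w = exp (of_real x * w - of_real (x\<^sup>2 / 4) - w\<^sup>2 / 2)"

definition bargmann :: "(real \<Rightarrow> complex) \<Rightarrow> complex \<Rightarrow> complex" where
  "bargmann g w = (\<integral>x. g x * bargmann_kernel x w \<partial>lborel)"

lemma norm_bargmann_kernel:
  "cmod (bargmann_kernel x w) = exp (- Re (w\<^sup>2) / 2) * exp (Re w * x - 1 / 4 * x\<^sup>2)"
  by (simp add: bargmann_kernel_def norm_exp_eq_Re exp_add[symmetric] algebra_simps)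

lemma measurable_bargmann_kernel [measurable]:
  "case_prod bargmann_kernel \<in> borel_measurable (borel \<Otimes>\<^sub>M borel)"
  unfolding bargmann_kernel_def split_def by measurable

lemma measurable_bargmann_kernel1 [measurable]:
  "(\<lambda>x. bargmann_kernel x w) \<in> borel_measurable borel"
  unfolding bargmann_kernel_def by measurable

lemma bargmann_integrable:
  assumes g: "gauss_integrable g"
  shows "integrable lborel (\<lambda>x. g x * bargmann_kernel x w)"
proof (rule gauss_integrable_bound[OF g, where \<delta> = "1/4"])
  note [measurable] = gauss_integrable_measurable[OF g]
  show "(\<lambda>x. g x * bargmann_kernel x w) \<in> borel_measurable borel" by measurable
  fix x
  have "Re w * x \<le> \<bar>Re w\<bar> * \<bar>x\<bar>" by (metis abs_ge_self abs_mult)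
  then have "cmod (bargmann_kernel x w) \<le> exp (- Re (w\<^sup>2) / 2) * exp (\<bar>Re w\<bar> * \<bar>x\<bar> - 1 / 4 * x\<^sup>2)"
    unfolding norm_bargmann_kernel by (intro mult_left_mono) auto
  from mult_left_mono[OF this norm_ge_zero[of "g x"]]
  show "norm (g x * bargmann_kernel x w) \<le> exp (- Re (w\<^sup>2) / 2) * (cmod (g x) * exp (\<bar>Re w\<bar> * \<bar>x\<bar> - 1 / 4 * x\<^sup>2))"
    by (simp add: norm_mult mult_ac)
qed simp

lemma bargmann_linear:
  assumes "gauss_integrable f" "gauss_integrable g"
  shows "bargmann (\<lambda>x. a * f x + b * g x) w = a * bargmann f w + b * bargmann g w"
  unfolding bargmann_def using bargmann_integrable[OF assms(1), of w] bargmann_integrable[OF assms(2), of w]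
  by (simp add: distrib_right mult.assoc)

lemma bargmann_cong_AE:
  assumes [measurable]: "f \<in> borel_measurable borel" "g \<in> borel_measurable borel"
    and "AE x in lborel. f x = g x"
  shows "bargmann f w = bargmann g w"
  unfolding bargmann_def by (intro integral_cong_AE) (use assms(3) in auto)

lemma bargmann_holomorphic:
  assumes g: "gauss_integrable g"
  shows "bargmann g holomorphic_on UNIV"
proof -
  note [measurable] = gauss_integrable_measurable[OF g]
  let ?h = "\<lambda>x. g x * exp (- of_real (x\<^sup>2 / 4))"
  have "(\<lambda>w. \<integral>x. ?h x * exp (of_real x * w) \<partial>lborel) holomorphic_on UNIV"
  proof (rule integral_exp_holomorphic)
    fix r
    have "cmod (?h x) = cmod (g x) * exp (- (x\<^sup>2 / 4))" for x
      by (simp add: norm_mult norm_exp_eq_Re)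
    then show "integrable lborel (\<lambda>x. cmod (?h x) * exp (r * \<bar>x\<bar>))"
      by (intro gauss_integrable_bound[OF g, where \<delta> = "1/4" and K = 1 and k = r])
         (auto simp: abs_mult mult.assoc exp_add[symmetric])
  qed measurable
  moreover have "bargmann g = (\<lambda>w. exp (- w\<^sup>2 / 2) * (\<integral>x. ?h x * exp (of_real x * w) \<partial>lborel))"
  proof
    fix w
    have e: "g x * bargmann_kernel x w = exp (- w\<^sup>2 / 2) * (?h x * exp (of_real x * w))" for x
      by (simp add: bargmann_kernel_def exp_add[symmetric] exp_diff exp_minus field_simps)
    show "bargmann g w = exp (- w\<^sup>2 / 2) * (\<integral>x. ?h x * exp (of_real x * w) \<partial>lborel)"
      unfolding bargmann_def e by (rule integral_mult_right_zero)
  qed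
  ultimately show ?thesis by (auto intro!: holomorphic_intros)
qed

text \<open>On the imaginary axis the transform is, up to a Gaussian factor, the Fourier transform
  of \<open>g x * exp (- x\<^sup>2 / 4)\<close>.\<close>

lemma bargmann_injective:
  assumes g: "gauss_integrable g" and 0: "\<And>w. bargmann g w = 0"
  shows "AE x in lborel. g x = 0"
proof -
  note [measurable] = gauss_integrable_measurable[OF g]
  let ?h = "\<lambda>x. g x * exp (- of_real (x\<^sup>2 / 4))"
  have "AE x in lborel. ?h x = 0"
  proof (rule fourier_injective)
    show "integrable lborel ?h"
      by (rule gauss_integrable_bound[OF g, where \<delta> = "1/4" and K = 1 and k = 0])
         (auto simp: norm_mult norm_exp_eq_Re)
    fix t :: real
    have e: "?h x * exp (\<i> * of_real (t * x)) = exp (- of_real (t\<^sup>2 / 2)) * (g x * bargmann_kernel x (\<i> * of_real t))" for x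
    proof -
      have q: "exp (- of_real (x\<^sup>2 / 4)) * exp (\<i> * of_real (t * x))
          = exp (- of_real (t\<^sup>2 / 2)) * bargmann_kernel x (\<i> * of_real t)"
        unfolding bargmann_kernel_def exp_add[symmetric]
        by (rule arg_cong[where f = exp]) (simp add: power_mult_distrib field_simps)
      have "?h x * exp (\<i> * of_real (t * x)) = g x * (exp (- of_real (x\<^sup>2 / 4)) * exp (\<i> * of_real (t * x)))"
        by (rule mult.assoc)
      also have "\<dots> = exp (- of_real (t\<^sup>2 / 2)) * (g x * bargmann_kernel x (\<i> * of_real t))"
        unfolding q by (rule mult.left_commute)
      finally show ?thesis .
    qed
    have "(\<integral>x. ?h x * exp (\<i> * of_real (t * x)) \<partial>lborel) = exp (- of_real (t\<^sup>2 / 2)) * bargmann g (\<i> * of_real t)"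
      unfolding e bargmann_def by (rule integral_mult_right_zero)
    then show "(\<integral>x. ?h x * exp (\<i> * of_real (t * x)) \<partial>lborel) = 0" by (simp add: 0)
  qed
  then show ?thesis by eventually_elim simp
qed

lemma bargmann_eqI_AE:
  assumes "gauss_integrable f" "gauss_integrable g" "\<And>w. bargmann f w = bargmann g w"
  shows "AE x in lborel. f x = g x"
proof -
  have "gauss_integrable (\<lambda>x. 1 * f x + (-1) * g x)"
    using assms(1,2) unfolding gauss_integrable_def
  proof (intro conjI allI impI)
    fix \<epsilon> :: real assume \<epsilon>: "0 < \<epsilon>"
    assume "f \<in> borel_measurable borel \<and> (\<forall>\<epsilon>>0. integrable lborel (\<lambda>x. cmod (f x) * exp (- \<epsilon> * x\<^sup>2)))"
      and "g \<in> borel_measurable borel \<and> (\<forall>\<epsilon>>0. integrable lborel (\<lambda>x. cmod (g x) * exp (- \<epsilon> * x\<^sup>2)))"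
    then have [measurable]: "f \<in> borel_measurable borel" "g \<in> borel_measurable borel"
      and i: "integrable lborel (\<lambda>x. cmod (f x) * exp (- \<epsilon> * x\<^sup>2) + cmod (g x) * exp (- \<epsilon> * x\<^sup>2))"
      using \<epsilon> by auto
    show "integrable lborel (\<lambda>x. cmod (1 * f x + - 1 * g x) * exp (- \<epsilon> * x\<^sup>2))"
    proof (rule Bochner_Integration.integrable_bound[OF i])
      have "cmod (f x - g x) * exp (- \<epsilon> * x\<^sup>2) \<le> (cmod (f x) + cmod (g x)) * exp (- \<epsilon> * x\<^sup>2)" for x
        by (intro mult_right_mono norm_triangle_ineq4) simp
      then show "AE x in lborel. norm (cmod (1 * f x + - 1 * g x) * exp (- \<epsilon> * x\<^sup>2)) \<le> norm (cmod (f x) * exp (- \<epsilon> * x\<^sup>2) + cmod (g x) * exp (- \<epsilon> * x\<^sup>2))"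
        by (intro AE_I2) (simp add: abs_mult distrib_right)
    qed measurable
  qed auto
  then have "AE x in lborel. 1 * f x + (-1) * g x = 0"
    using assms(3) by (intro bargmann_injective) (simp_all only: bargmann_linear[OF assms(1,2)], simp)
  then show ?thesis by eventually_elim simp
qed

text \<open>Multiplication by exp (b x) or exp (-b x) shifts the argument of the kernel by b or -b
  and leaves an exponential factor. This is the origin of the two branches of the Ruelle
  operator.\<close>

lemma bargmann_cosh:
  assumes g: "gauss_integrable g"
  shows "bargmann (\<lambda>x. cosh (b * of_real x) * g x) (b * z) =
    exp (b\<^sup>2 / 2) / 2 * (exp (b\<^sup>2 * z) * bargmann g (b * (z + 1)) + exp (- (b\<^sup>2 * z)) * bargmann g (b * (z - 1)))"
proof -
  have p: "exp (b * of_real x) * bargmann_kernel x (b * z) = exp (b\<^sup>2 / 2) * exp (b\<^sup>2 * z) * bargmann_kernel x (b * (z + 1))"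
    and m: "exp (- (b * of_real x)) * bargmann_kernel x (b * z) = exp (b\<^sup>2 / 2) * exp (- (b\<^sup>2 * z)) * bargmann_kernel x (b * (z - 1))" for x
    unfolding bargmann_kernel_def exp_add[symmetric] by (rule arg_cong[where f = exp], simp add: field_simps power2_eq_square)+
  have e: "cosh (b * of_real x) * g x * bargmann_kernel x (b * z)
     = exp (b\<^sup>2 / 2) / 2 * (exp (b\<^sup>2 * z) * (g x * bargmann_kernel x (b * (z + 1))) + exp (- (b\<^sup>2 * z)) * (g x * bargmann_kernel x (b * (z - 1))))" for x
  proof -
    have "cosh (b * of_real x) * g x * bargmann_kernel x (b * z)
      = g x / 2 * (exp (b * of_real x) * bargmann_kernel x (b * z) + exp (- (b * of_real x)) * bargmann_kernel x (b * z))"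
      by (simp add: cosh_def scaleR_conv_of_real field_simps)
    then show ?thesis unfolding p m by (simp add: field_simps)
  qed
  have i: "integrable lborel (\<lambda>x. c * (g x * bargmann_kernel x w))" for c w :: complex
    by (rule Bochner_Integration.integrable_mult_right) (rule bargmann_integrable[OF g])
  show ?thesis
    unfolding bargmann_def e by (simp only: Bochner_Integration.integral_add[OF i i] integral_mult_right_zero)
qed

section \<open>The Mehler kernel and its Bargmann conjugate, a dilation\<close>

definition mehler_kernel :: "real \<Rightarrow> real \<Rightarrow> real \<Rightarrow> real" where
  "mehler_kernel \<gamma> x y = exp (- (1/4) * tanh (\<gamma> / 2) * (x\<^sup>2 + y\<^sup>2) - (x - y)\<^sup>2 / (4 * sinh \<gamma>))"

definition mehler :: "real \<Rightarrow> (real \<Rightarrow> complex) \<Rightarrow> real \<Rightarrow> complex" where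
  "mehler \<gamma> g x = (\<integral>y. of_real (mehler_kernel \<gamma> x y) * g y \<partial>lborel)"

lemma measurable_mehler_kernel [measurable]:
  "(\<lambda>p. mehler_kernel \<gamma> (fst p) (snd p)) \<in> borel_measurable (borel \<Otimes>\<^sub>M borel)"
  "mehler_kernel \<gamma> x \<in> borel_measurable borel"
  unfolding mehler_kernel_def[abs_def] by measurable

lemma measurable_mehler [measurable]:
  assumes [measurable]: "g \<in> borel_measurable borel"
  shows "mehler \<gamma> g \<in> borel_measurable borel"
  unfolding mehler_def[abs_def] mehler_kernel_def by measurable

context
  fixes \<gamma> :: real
  assumes \<gamma>: "0 < \<gamma>"
begin

text \<open>Dropping the off-diagonal term leaves a product of one Gaussian in \<open>x\<close> and
  one in \<open>y\<close>; this separated majorant later gives the boundedness of the Kac-Gutzwiller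
  operator.\<close>

lemma mehler_kernel_le: "mehler_kernel \<gamma> x y \<le> exp (- (tanh (\<gamma> / 2) / 4) * x\<^sup>2) * exp (- (tanh (\<gamma> / 2) / 4) * y\<^sup>2)"
proof -
  have "0 \<le> (x - y)\<^sup>2 / (4 * sinh \<gamma>)" using \<gamma> by simp
  then show ?thesis
    unfolding mehler_kernel_def exp_add[symmetric] by (simp add: algebra_simps add_divide_distrib)
qed

lemma mehler_kernel_pos: "0 \<le> mehler_kernel \<gamma> x y"
  by (simp add: mehler_kernel_def)

lemma mehler_integrable:
  assumes g: "gauss_integrable g"
  shows "integrable lborel (\<lambda>y. of_real (mehler_kernel \<gamma> x y) * g y)"
proof (rule gauss_integrable_bound[OF g, where k = 0 and \<delta> = "tanh (\<gamma> / 2) / 4" and K = "exp (- (tanh (\<gamma> / 2) / 4) * x\<^sup>2)"])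
  note [measurable] = gauss_integrable_measurable[OF g]
  show "(\<lambda>y. of_real (mehler_kernel \<gamma> x y) * g y) \<in> borel_measurable borel" by measurable
  fix y
  show "norm (of_real (mehler_kernel \<gamma> x y) * g y) \<le> exp (- (tanh (\<gamma> / 2) / 4) * x\<^sup>2) * (cmod (g y) * exp (0 * \<bar>y\<bar> - tanh (\<gamma> / 2) / 4 * y\<^sup>2))"
    using mult_right_mono[OF mehler_kernel_le[of x y] norm_ge_zero[of "g y"]] mehler_kernel_pos[of x y]
    by (simp add: norm_mult mult_ac)
qed (use \<gamma> in simp)

lemma norm_mehler_le:
  assumes g: "gauss_integrable g"
  shows "cmod (mehler \<gamma> g x) \<le> exp (- (tanh (\<gamma> / 2) / 4) * x\<^sup>2) * (\<integral>y. cmod (g y) * exp (- (tanh (\<gamma> / 2) / 4) * y\<^sup>2) \<partial>lborel)"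
proof -
  have "integrable lborel (\<lambda>y. cmod (g y) * exp (- (tanh (\<gamma> / 2) / 4) * y\<^sup>2))"
  proof -
    have "0 < tanh (\<gamma> / 2) / 4" using \<gamma> by simp
    then show ?thesis using g unfolding gauss_integrable_def by blast
  qed
  then have i: "integrable lborel (\<lambda>y. exp (- (tanh (\<gamma> / 2) / 4) * x\<^sup>2) * (cmod (g y) * exp (- (tanh (\<gamma> / 2) / 4) * y\<^sup>2)))"
    by simp
  have "cmod (mehler \<gamma> g x) \<le> (\<integral>y. exp (- (tanh (\<gamma> / 2) / 4) * x\<^sup>2) * (cmod (g y) * exp (- (tanh (\<gamma> / 2) / 4) * y\<^sup>2)) \<partial>lborel)"
    unfolding mehler_def
  proof (rule Bochner_Integration.integral_norm_bound_integral[OF mehler_integrable[OF g] i])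
    fix y
    show "norm (of_real (mehler_kernel \<gamma> x y) * g y) \<le> exp (- (tanh (\<gamma> / 2) / 4) * x\<^sup>2) * (cmod (g y) * exp (- (tanh (\<gamma> / 2) / 4) * y\<^sup>2))"
      using mult_right_mono[OF mehler_kernel_le[of x y] norm_ge_zero[of "g y"]] mehler_kernel_pos[of x y]
      by (simp add: norm_mult mult_ac)
  qed
  then show ?thesis by simp
qed

lemma mehler_gauss_integrable:
  assumes g: "gauss_integrable g"
  shows "gauss_integrable (mehler \<gamma> g)"
proof (rule gauss_integrable_bounded)
  note [measurable] = gauss_integrable_measurable[OF g]
  show "mehler \<gamma> g \<in> borel_measurable borel" by measurable
  fix x
  let ?I = "\<integral>y. cmod (g y) * exp (- (tanh (\<gamma> / 2) / 4) * y\<^sup>2) \<partial>lborel"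
  have "exp (- (tanh (\<gamma> / 2) / 4) * x\<^sup>2) * ?I \<le> 1 * ?I"
    using \<gamma> by (intro mult_right_mono) auto
  then show "cmod (mehler \<gamma> g x) \<le> ?I"
    using norm_mehler_le[OF g, of x] by simp
qed

text \<open>As tanh (\<gamma> / 2) + 1 / sinh \<gamma> = coth \<gamma>, the kernel is, up to a
  constant, the heat kernel at time \<gamma> of the harmonic oscillator with ground state exp (-x^2
  / 4). It multiplies the n-th Hermite function by a constant times exp (-n \<gamma>), which on the
  generating function is a dilation of \<open>w\<close>.\<close>

lemma integral_bargmann_mehler_kernel:
  "(\<integral>x. bargmann_kernel x w * of_real (mehler_kernel \<gamma> x y) \<partial>lborel)
    = of_real (sqrt (4 * pi * exp (- \<gamma>) * sinh \<gamma>)) * bargmann_kernel y (of_real (exp (- \<gamma>)) * w)"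
proof -
  define S where "S = sinh \<gamma>"
  define L where "L = exp (- \<gamma>)"
  define t where "t = tanh (\<gamma> / 2)"
  have S: "0 < S" using \<gamma> by (simp add: S_def)
  have L: "0 < L" by (simp add: L_def)
  have LS: "2 * L * S = 1 - L\<^sup>2"
    by (simp add: L_def S_def sinh_def exp_minus field_simps power2_eq_square)
  \<comment> \<open>Half-angle formulas: tanh (\<gamma> / 2) = (1 - L) / (1 + L) and sinh \<gamma> =
    (1 - L^2) / (2 L), so that everything becomes rational in \<open>L\<close>.\<close>
  have tS: "t * S = (1 - L)\<^sup>2 / (2 * L)"
  proof -
    define e where "e = exp (\<gamma> / 2)"
    have e: "0 < e" "exp \<gamma> = e\<^sup>2" by (auto simp: e_def exp_double[symmetric])
    have sc: "sinh (\<gamma> / 2) = (e - 1 / e) / 2" "cosh (\<gamma> / 2) = (e + 1 / e) / 2"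
      by (simp_all add: sinh_def cosh_def e_def exp_minus inverse_eq_divide)
    have "t = (e - 1 / e) / (e + 1 / e)"
    proof -
      have "(a / 2) / (b / 2) = a / b" for a b :: real by simp
      then show ?thesis unfolding t_def tanh_def sc .
    qed
    also have "\<dots> = (e * (1 - L)) / (e * (1 + L))"
    proof -
      have "L = 1 / e\<^sup>2" by (simp add: L_def exp_minus e(2) inverse_eq_divide)
      then have "e * L = 1 / e" using e(1) by (simp add: power2_eq_square)
      then show ?thesis by (simp add: right_diff_distrib distrib_left)
    qed
    finally have t1: "t = (1 - L) / (1 + L)" using e(1) by simp
    have S1: "S = (1 - L) * (1 + L) / (2 * L)"
      using LS L by (simp add: field_simps power2_eq_square)
    have "1 + L \<noteq> 0" using L by simp
    then show ?thesis unfolding t1 S1 by (simp add: power2_eq_square)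
  qed
  \<comment> \<open>The coefficients of -x^2 from the Bargmann kernel, the potential term and the
    off-diagonal term add up to the rate \<open>p\<close> of the Gaussian integral.\<close>
  have tS': "1 / 4 + t / 4 + 1 / (4 * S) = 1 / (4 * L * S)"
  proof -
    have "L * (t * S) = (1 - L)\<^sup>2 / 2" unfolding tS using L by simp
    moreover have "L * S = (1 - L\<^sup>2) / 2" using LS by simp
    ultimately have 1: "L * S + L * (t * S) + L = 1"
      by (simp add: field_simps power2_eq_square)
    have "1 / 4 + t / 4 + 1 / (4 * S) = (L * S + L * (t * S) + L) / (4 * L * S)"
      using S L by (simp add: field_simps)
    then show ?thesis unfolding 1 .
  qed
  define p where "p = 1 / (4 * L * S)"
  have p: "0 < p" using S L by (simp add: p_def)
  define v where "v = w + of_real (y / (2 * S))"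
  have e: "bargmann_kernel x w * of_real (mehler_kernel \<gamma> x y)
      = exp (- w\<^sup>2 / 2 - of_real ((t / 4 + 1 / (4 * S)) * y\<^sup>2)) * exp (v * of_real x - of_real (p * x\<^sup>2))" for x
  proof -
    have "- (x\<^sup>2 / 4) + (- (1/4) * t * (x\<^sup>2 + y\<^sup>2) - (x - y)\<^sup>2 / (4 * S))
        = - ((t / 4 + 1 / (4 * S)) * y\<^sup>2) + y / (2 * S) * x - (1 / 4 + t / 4 + 1 / (4 * S)) * x\<^sup>2"
      using S by (simp add: field_simps power2_eq_square)
    then have q: "- (x\<^sup>2 / 4) + (- (1/4) * t * (x\<^sup>2 + y\<^sup>2) - (x - y)\<^sup>2 / (4 * S))
        = - ((t / 4 + 1 / (4 * S)) * y\<^sup>2) + y / (2 * S) * x - p * x\<^sup>2"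
      unfolding tS' p_def .
    have "bargmann_kernel x w * of_real (mehler_kernel \<gamma> x y)
        = exp (of_real x * w - w\<^sup>2 / 2 + of_real (- (x\<^sup>2 / 4) + (- (1/4) * t * (x\<^sup>2 + y\<^sup>2) - (x - y)\<^sup>2 / (4 * S))))"
      unfolding bargmann_kernel_def mehler_kernel_def exp_of_real[symmetric] exp_add[symmetric] t_def S_def
      by (rule arg_cong[where f = exp]) simp
    also have "\<dots> = exp (- w\<^sup>2 / 2 - of_real ((t / 4 + 1 / (4 * S)) * y\<^sup>2)) * exp (v * of_real x - of_real (p * x\<^sup>2))"
      unfolding q v_def exp_add[symmetric] by (rule arg_cong[where f = exp]) (simp add: algebra_simps)
    finally show ?thesis .
  qed
  have "(\<integral>x. bargmann_kernel x w * of_real (mehler_kernel \<gamma> x y) \<partial>lborel)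
    = exp (- w\<^sup>2 / 2 - of_real ((t / 4 + 1 / (4 * S)) * y\<^sup>2)) * (of_real (sqrt (pi / p)) * exp (v\<^sup>2 / of_real (4 * p)))"
    unfolding e using complex_gaussian[OF p, of v] by (simp only: integral_mult_right_zero has_bochner_integral_iff)
  also have "pi / p = 4 * pi * exp (- \<gamma>) * sinh \<gamma>" by (simp add: p_def L_def S_def)
  also have "exp (- w\<^sup>2 / 2 - of_real ((t / 4 + 1 / (4 * S)) * y\<^sup>2)) * (of_real (sqrt (4 * pi * exp (- \<gamma>) * sinh \<gamma>)) * exp (v\<^sup>2 / of_real (4 * p)))
     = of_real (sqrt (4 * pi * exp (- \<gamma>) * sinh \<gamma>)) * exp (- w\<^sup>2 / 2 - of_real ((t / 4 + 1 / (4 * S)) * y\<^sup>2) + v\<^sup>2 / of_real (4 * p))"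
    by (simp only: exp_add mult_ac)
  also have "- w\<^sup>2 / 2 - of_real ((t / 4 + 1 / (4 * S)) * y\<^sup>2) + v\<^sup>2 / of_real (4 * p)
     = of_real y * (of_real L * w) - of_real (y\<^sup>2 / 4) - (of_real L * w)\<^sup>2 / 2"
  proof -
    have "v\<^sup>2 / of_real (4 * p) = of_real (L * S) * v\<^sup>2"
      using S L by (simp add: p_def)
    also have "\<dots> = of_real (L * S) * w\<^sup>2 + of_real L * w * of_real y + of_real (L / (4 * S) * y\<^sup>2)"
      using S by (simp add: v_def field_simps power2_eq_square)
    finally have 1: "v\<^sup>2 / of_real (4 * p) = of_real (L * S) * w\<^sup>2 + of_real L * w * of_real y + of_real (L / (4 * S) * y\<^sup>2)" .
    \<comment> \<open>The coefficients of \<open>y\<^sup>2\<close> and \<open>w\<^sup>2\<close> must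
      come out as -1/4 and -L^2 / 2, those in the exponent of the Bargmann kernel at
      \<open>L * w\<close>.\<close>
    have 2: "L / (4 * S) - (t / 4 + 1 / (4 * S)) = - 1 / 4"
    proof -
      have "2 * L * (t * S) = (1 - L)\<^sup>2" unfolding tS using L by simp
      then have "2 * L * (L - t * S - 1 + S) = 2 * L\<^sup>2 - (1 - L)\<^sup>2 - 2 * L + 2 * L * S"
        by (simp add: algebra_simps power2_eq_square)
      also have "\<dots> = 0" unfolding LS by (simp add: algebra_simps power2_eq_square)
      finally have 0: "L - t * S - 1 = - S" using L by simp
      have "L / (4 * S) - (t / 4 + 1 / (4 * S)) = (L - t * S - 1) / (4 * S)"
        using S by (simp add: field_simps)
      then show ?thesis unfolding 0 using S by simp
    qed
    have 3: "L * S - 1 / 2 = - L\<^sup>2 / 2" using LS by (simp add: field_simps)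
    have "- w\<^sup>2 / 2 - of_real ((t / 4 + 1 / (4 * S)) * y\<^sup>2) + v\<^sup>2 / of_real (4 * p)
       = of_real (L * S - 1 / 2) * w\<^sup>2 + of_real L * w * of_real y + of_real ((L / (4 * S) - (t / 4 + 1 / (4 * S))) * y\<^sup>2)"
      unfolding 1 by (simp add: algebra_simps)
    also have "\<dots> = of_real y * (of_real L * w) - of_real (y\<^sup>2 / 4) - (of_real L * w)\<^sup>2 / 2"
      unfolding 2 3 by (simp add: power_mult_distrib)
    finally show ?thesis .
  qed
  finally show ?thesis by (simp add: bargmann_kernel_def L_def)
qed

theorem bargmann_mehler:
  assumes g: "gauss_integrable g"
  shows "bargmann (mehler \<gamma> g) w
    = of_real (sqrt (4 * pi * exp (- \<gamma>) * sinh \<gamma>)) * bargmann g (of_real (exp (- \<gamma>)) * w)"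
proof -
  note [measurable] = gauss_integrable_measurable[OF g]
  let ?h = "\<lambda>x y. of_real (mehler_kernel \<gamma> x y) * g y * bargmann_kernel x w"
  have i1: "integrable lborel (\<lambda>y. ?h x y)" for x
    by (rule Bochner_Integration.integrable_mult_left) (rule mehler_integrable[OF g])
  have "integrable (lborel \<Otimes>\<^sub>M lborel) (case_prod ?h)"
  proof (rule lborel_pair.Fubini_integrable)
    let ?I = "\<integral>y. cmod (g y) * exp (- (tanh (\<gamma> / 2) / 4) * y\<^sup>2) \<partial>lborel"
    \<comment> \<open>Absolute integrability for Fubini: the Mehler kernel is positive, so the inner
      integral of norms is the Mehler transform of the modulus of \<open>g\<close>, and the outer
      one is a convergent Bargmann integral.\<close>
    let ?n = "\<lambda>y. of_real (cmod (g y)) :: complex"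
    have n: "gauss_integrable ?n" using g by (auto simp: gauss_integrable_def)
    have "(\<integral>y. norm (case_prod ?h (x, y)) \<partial>lborel) = cmod (mehler \<gamma> ?n x * bargmann_kernel x w)" for x
    proof -
      have "mehler \<gamma> ?n x = of_real (\<integral>y. mehler_kernel \<gamma> x y * cmod (g y) \<partial>lborel)"
        unfolding mehler_def of_real_mult[symmetric] by (rule integral_complex_of_real)
      moreover have "0 \<le> (\<integral>y. mehler_kernel \<gamma> x y * cmod (g y) \<partial>lborel)"
        by (simp add: mehler_kernel_pos)
      ultimately show ?thesis by (simp add: norm_mult mehler_kernel_pos)
    qed
    then show "integrable lborel (\<lambda>x. \<integral>y. norm (case_prod ?h (x, y)) \<partial>lborel)"
      using integrable_norm[OF bargmann_integrable[OF mehler_gauss_integrable[OF n], of w]] by simp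
  qed (use i1 in auto)
  then have "(\<integral>x. (\<integral>y. ?h x y \<partial>lborel) \<partial>lborel) = (\<integral>y. (\<integral>x. ?h x y \<partial>lborel) \<partial>lborel)"
    by (rule lborel_pair.Fubini_integral[symmetric])
  moreover have "(\<integral>y. ?h x y \<partial>lborel) = mehler \<gamma> g x * bargmann_kernel x w" for x
    unfolding mehler_def by (rule integral_mult_left_zero)
  moreover have "(\<integral>x. ?h x y \<partial>lborel) = of_real (sqrt (4 * pi * exp (- \<gamma>) * sinh \<gamma>)) * (g y * bargmann_kernel y (of_real (exp (- \<gamma>)) * w))" for y
  proof -
    have "(\<integral>x. ?h x y \<partial>lborel) = (\<integral>x. g y * (bargmann_kernel x w * of_real (mehler_kernel \<gamma> x y)) \<partial>lborel)"
      by (simp only: mult_ac)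
    then show ?thesis
      unfolding integral_mult_right_zero integral_bargmann_mehler_kernel by (simp only: mult_ac)
  qed
  ultimately show ?thesis
    unfolding bargmann_def by (simp only: integral_mult_right_zero)
qed

end

section \<open>The inverse transform\<close>

text \<open>The adjoint kernel: the conjugate of \<open>bargmann_kernel x (sqrt pi * z)\<close>
  times the weight of the Fock space with t = 1.\<close>

definition inv_kernel :: "real \<Rightarrow> complex \<Rightarrow> complex" where
  "inv_kernel x z = exp (of_real (sqrt pi * x) * cnj z - of_real (x\<^sup>2 / 4)
     - of_real (pi / 2) * (cnj z)\<^sup>2 - of_real (pi * (cmod z)\<^sup>2))"

definition bargmann_inv :: "(complex \<Rightarrow> complex) \<Rightarrow> real \<Rightarrow> complex" where
  "bargmann_inv F x = (\<integral>z. F z * inv_kernel x z \<partial>lborel)"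

lemma measurable_cnj [measurable]: "cnj \<in> borel_measurable borel"
  by (intro borel_measurable_continuous_onI continuous_intros)

lemma measurable_inv_kernel [measurable]:
  "inv_kernel x \<in> borel_measurable borel"
  "case_prod inv_kernel \<in> borel_measurable (borel \<Otimes>\<^sub>M borel)"
  unfolding inv_kernel_def[abs_def] split_def by measurable

lemma measurable_bargmann_inv [measurable]:
  assumes [measurable]: "F \<in> borel_measurable borel"
  shows "bargmann_inv F \<in> borel_measurable borel"
  unfolding bargmann_inv_def[abs_def] inv_kernel_def by measurable

text \<open>The term with \<open>(cnj z)\<^sup>2\<close> strengthens the Gaussian weight in the real
  direction and weakens it in the imaginary one, from pi to 3 pi / 2 and pi / 2. The smaller rate
  dictates the condition a < pi / 2 below.\<close>

lemma norm_inv_kernel: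
  "cmod (inv_kernel x z) = exp (- (x\<^sup>2 / 4)) *
     exp (sqrt pi * x * Re z - 3 * pi / 2 * (Re z)\<^sup>2 + (0 * Im z - pi / 2 * (Im z)\<^sup>2))"
proof -
  have "Re ((cnj z)\<^sup>2) = (Re z)\<^sup>2 - (Im z)\<^sup>2" by (simp add: power2_eq_square)
  then have "Re (of_real (sqrt pi * x) * cnj z - of_real (x\<^sup>2 / 4) - of_real (pi / 2) * (cnj z)\<^sup>2 - of_real (pi * (cmod z)\<^sup>2))
     = sqrt pi * x * Re z - x\<^sup>2 / 4 - pi / 2 * ((Re z)\<^sup>2 - (Im z)\<^sup>2) - pi * ((Re z)\<^sup>2 + (Im z)\<^sup>2)"
    by (simp add: cmod_power2)
  also have "\<dots> = - (x\<^sup>2 / 4) + (sqrt pi * x * Re z - 3 * pi / 2 * (Re z)\<^sup>2 + (0 * Im z - pi / 2 * (Im z)\<^sup>2))"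
    by (simp add: algebra_simps)
  finally show ?thesis unfolding inv_kernel_def norm_exp_eq_Re exp_add[symmetric] by simp
qed

text \<open>Decay rate in x of the inverse transform of a function of growth rate \<open>a\<close>:
  the 1/4 of the kernel minus what integrating exp (sqrt pi * x * Re z) against the remaining
  Gaussian gives back. It is positive for a < pi / 2.\<close>

definition inv_decay :: "real \<Rightarrow> real" where
  "inv_decay a = 1 / 4 - pi / (4 * (3 * pi / 2 - a))"

definition inv_const :: "real \<Rightarrow> real" where
  "inv_const a = pi / sqrt ((3 * pi / 2 - a) * (pi / 2 - a))"

context
  fixes F :: "complex \<Rightarrow> complex" and K a :: real
  assumes F [measurable]: "F \<in> borel_measurable borel"
    and bd: "\<And>z. cmod (F z) \<le> K * exp (a * (cmod z)\<^sup>2)" and a: "a < pi / 2"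
begin

lemma pq: "0 < 3 * pi / 2 - a" "0 < pi / 2 - a"
  using a pi_gt_zero by linarith+

lemma inv_decay_pos: "0 < inv_decay a"
proof -
  have "pi < 3 * pi / 2 - a" using a by linarith
  then have "pi / (4 * (3 * pi / 2 - a)) < 1 / 4" using pq(1) by (subst pos_divide_less_eq) auto
  then show ?thesis by (simp add: inv_decay_def)
qed

lemma inv_integrand_bound:
  "cmod (F z * inv_kernel x z) \<le> (K * exp (- (x\<^sup>2 / 4))) *
     exp (sqrt pi * x * Re z - (3 * pi / 2 - a) * (Re z)\<^sup>2 + (0 * Im z - (pi / 2 - a) * (Im z)\<^sup>2))"
proof -
  have "cmod (F z * inv_kernel x z) \<le> K * exp (a * (cmod z)\<^sup>2) * cmod (inv_kernel x z)"
    unfolding norm_mult by (intro mult_right_mono bd) simp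
  also have "\<dots> = (K * exp (- (x\<^sup>2 / 4))) * (exp (a * (cmod z)\<^sup>2) * exp (sqrt pi * x * Re z - 3 * pi / 2 * (Re z)\<^sup>2 + (0 * Im z - pi / 2 * (Im z)\<^sup>2)))"
    unfolding norm_inv_kernel by (simp only: mult_ac)
  also have "exp (a * (cmod z)\<^sup>2) * exp (sqrt pi * x * Re z - 3 * pi / 2 * (Re z)\<^sup>2 + (0 * Im z - pi / 2 * (Im z)\<^sup>2))
     = exp (sqrt pi * x * Re z - (3 * pi / 2 - a) * (Re z)\<^sup>2 + (0 * Im z - (pi / 2 - a) * (Im z)\<^sup>2))"
    unfolding exp_add[symmetric] cmod_power2 by (rule arg_cong[where f = exp]) (simp add: algebra_simps)
  finally show ?thesis .
qed

lemma inv_bound_eq: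
  "(K * exp (- (x\<^sup>2 / 4))) * (pi / sqrt ((3 * pi / 2 - a) * (pi / 2 - a))) *
     exp ((sqrt pi * x)\<^sup>2 / (4 * (3 * pi / 2 - a)) + 0\<^sup>2 / (4 * (pi / 2 - a)))
   = K * inv_const a * exp (- inv_decay a * x\<^sup>2)"
proof -
  have "exp (- (x\<^sup>2 / 4)) * exp ((sqrt pi * x)\<^sup>2 / (4 * (3 * pi / 2 - a)) + 0\<^sup>2 / (4 * (pi / 2 - a))) = exp (- inv_decay a * x\<^sup>2)"
    unfolding exp_add[symmetric] inv_decay_def
    by (rule arg_cong[where f = exp]) (simp add: power_mult_distrib left_diff_distrib)
  moreover have "k * e * c * y = k * c * (e * y)" for k e c y :: real by simp
  ultimately show ?thesis unfolding inv_const_def by simp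
qed

lemma inv_integrable: "integrable lborel (\<lambda>z. F z * inv_kernel x z)"
  by (rule integrable_complex_gaussian_bound(1)[OF _ _ _ inv_integrand_bound]) (use pq in simp_all)

lemma norm_bargmann_inv: "cmod (bargmann_inv F x) \<le> K * inv_const a * exp (- inv_decay a * x\<^sup>2)"
  unfolding bargmann_inv_def inv_bound_eq[symmetric]
  by (rule integrable_complex_gaussian_bound(2)[OF _ _ _ inv_integrand_bound]) (use pq in simp_all)

lemma inv_norm_integral:
  "(\<integral>z. cmod (F z * inv_kernel x z) \<partial>lborel) \<le> K * inv_const a * exp (- inv_decay a * x\<^sup>2)"
proof -
  have "cmod (\<integral>z. of_real (cmod (F z * inv_kernel x z)) \<partial>lborel) \<le> K * inv_const a * exp (- inv_decay a * x\<^sup>2)"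
    unfolding inv_bound_eq[symmetric]
    by (rule integrable_complex_gaussian_bound(2)) (use pq inv_integrand_bound in simp_all)
  then show ?thesis by (simp only: integral_complex_of_real norm_of_real)
qed

lemma bargmann_inv_gauss_integrable: "gauss_integrable (bargmann_inv F)"
proof (rule gauss_integrable_bounded)
  fix x
  have "0 \<le> K" using order_trans[OF norm_ge_zero bd[of 0]] by simp
  moreover have "0 \<le> inv_const a" unfolding inv_const_def using pq pi_gt_zero
    by (intro divide_nonneg_nonneg real_sqrt_ge_zero mult_nonneg_nonneg) linarith+
  moreover have "exp (- inv_decay a * x\<^sup>2) \<le> 1" using inv_decay_pos by simp
  ultimately have "K * inv_const a * exp (- inv_decay a * x\<^sup>2) \<le> K * inv_const a * 1"
    by (intro mult_left_mono) auto
  with norm_bargmann_inv[of x] show "cmod (bargmann_inv F x) \<le> K * inv_const a" by simp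
qed measurable

text \<open>Composing the inverse transform with the transform produces the reproducing kernel with
  its weight: completing the square cancels the terms in \<open>w\<^sup>2\<close> and
  \<open>(cnj z)\<^sup>2\<close> and leaves the mixed one.\<close>

lemma integral_inv_kernel_bargmann_kernel:
  "(\<integral>x. inv_kernel x z * bargmann_kernel x (of_real (sqrt pi) * w) \<partial>lborel)
    = of_real (sqrt (2 * pi)) * exp (of_real pi * w * cnj z - of_real (pi * (cmod z)\<^sup>2))"
proof -
  define v where "v = of_real (sqrt pi) * (w + cnj z)"
  define C where "C = - of_real (pi / 2) * (cnj z)\<^sup>2 - of_real (pi * (cmod z)\<^sup>2) - of_real (pi / 2) * w\<^sup>2"
  have s: "(complex_of_real (sqrt pi))\<^sup>2 = of_real pi" by (simp flip: of_real_power)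
  have e: "inv_kernel x z * bargmann_kernel x (of_real (sqrt pi) * w) = exp C * exp (v * of_real x - of_real (1 / 2 * x\<^sup>2))" for x
    unfolding inv_kernel_def bargmann_kernel_def exp_add[symmetric] C_def v_def power_mult_distrib s
    by (rule arg_cong[where f = exp]) (simp add: field_simps)
  have "(\<integral>x. inv_kernel x z * bargmann_kernel x (of_real (sqrt pi) * w) \<partial>lborel)
     = exp C * (of_real (sqrt (pi / (1 / 2))) * exp (v\<^sup>2 / of_real (4 * (1 / 2))))"
    unfolding e using complex_gaussian[of "1/2" v] by (simp only: integral_mult_right_zero has_bochner_integral_iff)
  also have "\<dots> = of_real (sqrt (2 * pi)) * exp (C + v\<^sup>2 / 2)"
    by (simp add: exp_add mult.commute)
  also have "C + v\<^sup>2 / 2 = of_real pi * w * cnj z - of_real (pi * (cmod z)\<^sup>2)"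
    unfolding C_def v_def power_mult_distrib s by (simp add: field_simps power2_eq_square)
  finally show ?thesis .
qed

theorem bargmann_bargmann_inv:
  assumes hol: "F holomorphic_on UNIV"
  shows "bargmann (bargmann_inv F) (of_real (sqrt pi) * w) = of_real (sqrt (2 * pi)) * F w"
proof -
  let ?w = "of_real (sqrt pi) * w"
  let ?h = "\<lambda>x z. F z * inv_kernel x z * bargmann_kernel x ?w"
  have K: "0 \<le> K * inv_const a * exp (- inv_decay a * x\<^sup>2)" for x
    using order_trans[OF norm_ge_zero norm_bargmann_inv] .
  have "integrable (lborel \<Otimes>\<^sub>M lborel) (case_prod ?h)"
  proof (rule lborel_pair.Fubini_integrable)
    \<comment> \<open>The inner integral of norms has a Gaussian majorant, itself
      \<open>gauss_integrable\<close>; the outer integral is thus dominated by a convergent Bargmann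
      integral.\<close>
    let ?g = "\<lambda>x. of_real (K * inv_const a * exp (- inv_decay a * x\<^sup>2)) :: complex"
    have "gauss_integrable ?g"
      by (intro gauss_integrable_square_integrable square_integrable_of_gaussian_bound(1)[where K = "\<bar>K * inv_const a\<bar>" and k = 0 and \<delta> = "inv_decay a"])
         (use inv_decay_pos in \<open>auto simp: norm_mult abs_mult\<close>)
    from integrable_norm[OF bargmann_integrable[OF this, of ?w]]
    show "integrable lborel (\<lambda>x. \<integral>z. norm (case_prod ?h (x, z)) \<partial>lborel)"
    proof (rule Bochner_Integration.integrable_bound)
      show "AE x in lborel. norm (\<integral>z. norm (case_prod ?h (x, z)) \<partial>lborel)
          \<le> norm (norm (?g x * bargmann_kernel x ?w))"
      proof (rule AE_I2)
        fix x
        have "(\<integral>z. norm (case_prod ?h (x, z)) \<partial>lborel) = (\<integral>z. cmod (F z * inv_kernel x z) \<partial>lborel) * cmod (bargmann_kernel x ?w)"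
          by (simp add: norm_mult)
        also have "\<dots> \<le> K * inv_const a * exp (- inv_decay a * x\<^sup>2) * cmod (bargmann_kernel x ?w)"
          by (intro mult_right_mono inv_norm_integral) simp
        also have "\<dots> = norm (norm (?g x * bargmann_kernel x ?w))"
          using K[of x] unfolding norm_mult norm_of_real by simp
        finally show "norm (\<integral>z. norm (case_prod ?h (x, z)) \<partial>lborel) \<le> norm (norm (?g x * bargmann_kernel x ?w))"
          by simp
      qed
    qed measurable
    show "AE x in lborel. integrable lborel (\<lambda>z. case_prod ?h (x, z))"
      using inv_integrable by (intro AE_I2) (simp add: Bochner_Integration.integrable_mult_left)
  qed measurable
  then have "(\<integral>x. (\<integral>z. ?h x z \<partial>lborel) \<partial>lborel) = (\<integral>z. (\<integral>x. ?h x z \<partial>lborel) \<partial>lborel)"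
    by (rule lborel_pair.Fubini_integral[symmetric])
  moreover have "(\<integral>z. ?h x z \<partial>lborel) = bargmann_inv F x * bargmann_kernel x ?w" for x
    unfolding bargmann_inv_def by (rule integral_mult_left_zero)
  moreover have "(\<integral>x. ?h x z \<partial>lborel) = of_real (sqrt (2 * pi)) * (F z * exp (of_real pi * w * cnj z - of_real (pi * (cmod z)\<^sup>2)))" for z
    unfolding mult.assoc integral_mult_right_zero integral_inv_kernel_bargmann_kernel by (rule mult.left_commute)
  ultimately show ?thesis
    using fock_reproducing[OF hol bd, of w] a pi_gt_zero
    unfolding bargmann_def by (simp only: integral_mult_right_zero)
qed

end

section \<open>The two transfer operators\<close>

lemma bargmann_scale: "bargmann (\<lambda>x. c * g x) w = c * bargmann g w"
  unfolding bargmann_def mult.assoc by (rule integral_mult_right_zero)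

text \<open>Continuity fails on the negative real axis, which the argument
  \<open>cosh (b * of_real x)\<close> does reach for \<beta> < 0.\<close>

lemma measurable_csqrt [measurable]: "csqrt \<in> borel_measurable borel"
proof -
  have "csqrt = (\<lambda>z. of_real (sqrt ((cmod z + Re z) / 2)) +
      \<i> * of_real ((if Im z = 0 then 1 else sgn (Im z)) * sqrt ((cmod z - Re z) / 2)))"
    by (simp add: fun_eq_iff complex_eq_iff)
  moreover have "\<dots> \<in> borel_measurable borel" unfolding sgn_real_def by measurable
  ultimately show ?thesis by simp
qed

lemma measurable_cosh [measurable]: "(cosh :: complex \<Rightarrow> complex) \<in> borel_measurable borel"
  by (intro borel_measurable_continuous_onI continuous_intros)

section \<open>Parameters and the square root of the hyperbolic cosine\<close>

locale kac_baker =
  fixes \<gamma> lam \<beta> :: real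
  assumes lam_def: "lam = exp (- \<gamma>)" and lam_less: "lam < 1" and \<beta>: "\<beta> \<noteq> 0"
begin

lemma \<gamma>: "0 < \<gamma>" using lam_less by (simp add: lam_def)

lemma lam: "0 < lam" by (simp add: lam_def)

definition b :: complex where "b = sqrt_beta \<beta>"

lemma b_sq: "b\<^sup>2 = of_real \<beta>" by (simp add: b_def sqrt_beta_def)

lemma b_nz: "b \<noteq> 0" using b_sq \<beta> by auto

lemma norm_b_sq: "(cmod b)\<^sup>2 = \<bar>\<beta>\<bar>"
  using b_sq norm_power[of b 2] by simp

definition cc :: "real \<Rightarrow> complex" where "cc x = csqrt (cosh (b * of_real x))"

lemma measurable_cc [measurable]: "cc \<in> borel_measurable borel"
  unfolding cc_def[abs_def] by measurable

text \<open>True for either branch of the root. The Kac kernel and the transform \<open>A\<close>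
  each contribute a factor \<open>cc\<close>, and they meet as this product.\<close>

lemma cc_mult: "cc x * cc x = cosh (b * of_real x)"
  using power2_csqrt[of "cosh (b * of_real x)"] by (simp add: cc_def power2_eq_square)

lemma norm_cosh_le: "cmod (cosh (b * of_real x)) \<le> exp (cmod b * \<bar>x\<bar>)"
proof -
  have "cmod (exp (b * of_real x)) \<le> exp (cmod b * \<bar>x\<bar>)" "cmod (exp (- (b * of_real x))) \<le> exp (cmod b * \<bar>x\<bar>)"
    using norm_exp[of "b * of_real x"] norm_exp[of "- (b * of_real x)"] by (simp_all add: norm_mult)
  then have "cmod (exp (b * of_real x) + exp (- (b * of_real x))) \<le> 2 * exp (cmod b * \<bar>x\<bar>)"
    using norm_triangle_ineq[of "exp (b * of_real x)" "exp (- (b * of_real x))"] by linarith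
  then show ?thesis by (simp add: cosh_def)
qed

lemma norm_cc_le: "cmod (cc x) \<le> exp (cmod b * \<bar>x\<bar>)"
proof (rule power2_le_imp_le)
  have "(cmod (cc x))\<^sup>2 = cmod (cosh (b * of_real x))"
    unfolding cc_mult[symmetric] norm_mult power2_eq_square ..
  also have "\<dots> \<le> exp (cmod b * \<bar>x\<bar>) * 1" using norm_cosh_le by simp
  also have "\<dots> \<le> exp (cmod b * \<bar>x\<bar>) * exp (cmod b * \<bar>x\<bar>)"
    by (intro mult_left_mono) auto
  finally show "(cmod (cc x))\<^sup>2 \<le> (exp (cmod b * \<bar>x\<bar>))\<^sup>2" by (simp add: power2_eq_square)
qed simp

text \<open>For \<beta> < 0 these are zeros of a cosine, for \<beta> > 0 there are none on the real
  line. Both signs are covered by countability of the zeros of a nonconstant entire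
  function.\<close>

lemma cc_nz_AE: "AE x in lborel. cc x \<noteq> 0"
proof -
  have hol: "(\<lambda>z. cosh (b * z)) holomorphic_on UNIV"
    unfolding cosh_def by (intro holomorphic_intros)
  have "countable {z \<in> UNIV. cosh (b * z) = 0}"
  proof (rule holomorphic_countable_zeros[OF hol])
    have "cosh (b * (\<i> * of_real (pi / 2) / b)) = cosh (\<i> * of_real (pi / 2))"
      using b_nz by simp
    also have "\<dots> = cos (of_real (pi / 2))" by (rule cos_conv_cosh[symmetric])
    also have "\<dots> = 0" unfolding cos_of_real by simp
    finally have 0: "cosh (b * (\<i> * of_real (pi / 2) / b)) = 0" .
    show "\<not> (\<lambda>z. cosh (b * z)) constant_on UNIV"
    proof
      assume "(\<lambda>z. cosh (b * z)) constant_on UNIV"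
      then obtain c where c: "\<And>z. cosh (b * z) = c" by (auto simp: constant_on_def)
      have "c = 1" using c[of 0] by simp
      moreover have "c = 0" using 0 unfolding c .
      ultimately show False by simp
    qed
  qed auto
  moreover have "complex_of_real ` {x. cc x = 0} \<subseteq> {z \<in> UNIV. cosh (b * z) = 0}"
    by (auto simp: cc_def)
  ultimately have "countable (complex_of_real ` {x. cc x = 0})"
    using countable_subset by blast
  then have "countable {x. cc x = 0}"
    by (rule countable_image_inj_on) (simp add: inj_on_def)
  then have "{x. cc x = 0} \<in> null_sets lborel"
    by (simp add: countable_imp_null_set_lborel)
  then show ?thesis by (rule AE_I') auto
qed

section \<open>The two operators in Bargmann form and their intertwining\<close>

abbreviation "\<L> \<equiv> ruelle_op lam \<beta>"
abbreviation "\<G> \<equiv> gutzwiller_op \<gamma> \<beta>"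
abbreviation "A \<equiv> gutzwiller_to_ruelle \<beta>"
abbreviation "\<mu> \<equiv> fock_measure (\<bar>\<beta>\<bar> / pi)"
abbreviation "H \<equiv> HL2 (\<bar>\<beta>\<bar> / pi)"
abbreviation "L2 \<equiv> square_integrable (lborel :: real measure)"

text \<open>The prefactor of \<open>gutzwiller_to_ruelle\<close> divided by the Jacobian of the
  substitution y = 2 sqrt pi x, which brings it into Bargmann form.\<close>

definition a0 :: real where "a0 = (8 * pi) powr (1/4) / (2 * sqrt pi)"
definition g0 :: real where "g0 = (exp (- \<gamma>) * exp \<beta>) powr (- 1/2) / sqrt (pi * sinh \<gamma>)"

lemma a0_pos: "0 < a0" by (simp add: a0_def)

lemma g0_pos: "0 < g0" using \<gamma> by (simp add: g0_def)

lemma ruelle_integrand_eq: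
  "ruelle_integrand \<beta> f z x = (\<lambda>y. cc y * f y * bargmann_kernel y (b * z)) (0 + 2 * sqrt pi * x)"
proof -
  have s: "sqrt pi * sqrt pi = pi" by simp
  have e: "2 * (of_real (sqrt pi) * b) * of_real x * z - of_real (pi * x\<^sup>2) - of_real (\<beta> / 2) * z\<^sup>2
    = of_real (2 * sqrt pi * x) * (b * z) - of_real ((2 * sqrt pi * x)\<^sup>2 / 4) - (b * z)\<^sup>2 / 2"
  proof -
    have "(2 * sqrt pi * x)\<^sup>2 / 4 = pi * x\<^sup>2" using s by (simp add: power_mult_distrib)
    moreover have "(b * z)\<^sup>2 / 2 = of_real (\<beta> / 2) * z\<^sup>2" by (simp add: power_mult_distrib b_sq)
    ultimately show ?thesis by simp
  qed
  have c: "2 * (of_real (sqrt pi) * b) * of_real x = b * of_real (2 * sqrt pi * x)" by simp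
  show ?thesis
    unfolding ruelle_integrand_def b_def[symmetric] e unfolding c cc_def bargmann_kernel_def by simp
qed

lemma A_eq: "A f z = of_real a0 * bargmann (\<lambda>x. cc x * f x) (b * z)"
proof -
  let ?h = "\<lambda>y. cc y * f y * bargmann_kernel y (b * z)"
  have "integral\<^sup>L lborel ?h = \<bar>2 * sqrt pi\<bar> *\<^sub>R (\<integral>x. ruelle_integrand \<beta> f z x \<partial>lborel)"
    unfolding ruelle_integrand_eq by (rule lborel_integral_real_affine) simp
  then have "bargmann (\<lambda>x. cc x * f x) (b * z) = of_real (2 * sqrt pi) * (\<integral>x. ruelle_integrand \<beta> f z x \<partial>lborel)"
    by (simp add: bargmann_def scaleR_conv_of_real)
  then show ?thesis
    by (simp add: gutzwiller_to_ruelle_def a0_def)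
qed

lemma G_eq: "\<G> f x = of_real g0 * (cc x * mehler \<gamma> (\<lambda>y. cc y * f y) x)"
proof -
  have "kac_kernel \<gamma> \<beta> x y * f y = (cc x / of_real (sqrt (pi * sinh \<gamma>))) * (of_real (mehler_kernel \<gamma> x y) * (cc y * f y))" for y
    by (simp add: kac_kernel_def cc_def b_def mehler_kernel_def)
  then show ?thesis
    by (simp add: gutzwiller_op_def mehler_def g0_def)
qed

lemma cc_gauss_integrable: "f \<in> L2 \<Longrightarrow> gauss_integrable (\<lambda>x. cc x * f x)"
  using gauss_integrable_mult[OF gauss_integrable_square_integrable, of f cc 1 "cmod b"] norm_cc_le by simp

lemma ruelle_integrand_integrable:
  assumes "f \<in> L2"
  shows "integrable lborel (ruelle_integrand \<beta> f z)"
proof -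
  have "integrable lborel (\<lambda>x. (\<lambda>y. cc y * f y * bargmann_kernel y (b * z)) (0 + 2 * sqrt pi * x))"
    by (intro lborel_integrable_real_affine bargmann_integrable cc_gauss_integrable assms) simp
  then show ?thesis unfolding ruelle_integrand_eq[abs_def] .
qed

lemma A_holomorphic:
  assumes "f \<in> L2"
  shows "A f holomorphic_on UNIV"
proof -
  have "(\<lambda>z. b * z) holomorphic_on UNIV" by (intro holomorphic_intros)
  from holomorphic_on_compose[OF this holomorphic_on_subset[OF bargmann_holomorphic[OF cc_gauss_integrable[OF assms]]]]
  have "(\<lambda>z. bargmann (\<lambda>x. cc x * f x) (b * z)) holomorphic_on UNIV" by (simp add: o_def)
  then show ?thesis unfolding A_eq[abs_def] by (intro holomorphic_intros)
qed

lemma A_linear: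
  assumes "f \<in> L2" "g \<in> L2"
  shows "A (\<lambda>x. p * f x + q * g x) z = p * A f z + q * A g z"
proof -
  have e: "(\<lambda>x. cc x * (p * f x + q * g x)) = (\<lambda>x. p * (cc x * f x) + q * (cc x * g x))"
    by (simp add: fun_eq_iff algebra_simps)
  show ?thesis
    unfolding A_eq e bargmann_linear[OF cc_gauss_integrable[OF assms(1)] cc_gauss_integrable[OF assms(2)]]
    by (simp add: algebra_simps)
qed

lemma A_scale: "A (\<lambda>x. c * f x) z = c * A f z"
proof -
  have e: "(\<lambda>x. cc x * (c * f x)) = (\<lambda>x. c * (cc x * f x))"
    by (simp add: fun_eq_iff)
  show ?thesis unfolding A_eq e bargmann_scale by simp
qed

lemma A_cong_AE:
  assumes [measurable]: "f \<in> borel_measurable borel" "g \<in> borel_measurable borel"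
    and "AE x in lborel. f x = g x"
  shows "A f z = A g z"
  unfolding A_eq by (intro arg_cong[where f = "\<lambda>u. of_real a0 * u"] bargmann_cong_AE)
    (use assms(3) in auto)

lemma A_injective:
  assumes f: "f \<in> L2" and 0: "\<And>z. A f z = 0"
  shows "AE x in lborel. f x = 0"
proof -
  have "bargmann (\<lambda>x. cc x * f x) w = 0" for w
    using 0[of "w / b"] a0_pos b_nz by (simp add: A_eq)
  then have "AE x in lborel. cc x * f x = 0"
    by (intro bargmann_injective cc_gauss_integrable f)
  with cc_nz_AE show ?thesis by eventually_elim simp
qed

text \<open>A shift of \<open>z\<close> by 1 or -1 followed by the dilation by \<open>lam\<close>
  gives the two inner maps of the Ruelle operator. It is stated for general \<open>u\<close> because
  both \<open>A_G\<close> and \<open>A_Y\<close> end in this computation.\<close>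

lemma bargmann_cosh_ruelle:
  assumes u: "gauss_integrable u" and F: "\<And>w. bargmann u (b * w) = k * F (of_real lam * w)"
  shows "bargmann (\<lambda>x. cosh (b * of_real x) * u x) (b * z) = of_real (exp (\<beta> / 2) / 2) * k * \<L> F z"
proof -
  have e: "of_real lam * (z + 1) = of_real lam + of_real lam * z" "of_real lam * (z - 1) = - of_real lam + of_real lam * z"
    by (simp_all add: algebra_simps)
  have "exp (complex_of_real \<beta> / 2) = of_real (exp (\<beta> / 2))"
    by (simp add: exp_of_real[symmetric])
  then show ?thesis
    unfolding bargmann_cosh[OF u] F e b_sq ruelle_op_def by (simp add: algebra_simps)
qed

text \<open>The cancellation for which the normalisation of \<open>\<G>\<close> is made: it absorbs
  the constant of \<open>bargmann_mehler\<close> and the factor \<open>exp (\<beta> / 2) / 2\<close>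
  of \<open>bargmann_cosh\<close>.\<close>

lemma const_eq: "g0 * sqrt (4 * pi * exp (- \<gamma>) * sinh \<gamma>) * (exp (\<beta> / 2) / 2) = 1"
proof -
  have "(exp (- \<gamma>) * exp \<beta>) powr (- 1/2) = exp ((- \<gamma> + \<beta>) * (- 1/2))"
    unfolding exp_add[symmetric] by (rule exp_powr_real)
  also have "(- \<gamma> + \<beta>) * (- 1/2) = \<gamma> / 2 - \<beta> / 2" by (simp add: field_simps)
  finally have "(exp (- \<gamma>) * exp \<beta>) powr (- 1/2) = exp (\<gamma> / 2 - \<beta> / 2)" .
  moreover have "sqrt (4 * pi * exp (- \<gamma>) * sinh \<gamma>) = 2 * exp (- \<gamma> / 2) * sqrt (pi * sinh \<gamma>)"
  proof (rule real_sqrt_unique)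
    show "(2 * exp (- \<gamma> / 2) * sqrt (pi * sinh \<gamma>))\<^sup>2 = 4 * pi * exp (- \<gamma>) * sinh \<gamma>"
      using \<gamma> by (simp add: power_mult_distrib exp_double[symmetric])
  qed (use \<gamma> in simp)
  moreover have "0 < sqrt (pi * sinh \<gamma>)" using \<gamma> by simp
  moreover have "exp (\<gamma> / 2 - \<beta> / 2) * exp (- \<gamma> / 2) * exp (\<beta> / 2) = 1"
    by (simp add: exp_add[symmetric])
  ultimately show ?thesis using \<gamma> unfolding g0_def by (simp add: field_simps)
qed

text \<open>The \<open>cc\<close> of \<open>A\<close> and the outer \<open>cc\<close> of
  \<open>\<G>\<close> multiply to \<open>cosh\<close>, which becomes the shifts. The inner
  \<open>cc\<close> stays with \<open>f\<close> and forms \<open>A f\<close>, which the Mehler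
  operator dilates. Both effects together are \<open>\<L>\<close>.\<close>

lemma A_G:
  assumes f: "f \<in> L2"
  shows "A (\<G> f) z = \<L> (A f) z"
proof -
  let ?u = "mehler \<gamma> (\<lambda>y. cc y * f y)"
  define m0 where "m0 = sqrt (4 * pi * exp (- \<gamma>) * sinh \<gamma>)"
  note g = cc_gauss_integrable[OF f]
  have "bargmann ?u (b * w) = of_real (m0 / a0) * A f (of_real lam * w)" for w
    unfolding bargmann_mehler[OF \<gamma> g] A_eq lam_def[symmetric] m0_def using a0_pos by (simp add: mult.left_commute)
  from bargmann_cosh_ruelle[OF mehler_gauss_integrable[OF \<gamma> g] this]
  have c: "bargmann (\<lambda>x. cosh (b * of_real x) * ?u x) (b * z) = of_real (exp (\<beta> / 2) / 2) * of_real (m0 / a0) * \<L> (A f) z" .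
  have e: "(\<lambda>x. cc x * \<G> f x) = (\<lambda>x. of_real g0 * (cosh (b * of_real x) * ?u x))"
    unfolding G_eq cc_mult[symmetric] by (simp add: fun_eq_iff)
  have "A (\<G> f) z = of_real (a0 * g0 * (exp (\<beta> / 2) / 2) * (m0 / a0)) * \<L> (A f) z"
    unfolding A_eq[of "\<G> f"] e bargmann_scale c by simp
  also have "a0 * g0 * (exp (\<beta> / 2) / 2) * (m0 / a0) = 1"
  proof -
    have "a0 * g0 * (exp (\<beta> / 2) / 2) * (m0 / a0) = g0 * m0 * (exp (\<beta> / 2) / 2)"
      using a0_pos by simp
    then show ?thesis using const_eq by (simp only: m0_def)
  qed
  finally show ?thesis by simp
qed

text \<open>
  Functions in \<open>H\<close> and in the range of \<open>A\<close> grow at most like \<open>exp (\<alpha> * (cmod z)\<^sup>2)\<close>. The dilation by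
  \<open>lam\<close> in \<open>\<L>\<close> improves the exponent to \<open>\<alpha>'\<close>, as \<open>lam\<^sup>2 * \<alpha> < \<alpha>' < \<bar>\<beta>\<bar> / 2 < \<alpha>\<close>.
\<close>

definition \<alpha> :: real where "\<alpha> = \<bar>\<beta>\<bar> / (2 * lam)"
definition \<alpha>' :: real where "\<alpha>' = \<bar>\<beta>\<bar> * (lam + 1) / 4"

lemma \<alpha>_greater: "\<bar>\<beta>\<bar> / 2 < \<alpha>"
  using lam lam_less \<beta> by (simp add: \<alpha>_def field_simps)

lemma \<alpha>'_less: "\<alpha>' < \<bar>\<beta>\<bar> / 2"
  using lam lam_less \<beta> by (simp add: \<alpha>'_def field_simps)

lemma \<alpha>'_greater: "\<bar>\<beta>\<bar> * lam / 2 < \<alpha>'"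
  using lam lam_less \<beta> by (simp add: \<alpha>'_def field_simps)

lemma tpos: "0 < \<bar>\<beta>\<bar> / pi" using \<beta> by simp

section \<open>Growth on the range of \<open>A\<close> and on the Fock space, and the gain under
  \<open>\<L>\<close>\<close>

lemma A_bound:
  obtains C where "0 \<le> C" "\<And>f z. f \<in> L2 \<Longrightarrow> cmod (A f z) \<le> C * l2_norm lborel f * exp (\<alpha> * (cmod z)\<^sup>2)"
proof -
  define k where "k = cmod b"
  define D where "D = sqrt (2 * sqrt (2 * pi))"
  \<comment> \<open>Up to the factor \<open>a0\<close>, \<open>A f z\<close> pairs \<open>f\<close>
    with \<open>h (b * z)\<close>, so by Cauchy-Schwarz its growth is that of the norm of
    \<open>h\<close>. Bounding the square of \<open>cc\<close> by a sum of two exponentials keeps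
    this norm an explicit Gaussian integral.\<close>
  define h where "h w x = cc x * bargmann_kernel x w" for w x
  have h: "h w \<in> L2" "l2_norm lborel (h w) \<le> D * exp ((cmod w)\<^sup>2 / 2 + k * cmod w + k\<^sup>2 / 4)" for w
  proof -
    have [measurable]: "h w \<in> borel_measurable borel" unfolding h_def[abs_def] by measurable
    let ?g = "\<lambda>p x. exp (p * x - 1 / 2 * x\<^sup>2) :: real"
    let ?B = "\<lambda>x. exp (- Re (w\<^sup>2)) * (?g (2 * Re w + k) x + ?g (2 * Re w - k) x)"
    have gi: "integrable lborel (?g p)" "(\<integral>x. ?g p x \<partial>lborel) = sqrt (2 * pi) * exp (p\<^sup>2 / 2)" for p
      using real_gaussian[of "1/2" p] by (auto simp: has_bochner_integral_iff)
    have le: "(cmod (h w x))\<^sup>2 \<le> ?B x" for x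
    proof -
      have "(cmod (cc x))\<^sup>2 \<le> exp (k * \<bar>x\<bar>)"
        using norm_cosh_le[of x] by (metis cc_mult k_def norm_mult power2_eq_square)
      also have "\<dots> \<le> exp (k * x) + exp (- k * x)"
        by (cases "0 \<le> x") auto
      finally have "(cmod (cc x))\<^sup>2 * (cmod (bargmann_kernel x w))\<^sup>2 \<le> (exp (k * x) + exp (- k * x)) * (cmod (bargmann_kernel x w))\<^sup>2"
        by (rule mult_right_mono) simp
      moreover have kern: "(cmod (bargmann_kernel x w))\<^sup>2 = exp (- Re (w\<^sup>2)) * exp (2 * (Re w * x - 1 / 4 * x\<^sup>2))"
        unfolding norm_bargmann_kernel power_mult_distrib exp_double[symmetric] by simp
      moreover have "(exp (k * x) + exp (- k * x)) * (exp (- Re (w\<^sup>2)) * exp (2 * (Re w * x - 1 / 4 * x\<^sup>2))) = ?B x"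
      proof -
        have e: "exp (k * x) * exp (2 * (Re w * x - 1 / 4 * x\<^sup>2)) = ?g (2 * Re w + k) x"
          "exp (- k * x) * exp (2 * (Re w * x - 1 / 4 * x\<^sup>2)) = ?g (2 * Re w - k) x"
          unfolding exp_add[symmetric] by (rule arg_cong[where f = exp], simp add: field_simps)+
        have d: "(u + v) * (r * s) = r * (u * s + v * s)" for u v r s :: real
          by (simp add: algebra_simps)
        show ?thesis by (rule trans[OF d]) (simp only: e)
      qed
      ultimately have "(cmod (cc x))\<^sup>2 * (cmod (bargmann_kernel x w))\<^sup>2 \<le> ?B x" by (simp only:)
      then show ?thesis by (simp only: h_def norm_mult power_mult_distrib)
    qed
    have iB: "integrable lborel ?B" by (intro Bochner_Integration.integrable_mult_right Bochner_Integration.integrable_add gi)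
    have ih: "integrable lborel (\<lambda>x. (cmod (h w x))\<^sup>2)"
      by (rule Bochner_Integration.integrable_bound[OF iB]) (auto intro!: AE_I2 order_trans[OF le])
    then show "h w \<in> L2" by (simp add: square_integrable_def)
    have sq: "(2 * Re w + k)\<^sup>2 \<le> (2 * \<bar>Re w\<bar> + k)\<^sup>2" "(2 * Re w - k)\<^sup>2 \<le> (2 * \<bar>Re w\<bar> + k)\<^sup>2"
    proof -
      have k0: "0 \<le> k" by (simp add: k_def)
      show "(2 * Re w + k)\<^sup>2 \<le> (2 * \<bar>Re w\<bar> + k)\<^sup>2" "(2 * Re w - k)\<^sup>2 \<le> (2 * \<bar>Re w\<bar> + k)\<^sup>2"
        unfolding abs_le_square_iff[symmetric] using k0 by linarith+
    qed
    have "(l2_norm lborel (h w))\<^sup>2 \<le> (\<integral>x. ?B x \<partial>lborel)"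
      unfolding l2_norm_sq by (rule integral_mono[OF ih iB le])
    also have "\<dots> = exp (- Re (w\<^sup>2)) * (sqrt (2 * pi) * exp ((2 * Re w + k)\<^sup>2 / 2) + sqrt (2 * pi) * exp ((2 * Re w - k)\<^sup>2 / 2))"
      by (simp only: integral_mult_right_zero Bochner_Integration.integral_add[OF gi(1) gi(1)] gi(2))
    also have "\<dots> \<le> exp (- Re (w\<^sup>2)) * (sqrt (2 * pi) * exp ((2 * \<bar>Re w\<bar> + k)\<^sup>2 / 2) + sqrt (2 * pi) * exp ((2 * \<bar>Re w\<bar> + k)\<^sup>2 / 2))"
      using sq by (intro mult_left_mono add_mono) auto
    also have "\<dots> = 2 * sqrt (2 * pi) * exp (- Re (w\<^sup>2) + (2 * \<bar>Re w\<bar> + k)\<^sup>2 / 2)"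
      unfolding exp_add by simp
    also have "\<dots> \<le> 2 * sqrt (2 * pi) * exp (2 * ((cmod w)\<^sup>2 / 2 + k * cmod w + k\<^sup>2 / 4))"
    proof -
      have "k * \<bar>Re w\<bar> \<le> k * cmod w" by (intro mult_left_mono abs_Re_le_cmod) (simp add: k_def)
      \<comment> \<open>- Re (w^2) + 2 (Re w)^2 is exactly (cmod w)^2: the quadratic part has the
        critical Fock rate, and only the linear term exceeds it.\<close>
      moreover have "- Re (w\<^sup>2) + (2 * \<bar>Re w\<bar> + k)\<^sup>2 / 2 = (cmod w)\<^sup>2 + 2 * (k * \<bar>Re w\<bar>) + k\<^sup>2 / 2"
        unfolding cmod_power2 by (simp add: power2_eq_square algebra_simps add_divide_distrib)
      ultimately show ?thesis by simp
    qed
    also have "\<dots> = (D * exp ((cmod w)\<^sup>2 / 2 + k * cmod w + k\<^sup>2 / 4))\<^sup>2"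
      unfolding power_mult_distrib D_def exp_double by simp
    finally show "l2_norm lborel (h w) \<le> D * exp ((cmod w)\<^sup>2 / 2 + k * cmod w + k\<^sup>2 / 4)"
      by (rule power2_le_imp_le) (simp add: D_def)
  qed
  \<comment> \<open>The gap between \<alpha> and the critical rate, spent on the linear
    term.\<close>
  define \<epsilon> where "\<epsilon> = \<alpha> - \<bar>\<beta>\<bar> / 2"
  have \<epsilon>: "0 < \<epsilon>" using \<alpha>_greater by (simp add: \<epsilon>_def)
  define C where "C = a0 * D * exp (k\<^sup>2 / 4 + \<bar>\<beta>\<bar>\<^sup>2 / (4 * \<epsilon>))"
  show ?thesis
  proof (rule that[of C])
    show "0 \<le> C" using a0_pos by (simp add: C_def D_def)
    fix f z assume f: "f \<in> L2"
    have "bargmann (\<lambda>x. cc x * f x) (b * z) = (\<integral>x. f x * h (b * z) x \<partial>lborel)"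
      by (simp add: bargmann_def h_def mult_ac)
    then have "cmod (bargmann (\<lambda>x. cc x * f x) (b * z)) \<le> (\<integral>x. cmod (f x * h (b * z) x) \<partial>lborel)"
      by (simp only: integral_norm_bound)
    also have "\<dots> \<le> l2_norm lborel f * l2_norm lborel (h (b * z))"
      by (rule cauchy_schwarz_integral(2)[OF f h(1)])
    also have "\<dots> \<le> l2_norm lborel f * (D * exp ((cmod (b * z))\<^sup>2 / 2 + k * cmod (b * z) + k\<^sup>2 / 4))"
      by (intro mult_left_mono h(2)) simp
    also have "\<dots> \<le> l2_norm lborel f * (D * exp (\<alpha> * (cmod z)\<^sup>2 + (k\<^sup>2 / 4 + \<bar>\<beta>\<bar>\<^sup>2 / (4 * \<epsilon>))))"
    proof -
      have 1: "(cmod (b * z))\<^sup>2 / 2 = \<bar>\<beta>\<bar> / 2 * (cmod z)\<^sup>2" by (simp add: norm_mult power_mult_distrib norm_b_sq)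
      have 2: "k * cmod (b * z) = \<bar>\<beta>\<bar> * cmod z" using norm_b_sq by (simp add: norm_mult k_def power2_eq_square flip: mult.assoc)
      have "\<bar>\<beta>\<bar> * cmod z \<le> \<epsilon> * (cmod z)\<^sup>2 + \<bar>\<beta>\<bar>\<^sup>2 / (4 * \<epsilon>)" by (rule quadratic_absorb[OF \<epsilon>])
      then have "(cmod (b * z))\<^sup>2 / 2 + k * cmod (b * z) + k\<^sup>2 / 4 \<le> \<alpha> * (cmod z)\<^sup>2 + (k\<^sup>2 / 4 + \<bar>\<beta>\<bar>\<^sup>2 / (4 * \<epsilon>))"
        unfolding 1 2 by (simp add: \<epsilon>_def algebra_simps)
      then show ?thesis by (intro mult_left_mono) (auto simp: D_def)
    qed
    finally have "a0 * cmod (bargmann (\<lambda>x. cc x * f x) (b * z)) \<le> a0 * (l2_norm lborel f * (D * exp (\<alpha> * (cmod z)\<^sup>2 + (k\<^sup>2 / 4 + \<bar>\<beta>\<bar>\<^sup>2 / (4 * \<epsilon>)))))"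
      using a0_pos by (intro mult_left_mono) auto
    also have "\<dots> = C * l2_norm lborel f * exp (\<alpha> * (cmod z)\<^sup>2)"
      unfolding C_def exp_add by (simp only: mult_ac)
    finally show "cmod (A f z) \<le> C * l2_norm lborel f * exp (\<alpha> * (cmod z)\<^sup>2)"
      using a0_pos by (simp add: A_eq norm_mult)
  qed
qed

text \<open>The same rate \<alpha> as in \<open>A_bound\<close>, so that \<open>L_into_H\<close>
  applies to \<open>A f\<close> and to elements of \<open>H\<close> alike.\<close>

lemma H_bound:
  obtains C where "0 \<le> C" "\<And>F z. F \<in> H \<Longrightarrow> cmod (F z) \<le> C * l2_norm \<mu> F * exp (\<alpha> * (cmod z)\<^sup>2)"
proof -
  obtain C where C: "0 \<le> C"
    "\<And>F z. F \<in> H \<Longrightarrow> cmod (F z) \<le> C * l2_norm \<mu> F * exp (pi * (\<bar>\<beta>\<bar> / pi) / 2 * (cmod z + 1)\<^sup>2)"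
    using HL2_point_evaluation[OF tpos] by blast
  define \<epsilon> where "\<epsilon> = \<alpha> - \<bar>\<beta>\<bar> / 2"
  have \<epsilon>: "0 < \<epsilon>" using \<alpha>_greater by (simp add: \<epsilon>_def)
  define E where "E = \<bar>\<beta>\<bar> / 2 + \<bar>\<beta>\<bar>\<^sup>2 / (4 * \<epsilon>)"
  have e: "pi * (\<bar>\<beta>\<bar> / pi) / 2 * (r + 1)\<^sup>2 \<le> \<alpha> * r\<^sup>2 + E" for r
  proof -
    have "\<bar>\<beta>\<bar> * r \<le> \<epsilon> * r\<^sup>2 + \<bar>\<beta>\<bar>\<^sup>2 / (4 * \<epsilon>)" by (rule quadratic_absorb[OF \<epsilon>])
    then show ?thesis by (simp add: E_def \<epsilon>_def power2_sum algebra_simps add_divide_distrib)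
  qed
  show ?thesis
  proof (rule that[of "C * exp E"])
    fix F z assume F: "F \<in> H"
    have "cmod (F z) \<le> C * l2_norm \<mu> F * exp (pi * (\<bar>\<beta>\<bar> / pi) / 2 * (cmod z + 1)\<^sup>2)" by (rule C(2)[OF F])
    also have "\<dots> \<le> C * l2_norm \<mu> F * exp (\<alpha> * (cmod z)\<^sup>2 + E)"
      using C(1) e by (intro mult_left_mono) auto
    finally show "cmod (F z) \<le> C * exp E * l2_norm \<mu> F * exp (\<alpha> * (cmod z)\<^sup>2)"
      unfolding exp_add by (simp only: mult_ac)
  qed (use C in simp)
qed

lemma L_holomorphic:
  assumes F: "F holomorphic_on UNIV"
  shows "\<L> F holomorphic_on UNIV"
proof -
  have "(\<lambda>z. F (c + of_real lam * z)) holomorphic_on UNIV" for c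
  proof -
    have "(\<lambda>z. c + of_real lam * z) holomorphic_on UNIV" by (intro holomorphic_intros)
    from holomorphic_on_compose[OF this holomorphic_on_subset[OF F]] show ?thesis by (simp add: o_def)
  qed
  then show ?thesis unfolding ruelle_op_def by (intro holomorphic_intros)
qed

lemma L_bound:
  obtains D where "0 \<le> D" "\<And>F K z. \<forall>z. cmod (F z) \<le> K * exp (\<alpha> * (cmod z)\<^sup>2) \<Longrightarrow>
    cmod (\<L> F z) \<le> D * K * exp (\<alpha>' * (cmod z)\<^sup>2)"
proof -
  \<comment> \<open>\<open>\<alpha> * lam\<^sup>2\<close> equals \<bar>\<beta>\<bar> * lam / 2. The
    distance to \<alpha>' pays for the linear terms collected in \<open>k\<close>:
    \<bar>\<beta>\<bar> from the exponential weights, \<bar>\<beta>\<bar> * lam from the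
    shift.\<close>
  define \<epsilon> where "\<epsilon> = \<alpha>' - \<bar>\<beta>\<bar> * lam / 2"
  have \<epsilon>: "0 < \<epsilon>" using \<alpha>'_greater by (simp add: \<epsilon>_def)
  define k where "k = \<bar>\<beta>\<bar> * lam + \<bar>\<beta>\<bar>"
  define E where "E = \<bar>\<beta>\<bar> * lam / 2 + k\<^sup>2 / (4 * \<epsilon>)"
  have e: "\<bar>\<beta>\<bar> * r + \<alpha> * (lam * (r + 1))\<^sup>2 \<le> \<alpha>' * r\<^sup>2 + E" for r
  proof -
    have "\<alpha> * (lam * (r + 1))\<^sup>2 = \<bar>\<beta>\<bar> * lam / 2 * (r + 1)\<^sup>2"
      using lam by (simp add: \<alpha>_def power_mult_distrib power2_eq_square)
    moreover have "k * r \<le> \<epsilon> * r\<^sup>2 + k\<^sup>2 / (4 * \<epsilon>)" by (rule quadratic_absorb[OF \<epsilon>])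
    ultimately show ?thesis by (simp add: E_def k_def \<epsilon>_def power2_sum algebra_simps add_divide_distrib)
  qed
  show ?thesis
  proof (rule that[of "2 * exp E"])
    fix F :: "complex \<Rightarrow> complex" and K z
    assume "\<forall>z. cmod (F z) \<le> K * exp (\<alpha> * (cmod z)\<^sup>2)"
    then have bd: "cmod (F z) \<le> K * exp (\<alpha> * (cmod z)\<^sup>2)" for z by blast
    have K: "0 \<le> K" using order_trans[OF norm_ge_zero bd[of 0]] by simp
    have term_le: "cmod (exp p * F (c + of_real lam * z)) \<le> K * exp (\<alpha>' * (cmod z)\<^sup>2 + E)"
      if p: "cmod p = \<bar>\<beta>\<bar> * cmod z" and c: "cmod c = lam" for p c
    proof -
      have "cmod (c + of_real lam * z) \<le> lam * (cmod z + 1)"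
        using norm_triangle_ineq[of c "of_real lam * z"] lam by (simp add: norm_mult c algebra_simps)
      then have "(cmod (c + of_real lam * z))\<^sup>2 \<le> (lam * (cmod z + 1))\<^sup>2" by (intro power_mono) auto
      then have "\<alpha> * (cmod (c + of_real lam * z))\<^sup>2 \<le> \<alpha> * (lam * (cmod z + 1))\<^sup>2"
        using \<alpha>_greater by (intro mult_left_mono) auto
      then have "cmod (F (c + of_real lam * z)) \<le> K * exp (\<alpha> * (lam * (cmod z + 1))\<^sup>2)"
        using K by (intro order_trans[OF bd] mult_left_mono) auto
      moreover have "cmod (exp p) \<le> exp (\<bar>\<beta>\<bar> * cmod z)" using norm_exp[of p] by (simp add: p)
      ultimately have "cmod (exp p * F (c + of_real lam * z)) \<le> exp (\<bar>\<beta>\<bar> * cmod z) * (K * exp (\<alpha> * (lam * (cmod z + 1))\<^sup>2))"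
        unfolding norm_mult by (intro mult_mono) auto
      also have "\<dots> = K * exp (\<bar>\<beta>\<bar> * cmod z + \<alpha> * (lam * (cmod z + 1))\<^sup>2)" by (simp add: exp_add)
      also have "\<dots> \<le> K * exp (\<alpha>' * (cmod z)\<^sup>2 + E)" using K e by (intro mult_left_mono) auto
      finally show ?thesis .
    qed
    have "cmod (\<L> F z) \<le> K * exp (\<alpha>' * (cmod z)\<^sup>2 + E) + K * exp (\<alpha>' * (cmod z)\<^sup>2 + E)"
      unfolding ruelle_op_def
      by (intro order_trans[OF norm_triangle_ineq] add_mono term_le) (use lam in \<open>auto simp: norm_mult\<close>)
    also have "\<dots> = 2 * exp E * K * exp (\<alpha>' * (cmod z)\<^sup>2)" by (simp add: exp_add)
    finally show "cmod (\<L> F z) \<le> 2 * exp E * K * exp (\<alpha>' * (cmod z)\<^sup>2)" .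
  qed simp
qed

text \<open>Growth at rate \<alpha> is asked of \<open>F\<close>, not membership in
  \<open>H\<close>. This admits \<open>A f\<close>, which may lie outside \<open>H\<close>, and
  explains why \<open>X\<close> puts \<open>\<L>\<close> after \<open>A\<close>.\<close>

lemma L_into_H:
  obtains D where "0 \<le> D" "\<And>F K. F holomorphic_on UNIV \<Longrightarrow> \<forall>z. cmod (F z) \<le> K * exp (\<alpha> * (cmod z)\<^sup>2) \<Longrightarrow>
    \<L> F \<in> H \<and> l2_norm \<mu> (\<L> F) \<le> D * K"
proof -
  obtain D where D: "0 \<le> D" "\<And>F K z. \<forall>z. cmod (F z) \<le> K * exp (\<alpha> * (cmod z)\<^sup>2) \<Longrightarrow>
    cmod (\<L> F z) \<le> D * K * exp (\<alpha>' * (cmod z)\<^sup>2)"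
    using L_bound by blast
  let ?s = "sqrt (\<bar>\<beta>\<bar> / pi * pi / (pi * (\<bar>\<beta>\<bar> / pi) - 2 * \<alpha>'))"
  have l: "2 * \<alpha>' < pi * (\<bar>\<beta>\<bar> / pi)" using \<alpha>'_less by simp
  show ?thesis
  proof (rule that[of "?s * D"])
    show "0 \<le> ?s * D" using D(1) \<alpha>'_less by simp
    fix F :: "complex \<Rightarrow> complex" and K assume F: "F holomorphic_on UNIV" and bd: "\<forall>z. cmod (F z) \<le> K * exp (\<alpha> * (cmod z)\<^sup>2)"
    show "\<L> F \<in> H \<and> l2_norm \<mu> (\<L> F) \<le> ?s * D * K"
      using HL2_of_bound[OF tpos L_holomorphic[OF F] D(2)[OF bd] l] by (simp add: mult.assoc)
  qed
qed

lemma A_eqI: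
  assumes f: "f \<in> L2" and g: "g \<in> L2" and eq: "\<And>z. A f z = A g z"
  shows "AE x in lborel. f x = g x"
proof -
  have "AE x in lborel. 1 * f x + (-1) * g x = 0"
    by (intro A_injective square_integrable_lincomb(1) f g) (simp only: A_linear[OF f g] eq, simp)
  then show ?thesis by eventually_elim simp
qed

section \<open>Boundedness of the two operators\<close>

lemma G_measurable:
  assumes "f \<in> L2"
  shows "\<G> f \<in> borel_measurable borel"
proof -
  note [measurable] = gauss_integrable_measurable[OF cc_gauss_integrable[OF assms]]
  show ?thesis unfolding G_eq[abs_def] by measurable
qed

text \<open>The separated majorant of the Mehler kernel dominates \<open>\<G> f\<close> pointwise by
  a fixed function of Gaussian decay times the integral of \<open>cmod (f y * h y)\<close>, and
  Cauchy-Schwarz bounds that integral.\<close>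

lemma G_bounded:
  obtains C where "\<And>f. f \<in> L2 \<Longrightarrow> \<G> f \<in> L2 \<and> l2_norm lborel (\<G> f) \<le> C * l2_norm lborel f"
proof -
  define \<tau> where "\<tau> = tanh (\<gamma> / 2) / 4"
  have \<tau>: "0 < \<tau>" using \<gamma> by (simp add: \<tau>_def)
  define h where "h y = complex_of_real (cmod (cc y) * exp (- \<tau> * y\<^sup>2))" for y
  have [measurable]: "h \<in> borel_measurable borel" unfolding h_def[abs_def] by measurable
  have h: "h \<in> L2"
  proof (rule square_integrable_of_gaussian_bound(1)[OF _ \<tau>])
    fix x
    have "cmod (cc x) * exp (- \<tau> * x\<^sup>2) \<le> exp (cmod b * \<bar>x\<bar>) * exp (- \<tau> * x\<^sup>2)"
      by (intro mult_right_mono norm_cc_le) simp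
    also have "\<dots> = 1 * exp (cmod b * \<bar>x\<bar> - \<tau> * x\<^sup>2)" unfolding exp_add[symmetric] by simp
    finally show "cmod (h x) \<le> 1 * exp (cmod b * \<bar>x\<bar> - \<tau> * x\<^sup>2)"
      by (simp only: h_def norm_of_real) simp
  qed measurable
  define D where "D = sqrt (exp (2 * (cmod b)\<^sup>2 / \<tau>) * sqrt (pi / \<tau>))"
  show ?thesis
  proof (rule that[of "D * (g0 * l2_norm lborel h)"])
    fix f :: "real \<Rightarrow> complex" assume f: "f \<in> L2"
    let ?N = "l2_norm lborel f * l2_norm lborel h"
    have [measurable]: "\<G> f \<in> borel_measurable borel" by (rule G_measurable[OF f])
    have "(\<integral>y. cmod (cc y * f y) * exp (- \<tau> * y\<^sup>2) \<partial>lborel) = (\<integral>y. cmod (f y * h y) \<partial>lborel)"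
      by (simp add: h_def norm_mult mult_ac)
    also have "\<dots> \<le> ?N" by (rule cauchy_schwarz_integral(2)[OF f h])
    finally have I: "(\<integral>y. cmod (cc y * f y) * exp (- \<tau> * y\<^sup>2) \<partial>lborel) \<le> ?N" .
    have bd: "cmod (\<G> f x) \<le> (g0 * ?N) * exp (cmod b * \<bar>x\<bar> - \<tau> * x\<^sup>2)" for x
    proof -
      have "cmod (mehler \<gamma> (\<lambda>y. cc y * f y) x) \<le> exp (- \<tau> * x\<^sup>2) * ?N"
        by (rule order_trans[OF norm_mehler_le[OF \<gamma> cc_gauss_integrable[OF f], of x, folded \<tau>_def] mult_left_mono[OF I]]) simp
      then have "cmod (cc x * mehler \<gamma> (\<lambda>y. cc y * f y) x) \<le> exp (cmod b * \<bar>x\<bar>) * (exp (- \<tau> * x\<^sup>2) * ?N)"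
        unfolding norm_mult by (intro mult_mono norm_cc_le) auto
      then have "cmod (\<G> f x) \<le> g0 * (exp (cmod b * \<bar>x\<bar>) * (exp (- \<tau> * x\<^sup>2) * ?N))"
        using g0_pos by (simp add: G_eq norm_mult)
      also have "\<dots> = (g0 * ?N) * (exp (cmod b * \<bar>x\<bar>) * exp (- \<tau> * x\<^sup>2))" by (simp only: mult_ac)
      finally show ?thesis unfolding exp_add[symmetric] by simp
    qed
    note r = square_integrable_of_gaussian_bound[OF _ \<tau> bd]
    show "\<G> f \<in> L2 \<and> l2_norm lborel (\<G> f) \<le> D * (g0 * l2_norm lborel h) * l2_norm lborel f"
      using r by (simp add: D_def mult_ac)
  qed
qed

lemma G_linear:
  assumes f: "f \<in> L2" and g: "g \<in> L2"
  shows "\<G> (\<lambda>x. p * f x + q * g x) x = p * \<G> f x + q * \<G> g x"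
proof -
  have e: "(\<lambda>y. cc y * (p * f y + q * g y)) = (\<lambda>y. p * (cc y * f y) + q * (cc y * g y))"
    by (simp add: fun_eq_iff algebra_simps)
  have m: "mehler \<gamma> (\<lambda>y. p * (cc y * f y) + q * (cc y * g y)) x
      = p * mehler \<gamma> (\<lambda>y. cc y * f y) x + q * mehler \<gamma> (\<lambda>y. cc y * g y) x"
  proof -
    have i: "integrable lborel (\<lambda>y. r * (of_real (mehler_kernel \<gamma> x y) * (cc y * u y)))" if "u \<in> L2" for r u
      by (rule Bochner_Integration.integrable_mult_right) (rule mehler_integrable[OF \<gamma> cc_gauss_integrable[OF that]])
    have "of_real (mehler_kernel \<gamma> x y) * (p * (cc y * f y) + q * (cc y * g y))
      = p * (of_real (mehler_kernel \<gamma> x y) * (cc y * f y)) + q * (of_real (mehler_kernel \<gamma> x y) * (cc y * g y))" for y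
      by (simp add: algebra_simps)
    then show ?thesis
      unfolding mehler_def by (simp only: Bochner_Integration.integral_add[OF i[OF f] i[OF g]] integral_mult_right_zero)
  qed
  show ?thesis unfolding G_eq e m by (simp add: algebra_simps)
qed

lemma L_linear: "\<L> (\<lambda>z. p * F z + q * G z) z = p * \<L> F z + q * \<L> G z"
  by (simp add: ruelle_op_def algebra_simps)

lemma H_D: "F \<in> H \<Longrightarrow> F holomorphic_on UNIV"
  by (simp add: HL2_def)

lemma bounded_G: "bounded_map_on lborel L2 lborel L2 \<G>"
proof -
  obtain C where "\<And>f. f \<in> L2 \<Longrightarrow> \<G> f \<in> L2 \<and> l2_norm lborel (\<G> f) \<le> C * l2_norm lborel f"
    using G_bounded by blast
  then show ?thesis
    unfolding bounded_map_on_def by (intro conjI ballI allI exI[of _ C]) (simp_all add: G_linear)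
qed

lemma bounded_L: "bounded_map_on \<mu> H \<mu> H \<L>"
proof -
  obtain C where C: "0 \<le> C" "\<And>F z. F \<in> H \<Longrightarrow> cmod (F z) \<le> C * l2_norm \<mu> F * exp (\<alpha> * (cmod z)\<^sup>2)"
    using H_bound by blast
  obtain D where D: "0 \<le> D" "\<And>F K. F holomorphic_on UNIV \<Longrightarrow> \<forall>z. cmod (F z) \<le> K * exp (\<alpha> * (cmod z)\<^sup>2) \<Longrightarrow>
    \<L> F \<in> H \<and> l2_norm \<mu> (\<L> F) \<le> D * K" using L_into_H by blast
  have "\<L> F \<in> H \<and> l2_norm \<mu> (\<L> F) \<le> (D * C) * l2_norm \<mu> F" if "F \<in> H" for F
    using D(2)[OF H_D[OF that], of "C * l2_norm \<mu> F"] C(2)[OF that] by (simp add: mult.assoc)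
  then show ?thesis
    unfolding bounded_map_on_def by (intro conjI ballI allI exI[of _ "D * C"]) (simp_all add: L_linear)
qed

section \<open>The two bounded intertwiners\<close>

definition X where "X f = \<L> (A f)"

lemma bounded_X: "bounded_map_on lborel L2 \<mu> H X"
proof -
  obtain C where C: "0 \<le> C" "\<And>f z. f \<in> L2 \<Longrightarrow> cmod (A f z) \<le> C * l2_norm lborel f * exp (\<alpha> * (cmod z)\<^sup>2)"
    using A_bound by blast
  obtain D where D: "0 \<le> D" "\<And>F K. F holomorphic_on UNIV \<Longrightarrow> \<forall>z. cmod (F z) \<le> K * exp (\<alpha> * (cmod z)\<^sup>2) \<Longrightarrow>
    \<L> F \<in> H \<and> l2_norm \<mu> (\<L> F) \<le> D * K" using L_into_H by blast
  have "X f \<in> H \<and> l2_norm \<mu> (X f) \<le> (D * C) * l2_norm lborel f" if "f \<in> L2" for f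
    using D(2)[OF A_holomorphic[OF that], of "C * l2_norm lborel f"] C(2)[OF that] by (simp add: X_def mult.assoc)
  moreover have "X (\<lambda>y. p * f y + q * g y) x = p * X f x + q * X g x" if "f \<in> L2" "g \<in> L2" for f g p q x
  proof -
    have "A (\<lambda>y. p * f y + q * g y) = (\<lambda>z. p * A f z + q * A g z)"
      by (rule ext) (rule A_linear[OF that])
    then show ?thesis unfolding X_def by (simp only: L_linear)
  qed
  ultimately show ?thesis
    unfolding bounded_map_on_def by (intro conjI ballI allI exI[of _ "D * C"]) simp_all
qed

text \<open>The factor sqrt pi / b carries the Fock space with parameter \<bar>\<beta>\<bar> / pi to
  the one with t = 1, to which \<open>bargmann_inv\<close> belongs. The extra dilation
  \<open>r\<close> is 1 in the inverse transform and \<open>lam\<close> in \<open>Y\<close>.\<close>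

definition rescale :: "complex \<Rightarrow> (complex \<Rightarrow> complex) \<Rightarrow> complex \<Rightarrow> complex" where
  "rescale r F z = F (r * (of_real (sqrt pi) / b * z))"

lemma rescale_holomorphic:
  assumes F: "F holomorphic_on UNIV"
  shows "rescale r F holomorphic_on UNIV"
proof -
  have "(\<lambda>z. r * (of_real (sqrt pi) / b * z)) holomorphic_on UNIV" by (intro holomorphic_intros)
  from holomorphic_on_compose[OF this holomorphic_on_subset[OF F]] show ?thesis
    by (simp add: o_def rescale_def[abs_def])
qed

lemma rescale_bound:
  assumes "\<And>z. cmod (F z) \<le> K * exp (p * (cmod z)\<^sup>2)"
  shows "cmod (rescale r F z) \<le> K * exp (p * (cmod r)\<^sup>2 * pi / \<bar>\<beta>\<bar> * (cmod z)\<^sup>2)"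
proof -
  have "(cmod (r * (of_real (sqrt pi) / b * z)))\<^sup>2 = (cmod r)\<^sup>2 * pi / \<bar>\<beta>\<bar> * (cmod z)\<^sup>2"
    by (simp add: norm_mult norm_divide power_mult_distrib power_divide norm_b_sq)
  then show ?thesis
    using assms[of "r * (of_real (sqrt pi) / b * z)"] by (simp add: rescale_def mult.assoc)
qed

lemma bargmann_inv_rescale:
  assumes F: "F holomorphic_on UNIV" and bd: "\<And>z. cmod (F z) \<le> K * exp (p * (cmod z)\<^sup>2)"
    and p: "p * (cmod r)\<^sup>2 * pi / \<bar>\<beta>\<bar> < pi / 2"
  shows "gauss_integrable (bargmann_inv (rescale r F))"
    and "bargmann (bargmann_inv (rescale r F)) (b * w) = of_real (sqrt (2 * pi)) * F (r * w)"
    and "integrable lborel (\<lambda>z. rescale r F z * inv_kernel x z)"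
proof -
  note h = rescale_holomorphic[OF F, of r]
  note i = entire_measurable[OF h] rescale_bound[OF bd] p
  show "gauss_integrable (bargmann_inv (rescale r F))" by (rule bargmann_inv_gauss_integrable[OF i])
  show "integrable lborel (\<lambda>z. rescale r F z * inv_kernel x z)" by (rule inv_integrable[OF i])
  have "bargmann (bargmann_inv (rescale r F)) (of_real (sqrt pi) * (b / of_real (sqrt pi) * w))
      = of_real (sqrt (2 * pi)) * rescale r F (b / of_real (sqrt pi) * w)"
    by (rule bargmann_bargmann_inv[OF i h])
  then show "bargmann (bargmann_inv (rescale r F)) (b * w) = of_real (sqrt (2 * pi)) * F (r * w)"
    using b_nz by (simp add: rescale_def)
qed

text \<open>Divides out the three constants met in \<open>bargmann_cc_Y\<close>: the prefactor
  \<open>a0\<close>, the one from \<open>bargmann_cosh\<close> and the one from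
  \<open>bargmann_bargmann_inv\<close>.\<close>

definition y0 :: real where "y0 = 1 / (a0 * (exp (\<beta> / 2) / 2) * sqrt (2 * pi))"

text \<open>Formally \<open>\<G>\<close> after \<open>ruelle_to_gutzwiller \<beta>\<close>: the
  inner \<open>cc\<close> of \<open>\<G>\<close> cancels the division, the Mehler operator becomes
  the dilation by \<open>lam\<close>, and the outer \<open>cc\<close> remains. The dilation makes
  the integral converge absolutely for every \<open>F\<close> in \<open>H\<close>.\<close>

definition Y where "Y F x = of_real y0 * (cc x * bargmann_inv (rescale (of_real lam) F) x)"

lemma y0_pos: "0 < y0" using a0_pos by (simp add: y0_def)

lemma \<alpha>_lam: "\<alpha> * (cmod (of_real lam))\<^sup>2 * pi / \<bar>\<beta>\<bar> = lam * pi / 2"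
  using lam \<beta> by (simp add: \<alpha>_def power2_eq_square)

lemma \<alpha>_lam_less: "\<alpha> * (cmod (of_real lam))\<^sup>2 * pi / \<bar>\<beta>\<bar> < pi / 2"
  unfolding \<alpha>_lam using lam_less by simp

lemma \<alpha>'_less': "\<alpha>' * (cmod 1)\<^sup>2 * pi / \<bar>\<beta>\<bar> < pi / 2"
  using \<alpha>'_less \<beta> by (simp add: field_simps)

lemma H_bound':
  assumes "F \<in> H"
  obtains K where "\<And>z. cmod (F z) \<le> K * exp (\<alpha> * (cmod z)\<^sup>2)"
  using H_bound assms by metis

lemma bargmann_cc_Y:
  assumes F: "F \<in> H"
  shows "of_real a0 * bargmann (\<lambda>x. cc x * Y F x) (b * z) = \<L> F z"
proof -
  obtain K where K: "\<And>z. cmod (F z) \<le> K * exp (\<alpha> * (cmod z)\<^sup>2)" using H_bound'[OF F] by blast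
  note r = bargmann_inv_rescale[OF H_D[OF F] K \<alpha>_lam_less]
  have e: "(\<lambda>x. cc x * Y F x) = (\<lambda>x. of_real y0 * (cosh (b * of_real x) * bargmann_inv (rescale (of_real lam) F) x))"
    unfolding Y_def cc_mult[symmetric] by (simp add: fun_eq_iff)
  have "of_real a0 * bargmann (\<lambda>x. cc x * Y F x) (b * z)
      = of_real (a0 * y0 * (exp (\<beta> / 2) / 2) * sqrt (2 * pi)) * \<L> F z"
    unfolding e bargmann_scale bargmann_cosh_ruelle[OF r(1,2)] by simp
  also have "a0 * y0 * (exp (\<beta> / 2) / 2) * sqrt (2 * pi) = 1"
    using a0_pos by (simp add: y0_def)
  finally show ?thesis by simp
qed

lemma A_Y: "F \<in> H \<Longrightarrow> A (Y F) z = \<L> F z"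
  using bargmann_cc_Y by (simp add: A_eq)

lemma bounded_Y: "bounded_map_on \<mu> H lborel L2 Y"
proof -
  obtain C where C: "0 \<le> C" "\<And>F z. F \<in> H \<Longrightarrow> cmod (F z) \<le> C * l2_norm \<mu> F * exp (\<alpha> * (cmod z)\<^sup>2)"
    using H_bound by blast
  define a where "a = \<alpha> * (cmod (of_real lam))\<^sup>2 * pi / \<bar>\<beta>\<bar>"
  have a: "a < pi / 2" unfolding a_def by (rule \<alpha>_lam_less)
  have \<delta>: "0 < inv_decay a"
    by (rule inv_decay_pos[OF _ _ a, of "\<lambda>z. 0" 0]) auto
  define D where "D = sqrt (exp (2 * (cmod b)\<^sup>2 / inv_decay a) * sqrt (pi / inv_decay a))"
  have i: "rescale (of_real lam) F \<in> borel_measurable borel"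
    "cmod (rescale (of_real lam) F z) \<le> C * l2_norm \<mu> F * exp (a * (cmod z)\<^sup>2)" if "F \<in> H" for F z
    unfolding a_def by (intro entire_measurable rescale_holomorphic H_D that, intro rescale_bound C(2) that)
  have "Y F \<in> L2 \<and> l2_norm lborel (Y F) \<le> (D * (y0 * (C * inv_const a))) * l2_norm \<mu> F" if F: "F \<in> H" for F
  proof -
    note [measurable] = i(1)[OF F]
    have [measurable]: "Y F \<in> borel_measurable borel" unfolding Y_def[abs_def] by measurable
    let ?K = "y0 * (C * l2_norm \<mu> F * inv_const a)"
    have "cmod (Y F x) \<le> ?K * exp (cmod b * \<bar>x\<bar> - inv_decay a * x\<^sup>2)" for x
    proof -
      have "cmod (cc x * bargmann_inv (rescale (of_real lam) F) x)
          \<le> exp (cmod b * \<bar>x\<bar>) * (C * l2_norm \<mu> F * inv_const a * exp (- inv_decay a * x\<^sup>2))"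
        unfolding norm_mult by (intro mult_mono norm_cc_le norm_bargmann_inv[OF i(1)[OF F] i(2)[OF F] a]) auto
      then have "cmod (Y F x) \<le> y0 * (exp (cmod b * \<bar>x\<bar>) * (C * l2_norm \<mu> F * inv_const a * exp (- inv_decay a * x\<^sup>2)))"
        using y0_pos by (simp add: Y_def norm_mult)
      also have "\<dots> = ?K * (exp (cmod b * \<bar>x\<bar>) * exp (- inv_decay a * x\<^sup>2))" by (simp only: mult_ac)
      finally show ?thesis unfolding exp_add[symmetric] by simp
    qed
    from square_integrable_of_gaussian_bound[OF _ \<delta> this]
    show ?thesis by (simp add: D_def mult_ac)
  qed
  moreover have "Y (\<lambda>z. p * F z + q * G z) x = p * Y F x + q * Y G x" if "F \<in> H" "G \<in> H" for F G p q x
  proof -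
    have j: "integrable lborel (\<lambda>z. r * (rescale (of_real lam) U z * inv_kernel x z))" if "U \<in> H" for r U
      by (rule Bochner_Integration.integrable_mult_right) (rule inv_integrable[OF i(1)[OF that] i(2)[OF that] a])
    have "rescale (of_real lam) (\<lambda>z. p * F z + q * G z) z * inv_kernel x z
      = p * (rescale (of_real lam) F z * inv_kernel x z) + q * (rescale (of_real lam) G z * inv_kernel x z)" for z
      by (simp add: rescale_def algebra_simps)
    then have "bargmann_inv (rescale (of_real lam) (\<lambda>z. p * F z + q * G z)) x
      = p * bargmann_inv (rescale (of_real lam) F) x + q * bargmann_inv (rescale (of_real lam) G) x"
      unfolding bargmann_inv_def
      by (simp only: Bochner_Integration.integral_add[OF j[OF that(1)] j[OF that(2)]] integral_mult_right_zero)
    then show ?thesis by (simp add: Y_def algebra_simps)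
  qed
  ultimately show ?thesis
    unfolding bounded_map_on_def by (intro conjI ballI allI exI[of _ "D * (y0 * (C * inv_const a))"]) simp_all
qed

text \<open>\<open>X f\<close> is also \<open>A (\<G> f)\<close>, so injectivity of \<open>A\<close>
  kills \<open>\<G> f\<close> and with it the Mehler transform of \<open>cc * f\<close>. On the
  Bargmann side that transform is an invertible dilation, whence \<open>A f = 0\<close>.\<close>

lemma X_injective:
  assumes f: "f \<in> L2" and 0: "AE z in \<mu>. X f z = 0"
  shows "AE x in lborel. f x = 0"
proof -
  have Gf: "\<G> f \<in> L2" using map_in[OF l2_subspace_square_integrable l2_subspace_square_integrable bounded_G f] .
  have "X f holomorphic_on UNIV" unfolding X_def by (intro L_holomorphic A_holomorphic f)
  then have "A (\<G> f) z = 0" for z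
    using entire_AE_zero[OF tpos _ 0] by (simp add: A_G[OF f] X_def)
  then have "AE x in lborel. \<G> f x = 0" by (intro A_injective Gf)
  with cc_nz_AE have "AE x in lborel. mehler \<gamma> (\<lambda>y. cc y * f y) x = 0"
    by eventually_elim (use g0_pos in \<open>auto simp: G_eq\<close>)
  then have "bargmann (mehler \<gamma> (\<lambda>y. cc y * f y)) w = bargmann (\<lambda>x. 0) w" for w
    using gauss_integrable_measurable[OF mehler_gauss_integrable[OF \<gamma> cc_gauss_integrable[OF f]]]
    by (intro bargmann_cong_AE) auto
  then have "bargmann (\<lambda>y. cc y * f y) (of_real lam * w) = 0" for w
    using \<gamma> by (simp add: bargmann_mehler[OF \<gamma> cc_gauss_integrable[OF f]] lam_def bargmann_def[of "\<lambda>x. 0"])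
  from this[of "b * _ / of_real lam"] have "A f z = 0" for z
    using lam by (simp add: A_eq)
  then show ?thesis by (rule A_injective[OF f])
qed

text \<open>The Bargmann transform recovers \<open>F\<close> at all points
  \<open>of_real lam * w\<close>, and these fill the plane.\<close>

lemma Y_injective:
  assumes F: "F \<in> H" and 0: "AE x in lborel. Y F x = 0"
  shows "F z = 0"
proof -
  obtain K where K: "\<And>z. cmod (F z) \<le> K * exp (\<alpha> * (cmod z)\<^sup>2)" using H_bound'[OF F] by blast
  note r = bargmann_inv_rescale[OF H_D[OF F] K \<alpha>_lam_less]
  from 0 cc_nz_AE have "AE x in lborel. bargmann_inv (rescale (of_real lam) F) x = 0"
    by eventually_elim (use y0_pos in \<open>auto simp: Y_def\<close>)
  then have "bargmann (bargmann_inv (rescale (of_real lam) F)) w = bargmann (\<lambda>x. 0) w" for w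
    using gauss_integrable_measurable[OF r(1)] by (intro bargmann_cong_AE) auto
  then have "of_real (sqrt (2 * pi)) * F (of_real lam * (z / of_real lam)) = 0"
    unfolding r(2)[symmetric] by (simp add: bargmann_def[of "\<lambda>x. 0"])
  then show ?thesis using lam by simp
qed

lemma square_intertwined_ops: "square_intertwined \<mu> H \<L> lborel L2 \<G> X Y"
proof (rule square_intertwinedI)
  show "l2_subspace \<mu> H" by (rule l2_subspace_HL2[OF tpos])
  show "l2_subspace lborel L2" by (rule l2_subspace_square_integrable)
  show "AE x in \<mu>. \<L> (X f) x = X (\<G> f) x" if "f \<in> L2" for f
  proof -
    have "A (\<G> f) = \<L> (A f)" by (rule ext) (rule A_G[OF that])
    then show ?thesis by (simp add: X_def)
  qed
  show "AE x in \<mu>. X (Y F) x = \<L> (\<L> F) x" if "F \<in> H" for F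
  proof -
    have "A (Y F) = \<L> F" by (rule ext) (rule A_Y[OF that])
    then show ?thesis by (simp add: X_def)
  qed
qed (use bounded_L bounded_G bounded_X bounded_Y X_injective Y_injective in auto)

sublocale square_intertwined \<mu> H \<L> lborel L2 \<G> X Y
  by (rule square_intertwined_ops)

section \<open>The inverse transform on eigenfunctions\<close>

abbreviation "R \<equiv> ruelle_to_gutzwiller \<beta>"

definition c1 :: real where "c1 = (1 / (2 * pi)) powr (1/4)"

text \<open>The prefactors of the two transforms, with the Jacobian contained in \<open>a0\<close>,
  compensate the \<open>sqrt (2 * pi)\<close> produced by
  \<open>bargmann_bargmann_inv\<close>.\<close>

lemma c1_a0: "a0 * c1 * sqrt (2 * pi) = 1"
proof -
  have "(8 * pi) powr (1/4) * c1 = 4 powr (1/4)"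
    unfolding c1_def by (subst powr_mult[symmetric]) auto
  also have "4 powr (1/4) = (2 powr 2) powr (1/4 :: real)" by simp
  also have "\<dots> = sqrt 2" unfolding powr_powr by (simp add: powr_half_sqrt)
  finally have "(8 * pi) powr (1/4) * c1 = sqrt 2" .
  then have "a0 * c1 = sqrt 2 / (2 * sqrt pi)" by (simp add: a0_def)
  then show ?thesis by (simp add: real_sqrt_mult)
qed

lemma gutzwiller_integrand_eq: "gutzwiller_integrand \<beta> F x z = rescale 1 F z * inv_kernel x z"
  by (simp add: gutzwiller_integrand_def rescale_def inv_kernel_def b_def)

lemma R_eq: "R F x = of_real c1 * (1 / cc x) * bargmann_inv (rescale 1 F) x"
  by (simp add: ruelle_to_gutzwiller_def gutzwiller_integrand_eq bargmann_inv_def c1_def cc_def b_def)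

lemma R_measurable:
  assumes "F holomorphic_on UNIV"
  shows "R F \<in> borel_measurable borel"
proof -
  note [measurable] = entire_measurable[OF rescale_holomorphic[OF assms]]
  show ?thesis unfolding R_eq[abs_def] by measurable
qed

context
  fixes F :: "complex \<Rightarrow> complex" and K
  assumes F: "F holomorphic_on UNIV" and K: "\<And>z. cmod (F z) \<le> K * exp (\<alpha>' * (cmod z)\<^sup>2)"
begin

lemmas inv1 = bargmann_inv_rescale[OF F K \<alpha>'_less']

lemma cc_R_AE: "AE x in lborel. cc x * R F x = of_real c1 * bargmann_inv (rescale 1 F) x"
  using cc_nz_AE by eventually_elim (simp add: R_eq)

lemma bargmann_c1_inv: "of_real a0 * bargmann (\<lambda>x. of_real c1 * bargmann_inv (rescale 1 F) x) (b * z) = F z"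
proof -
  have "of_real a0 * bargmann (\<lambda>x. of_real c1 * bargmann_inv (rescale 1 F) x) (b * z) = of_real (a0 * c1 * sqrt (2 * pi)) * F z"
    unfolding bargmann_scale inv1(2) by simp
  then show ?thesis by (simp add: c1_a0)
qed

lemma A_R: "A (R F) z = F z"
proof -
  note [measurable] = R_measurable[OF F] gauss_integrable_measurable[OF inv1(1)]
  have "bargmann (\<lambda>x. cc x * R F x) (b * z) = bargmann (\<lambda>x. of_real c1 * bargmann_inv (rescale 1 F) x) (b * z)"
    using cc_R_AE by (intro bargmann_cong_AE) auto
  then show ?thesis by (simp add: A_eq bargmann_c1_inv)
qed

lemma gutzwiller_integrand_integrable: "integrable lborel (gutzwiller_integrand \<beta> F x)"
  using inv1(3) by (simp add: gutzwiller_integrand_eq[abs_def])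

text \<open>The comparison is made between \<open>cc * R F\<close> and \<open>cc * g\<close>, where
  injectivity of \<open>bargmann\<close> is available before \<open>R F\<close> is known to be
  square integrable. It serves both for \<open>R (A f) = f\<close> and for putting
  \<open>R F\<close> into L2.\<close>

lemma R_unique:
  assumes g: "gauss_integrable (\<lambda>x. cc x * g x)" and eq: "\<And>z. A g z = F z"
  shows "AE x in lborel. R F x = g x"
proof -
  have "gauss_integrable (\<lambda>x. of_real c1 * bargmann_inv (rescale 1 F) x)"
    by (rule gauss_integrable_mult[OF inv1(1), where K = "\<bar>c1\<bar>" and k = 0]) auto
  moreover have "bargmann (\<lambda>x. of_real c1 * bargmann_inv (rescale 1 F) x) w = bargmann (\<lambda>x. cc x * g x) w" for w
  proof -
    have "of_real a0 * bargmann (\<lambda>x. of_real c1 * bargmann_inv (rescale 1 F) x) (b * (w / b)) = of_real a0 * bargmann (\<lambda>x. cc x * g x) (b * (w / b))"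
      unfolding bargmann_c1_inv using eq[of "w / b"] by (simp add: A_eq)
    then show ?thesis using a0_pos b_nz by simp
  qed
  ultimately have "AE x in lborel. of_real c1 * bargmann_inv (rescale 1 F) x = cc x * g x"
    by (intro bargmann_eqI_AE g)
  with cc_R_AE cc_nz_AE show ?thesis by eventually_elim simp
qed

end

text \<open>An eigenfunction is its image under \<open>\<L>\<close> divided by \<rho>, so it
  inherits the smaller rate \<alpha>'. Starting from a bound rather than from \<open>H\<close> lets
  this serve for \<open>A f\<close> before \<open>A f \<in> H\<close> is known.\<close>

lemma eigenvalue_bound:
  assumes F: "F holomorphic_on UNIV" "\<And>z. cmod (F z) \<le> K * exp (\<alpha> * (cmod z)\<^sup>2)"
    and e: "\<And>z. \<L> F z = \<rho> * F z" and \<rho>: "\<rho> \<noteq> 0"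
  obtains K' where "\<And>z. cmod (F z) \<le> K' * exp (\<alpha>' * (cmod z)\<^sup>2)"
proof -
  obtain D where D: "0 \<le> D" "\<And>F K z. \<forall>z. cmod (F z) \<le> K * exp (\<alpha> * (cmod z)\<^sup>2) \<Longrightarrow>
    cmod (\<L> F z) \<le> D * K * exp (\<alpha>' * (cmod z)\<^sup>2)" using L_bound by blast
  have "cmod (F z) \<le> D * K / cmod \<rho> * exp (\<alpha>' * (cmod z)\<^sup>2)" for z
    using D(2)[of F K z] F(2) \<rho> by (simp add: e norm_mult field_simps)
  then show ?thesis by (rule that)
qed

lemma eigenfunction_G:
  assumes "eigenfunction lborel L2 \<G> \<rho> f"
  shows "integrable lborel (ruelle_integrand \<beta> f z)"
    and "eigenfunction \<mu> H \<L> \<rho> (A f)"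
    and "AE x in lborel. R (A f) x = f x"
proof -
  have f: "f \<in> L2" and nz: "\<not> (AE x in lborel. f x = 0)" and Gf: "AE x in lborel. \<G> f x = \<rho> * f x"
    using assms by (auto simp: eigenfunction_def)
  show "integrable lborel (ruelle_integrand \<beta> f z)" by (rule ruelle_integrand_integrable[OF f])
  \<comment> \<open>With eigenvalue 0 the injectivity of \<open>\<G>\<close> would make
    \<open>f\<close> vanish almost everywhere.\<close>
  have \<rho>: "\<rho> \<noteq> 0" using S_inj[OF f] nz Gf by auto
  have L: "\<L> (A f) z = \<rho> * A f z" for z
  proof -
    have "A (\<G> f) z = A (\<lambda>x. \<rho> * f x) z"
      using square_integrableD(1)[OF f] by (intro A_cong_AE G_measurable f Gf) auto
    then show ?thesis by (simp add: A_G[OF f] A_scale)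
  qed
  obtain C where C: "\<And>f z. f \<in> L2 \<Longrightarrow> cmod (A f z) \<le> C * l2_norm lborel f * exp (\<alpha> * (cmod z)\<^sup>2)"
    using A_bound by blast
  obtain K where K: "\<And>z. cmod (A f z) \<le> K * exp (\<alpha>' * (cmod z)\<^sup>2)"
    using eigenvalue_bound[OF A_holomorphic[OF f] C[OF f] L \<rho>] by blast
  have "A f \<in> H"
    using \<alpha>'_less by (intro HL2_of_bound(1)[OF tpos A_holomorphic[OF f] K]) simp
  moreover have "\<not> (AE z in \<mu>. A f z = 0)"
    using entire_AE_zero[OF tpos A_holomorphic[OF f]] A_injective[OF f] nz by blast
  ultimately show "eigenfunction \<mu> H \<L> \<rho> (A f)" by (simp add: eigenfunction_def L)
  show "AE x in lborel. R (A f) x = f x"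
    by (rule R_unique[OF A_holomorphic[OF f] K cc_gauss_integrable[OF f]]) simp
qed

lemma eigenfunction_L:
  assumes "eigenfunction \<mu> H \<L> \<rho> F"
  shows "integrable lborel (gutzwiller_integrand \<beta> F x)"
    and "eigenfunction lborel L2 \<G> \<rho> (R F)"
    and "A (R F) z = F z"
proof -
  have F: "F \<in> H" and nz: "\<not> (AE z in \<mu>. F z = 0)" and LF: "AE z in \<mu>. \<L> F z = \<rho> * F z"
    using assms by (auto simp: eigenfunction_def)
  interpret swapped: square_intertwined lborel L2 \<G> \<mu> H \<L> Y X by (rule swap)
  have \<rho>: "\<rho> \<noteq> 0" using swapped.S_inj[OF F] nz LF by auto
  have L: "\<L> F z = \<rho> * F z" for z
  proof -
    have "(\<lambda>z. \<L> F z - \<rho> * F z) holomorphic_on UNIV"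
      by (intro holomorphic_intros L_holomorphic H_D F)
    from entire_AE_zero[OF tpos this] LF show ?thesis by simp
  qed
  obtain K where "\<And>z. cmod (F z) \<le> K * exp (\<alpha> * (cmod z)\<^sup>2)" using H_bound'[OF F] by blast
  then obtain K where K: "\<And>z. cmod (F z) \<le> K * exp (\<alpha>' * (cmod z)\<^sup>2)"
    using eigenvalue_bound[OF H_D[OF F] _ L \<rho>] by blast
  note hK = H_D[OF F] K
  show "integrable lborel (gutzwiller_integrand \<beta> F x)" by (rule gutzwiller_integrand_integrable[OF hK])
  show "A (R F) z = F z" by (rule A_R[OF hK])
  \<comment> \<open>A square integrable preimage of \<open>F\<close>: \<open>A (Y F)\<close> is
    \<open>\<L> F\<close>, which is \<rho> times \<open>F\<close>. \<open>R_unique\<close> then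
    identifies \<open>R F\<close> with \<open>g\<close>, and this is what makes \<open>R F\<close>
    square integrable despite the division by \<open>cc\<close>.\<close>
  define g where "g x = (1 / \<rho>) * Y F x" for x
  have g: "g \<in> L2"
    using square_integrable_lincomb(1)[OF Y_in[OF F] Y_in[OF F], of "1 / \<rho>" 0] by (simp add: g_def[abs_def])
  have Ag: "A g z = F z" for z
    using \<rho> A_scale[of "1 / \<rho>" "Y F"] by (simp add: g_def[abs_def] A_Y[OF F] L)
  have Rg: "AE x in lborel. R F x = g x"
    by (rule R_unique[OF hK cc_gauss_integrable[OF g] Ag])
  have Rm: "R F \<in> borel_measurable lborel" using R_measurable[OF H_D[OF F]] by simp
  have "integrable lborel (\<lambda>x. (cmod (R F x))\<^sup>2)"
  proof (rule integrable_cong_AE_imp[OF square_integrableD(2)[OF g]])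
    show "(\<lambda>x. (cmod (R F x))\<^sup>2) \<in> borel_measurable lborel" using Rm by measurable
    show "AE x in lborel. (cmod (g x))\<^sup>2 = (cmod (R F x))\<^sup>2" using Rg by eventually_elim simp
  qed
  with Rm have R: "R F \<in> L2" by (simp add: square_integrable_def)
  have "AE x in lborel. \<G> (R F) x = \<rho> * R F x"
  proof (rule A_eqI)
    show "\<G> (R F) \<in> L2" by (rule S_in[OF R])
    show "(\<lambda>x. \<rho> * R F x) \<in> L2"
      using square_integrable_lincomb(1)[OF R R, of \<rho> 0] by simp
    fix z
    have "A (R F) = F" by (rule ext) (rule A_R[OF hK])
    then show "A (\<G> (R F)) z = A (\<lambda>x. \<rho> * R F x) z"
      by (simp add: A_G[OF R] A_scale L)
  qed
  moreover have "\<not> (AE x in lborel. R F x = 0)"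
  proof
    assume "AE x in lborel. R F x = 0"
    then have "F z = A (\<lambda>x. 0) z" for z
      using A_cong_AE[of "R F" "\<lambda>x. 0" z] R_measurable[OF H_D[OF F]] by (simp add: A_R[OF hK])
    then have "F z = 0" for z using A_scale[of 0 "\<lambda>x. 0"] by simp
    then show False using nz by simp
  qed
  ultimately show "eigenfunction lborel L2 \<G> \<rho> (R F)"
    using R by (simp add: eigenfunction_def)
qed

end

theorem theorem4p10:
  fixes \<gamma> lam \<beta> :: real
  assumes "lam = exp (- \<gamma>)" and "0 < lam" and "lam < 1" and "\<beta> \<noteq> 0"
  defines "\<mu> \<equiv> fock_measure (\<bar>\<beta>\<bar> / pi)"
    and "H \<equiv> HL2 (\<bar>\<beta>\<bar> / pi)"
    and "L2 \<equiv> square_integrable (lborel :: real measure)"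
    and "\<L> \<equiv> ruelle_op lam \<beta>"
    and "\<G> \<equiv> gutzwiller_op \<gamma> \<beta>"
  shows
    "bounded_operator_on \<mu> H \<L> \<and> bounded_operator_on lborel L2 \<G> \<and>
     eigenvalues \<mu> H \<L> = eigenvalues lborel L2 \<G> \<and>
     (\<forall>\<rho>. geometric_multiplicity \<mu> H \<L> \<rho> = geometric_multiplicity lborel L2 \<G> \<rho>) \<and>
     (\<forall>\<rho>. algebraic_multiplicity \<mu> H \<L> \<rho> = algebraic_multiplicity lborel L2 \<G> \<rho>) \<and>
     op_spectrum \<mu> H \<L> = op_spectrum lborel L2 \<G> \<and>
     (\<forall>\<rho> f. eigenfunction lborel L2 \<G> \<rho> f \<longrightarrow>
        (\<forall>z. integrable lborel (ruelle_integrand \<beta> f z)) \<and>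
        eigenfunction \<mu> H \<L> \<rho> (gutzwiller_to_ruelle \<beta> f) \<and>
        (AE \<xi> in lborel. ruelle_to_gutzwiller \<beta> (gutzwiller_to_ruelle \<beta> f) \<xi> = f \<xi>)) \<and>
     (\<forall>\<rho> F. eigenfunction \<mu> H \<L> \<rho> F \<longrightarrow>
        (\<forall>\<xi>. integrable lborel (gutzwiller_integrand \<beta> F \<xi>)) \<and>
        eigenfunction lborel L2 \<G> \<rho> (ruelle_to_gutzwiller \<beta> F) \<and>
        (\<forall>z. gutzwiller_to_ruelle \<beta> (ruelle_to_gutzwiller \<beta> F) z = F z))"
proof -
  interpret kac_baker \<gamma> lam \<beta> by unfold_locales (use assms in auto)
  show ?thesis
    unfolding \<mu>_def H_def L2_def \<L>_def \<G>_def bounded_operator_on_iff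
    using bounded_L bounded_G same_spectral_data eigenfunction_G eigenfunction_L by blast
qed

end
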